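(* Let $R=\{R_t:t\ge0\}$ be a 3-dimensional Bessel process started from $x>0$, with $\mathbf{E}_x$ the corresponding expectation. Let $\theta>0$, $p\ge0$ and $q\ge0$, and put $$\widehat I_\infty(p,q):=\int_0^\infty\Big(\frac{p}{\exp(\theta R_s)-1}+\frac{q}{(\exp(\theta R_s)-1)^2}\Big)\,ds .$$ Let $$\alpha=\frac12+\frac12\sqrt{1+\frac{8q}{\theta^2}}+\frac1\theta\sqrt{2(q-p)},\qquad \beta=\frac12+\frac12\sqrt{1+\frac{8q}{\theta^2}}-\frac1\theta\sqrt{2(q-p)},$$ and $\gamma=\alpha+\beta=1+\sqrt{1+8q/\theta^2}$. Then $$\mathbf{E}_x\big(\exp(-\widehat I_\infty(p,q))\big)=\frac{(1-e^{-\theta x})^{\gamma/2}\,\Gamma(\alpha)\,\Gamma(\beta)}{x\,\theta\,\Gamma(\gamma)}\,F\big(\alpha,\beta,\gamma;1-e^{-\theta x}\big)$$ $$=\frac{(1-e^{-\theta x})^{\gamma/2}}{x\,\theta}\int_0^1 t^{\alpha-1}(1-t)^{\beta-1}\big(1-t(1-e^{-\theta x})\big)^{\alpha-\gamma}\,dt ,$$ where $F$ is Gauss' hypergeometric function.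
   Context: The 3-dimensional Bessel process is the diffusion on $(0,\infty)$ with generator $\frac12\frac{d^2}{dx^2}+\frac1x\frac{d}{dx}$ (the law of the Euclidean norm of a 3-dimensional Brownian motion). Gauss' hypergeometric function is, for $0<x<1$, $$F(\alpha,\beta,\gamma;x)=\frac{\Gamma(\gamma)}{\Gamma(\beta)\Gamma(\alpha)}\sum_{n=0}^\infty\frac{\Gamma(\alpha+n)\Gamma(\beta+n)}{\Gamma(\gamma+n)}\frac{x^n}{n!},$$ where $\gamma$ is real and $\alpha,\beta$ may be real or complex conjugates of each other. When $q<p$, $\sqrt{2(q-p)}$ is taken to be purely imaginary, so that $\alpha$ and $\beta$ are complex conjugates. *)

theory Defs
  imports "HOL-Probability.Probability"
begin

text \<open>
  Standard Brownian motion in a Euclidean space, started at the point \<open>b\<close>, with time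
  parameter \<open>t \<ge> 0\<close>; an increment over \<open>[s, t]\<close> has the law \<open>N(0, (t - s) Id)\<close>.
\<close>

definition brownian_motion ::
  "'w measure \<Rightarrow> (real \<Rightarrow> 'w \<Rightarrow> 'a :: euclidean_space) \<Rightarrow> 'a \<Rightarrow> bool" where
  "brownian_motion N B b \<longleftrightarrow>
     prob_space N \<and>
     (\<forall>t\<ge>0. B t \<in> borel_measurable N) \<and>
     (AE \<omega> in N. B 0 \<omega> = b) \<and>
     (\<forall>\<omega>\<in>space N. continuous_on {0..} (\<lambda>t. B t \<omega>)) \<and>
     (\<forall>s t. 0 \<le> s \<and> s < t \<longrightarrow>
        distributed N lborel (\<lambda>\<omega>. B t \<omega> - B s \<omega>)
          (\<lambda>y. ennreal (\<Prod>e\<in>Basis. normal_density 0 (sqrt (t - s)) (y \<bullet> e)))) \<and>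
     (\<forall>(n :: nat) (\<tau> :: nat \<Rightarrow> real). 0 \<le> \<tau> 0 \<and> mono \<tau> \<longrightarrow>
        prob_space.indep_vars N (\<lambda>_. borel) (\<lambda>i \<omega>. B (\<tau> (Suc i)) \<omega> - B (\<tau> i) \<omega>) {..<n})"

text \<open>
  A 3-dimensional Bessel process started from \<open>x\<close> is a continuous process whose law, on
  the product space indexed by the times \<open>t \<ge> 0\<close>, is that of the Euclidean norm of a
  3-dimensional Brownian motion started at some point of norm \<open>x\<close>. The Brownian motion
  need not live on the probability space of \<open>R\<close>. Taking its sample points of type
  \<open>real \<Rightarrow> real ^ 3\<close> is no restriction, as any Brownian motion can be realised on a path space.
\<close>

definition bessel3_process :: "'w measure \<Rightarrow> (real \<Rightarrow> 'w \<Rightarrow> real) \<Rightarrow> real \<Rightarrow> bool" where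
  "bessel3_process M R x \<longleftrightarrow>
     prob_space M \<and>
     (\<forall>t\<ge>0. R t \<in> borel_measurable M) \<and>
     (\<forall>\<omega>\<in>space M. continuous_on {0..} (\<lambda>t. R t \<omega>)) \<and>
     (\<forall>\<omega>\<in>space M. \<forall>t\<ge>0. R t \<omega> \<ge> 0) \<and>
     (\<exists>(N :: (real \<Rightarrow> real ^ 3) measure)
         (B :: real \<Rightarrow> (real \<Rightarrow> real ^ 3) \<Rightarrow> real ^ 3) (b :: real ^ 3).
        brownian_motion N B b \<and> norm b = x \<and>
        distr M (\<Pi>\<^sub>M t\<in>{0..}. borel) (\<lambda>\<omega>. \<lambda>t\<in>{0..}. R t \<omega>) =
        distr N (\<Pi>\<^sub>M t\<in>{0..}. borel) (\<lambda>\<omega>. \<lambda>t\<in>{0..}. norm (B t \<omega>)))"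

text \<open>
  The functional takes values in \<open>[0, \<infinity>]\<close>. The divisions are those of \<open>ennreal\<close>, so at
  \<open>R s \<omega> = 0\<close>, which a path reaches with probability 0 only, a term with a positive numerator is
  \<open>\<infinity>\<close> and one with numerator 0 is 0.
\<close>

definition I_hat ::
  "real \<Rightarrow> (real \<Rightarrow> 'w \<Rightarrow> real) \<Rightarrow> real \<Rightarrow> real \<Rightarrow> 'w \<Rightarrow> ennreal" where
  "I_hat \<theta> R p q \<omega> =
     (\<integral>\<^sup>+ s\<in>{0..}. (ennreal p / ennreal (exp (\<theta> * R s \<omega>) - 1) +
                  ennreal q / ennreal ((exp (\<theta> * R s \<omega>) - 1)\<^sup>2)) \<partial>lborel)"

text \<open>The function \<open>a \<mapsto> exp (- a)\<close> on \<open>[0, \<infinity>]\<close>.\<close>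

definition exp_neg :: "ennreal \<Rightarrow> real" where
  "exp_neg a = (if a = \<infinity> then 0 else exp (- enn2real a))"

definition gauss_F :: "complex \<Rightarrow> complex \<Rightarrow> real \<Rightarrow> real \<Rightarrow> complex" where
  "gauss_F \<alpha> \<beta> \<gamma> x =
     complex_of_real (Gamma \<gamma>) / (Gamma \<beta> * Gamma \<alpha>) *
     (\<Sum>n. Gamma (\<alpha> + of_nat n) * Gamma (\<beta> + of_nat n) / complex_of_real (Gamma (\<gamma> + real n)) *
          (complex_of_real x ^ n / fact n))"

end

(*
  With u the right-hand side, v(x) = x u(x) satisfies v'' = 2 V v, where V is the integrand of the
  functional seen as a function of the position, v(0+) = 0 and v(x)/x -> 1. Integrating by parts
  twice, 1 - u = G(V u), where G f(y) = E_y int_0^infinity f(R_t) dt has the kernel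
  (r/y) 2 min(y, r), because the transition density of R is (r/y) (phi_t(r-y) - phi_t(r+y)) with
  phi_t the Gaussian density.

  Let A_s = int_0^s V(R_r) dr. By the Markov property at time s,
    E int V(R_s) e^(-A_s) (1 - u(R_s)) ds = E int V(R_s) e^(-A_s) int_s^infinity (V u)(R_t) dt ds
      = E int (V u)(R_t) (1 - e^(-A_t)) dt,
  and adding E int (V u)(R_s) e^(-A_s) ds on both sides leaves E(1 - e^(-A_infinity)) = 1 - u(x).
  As V is singular at 0, the exponent is first built from the
  bounded continuous functions V(max(r, 1/m)).
*)
theory Submission
  imports Defs "HOL-Real_Asymp.Real_Asymp"
begin

section \<open>The Gamma coefficients and their generating function\<close>

text \<open>The normalisation v(x)/x -> 1 explains the Gamma quotient in the formula. As \<gamma> =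
  \<alpha> + \<beta>, the coefficients Gamma(\<alpha>+n) Gamma(\<beta>+n) / (Gamma(\<gamma>+n) n!)
  behave like 1/n, so their power series grows like -ln(1-z), and this is exactly \<theta> x at z =
  1 - e^(-\<theta> x). The exponent \<gamma>/2 is the root of g (g - 1) = 2q/\<theta>^2 that is at
  least 1; it makes v vanish at 0.

  The law of R is used only through finitely many times, so an exponential path functional can enter
  the Markov property only as a limit of functions of finitely many positions. Riemann sums provide
  it for bounded continuous integrands, whereas V may grow like 1/r^2 at 0, and positivity of the
  path is shown only at almost every time. After the cutoff, u still belongs to V and not to the
  cut-off potential, so the identity acquires a defect. The defect tends to 0 because G V(x) is
  finite: the weight r min(y, r) of the Green kernel balances the singularity.\<close>

lemma nn_integral_FTC_einterval:
  fixes f F :: "real \<Rightarrow> real" and a b :: ereal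
  assumes "a < b"
    and F: "\<And>x. a < ereal x \<Longrightarrow> ereal x < b \<Longrightarrow> (F has_real_derivative f x) (at x)"
    and cont: "\<And>x. a < ereal x \<Longrightarrow> ereal x < b \<Longrightarrow> isCont f x"
    and nonneg: "\<And>x. a < ereal x \<Longrightarrow> ereal x < b \<Longrightarrow> 0 \<le> f x"
    and A: "((F \<circ> real_of_ereal) \<longlongrightarrow> A) (at_right a)"
    and B: "((F \<circ> real_of_ereal) \<longlongrightarrow> B) (at_left b)"
  shows "(\<integral>\<^sup>+x\<in>einterval a b. ennreal (f x) \<partial>lborel) = ennreal (B - A)"
proof -
  have I: "set_integrable lborel (einterval a b) f" "(LBINT x=a..b. f x) = B - A"
    using interval_integral_FTC_nonneg[of a b F f A B] assms by auto
  have "(\<integral>\<^sup>+x\<in>einterval a b. ennreal (f x) \<partial>lborel) = (\<integral>\<^sup>+x. ennreal (indicator (einterval a b) x *\<^sub>R f x) \<partial>lborel)"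
    by (intro nn_integral_cong) (auto simp: indicator_def)
  also have "\<dots> = ennreal (LINT x:einterval a b|lborel. f x)"
    unfolding set_lebesgue_integral_def using I(1) nonneg
    by (intro nn_integral_eq_integral) (auto simp: set_integrable_def indicator_def einterval_def)
  also have "(LINT x:einterval a b|lborel. f x) = B - A"
    using I(2) less_imp_le[OF assms(1)] by (simp add: interval_lebesgue_integral_def)
  finally show ?thesis .
qed

text \<open>By Gauss' product, Gamma(z+n+1) is Gamma(z) n! n^z divided by a sequence tending to
  Gamma(z). In the quotient the powers of n cancel because \<alpha> + \<beta> = \<gamma>, and the
  limits of the remaining factors cancel the constants.\<close>

lemma Gamma_coefficient_limit:
  fixes \<alpha> \<beta> \<gamma> :: complex
  assumes \<alpha>: "\<alpha> \<notin> \<int>\<^sub>\<le>\<^sub>0" and \<beta>: "\<beta> \<notin> \<int>\<^sub>\<le>\<^sub>0" and \<gamma>: "\<gamma> \<notin> \<int>\<^sub>\<le>\<^sub>0" and sum: "\<alpha> + \<beta> = \<gamma>"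
  shows "(\<lambda>n. of_nat n * (Gamma (\<alpha> + of_nat n) * Gamma (\<beta> + of_nat n) / (Gamma (\<gamma> + of_nat n) * fact n)))
    \<longlonglongrightarrow> 1"
proof -
  define a where "a n = Gamma (\<alpha> + of_nat n) * Gamma (\<beta> + of_nat n) / (Gamma (\<gamma> + of_nat n) * fact n)" for n :: nat
  have G0: "Gamma z \<noteq> 0" if "z \<notin> \<int>\<^sub>\<le>\<^sub>0" for z :: complex using that by (simp add: Gamma_eq_zero_iff)
  have shift: "Gamma (z + of_nat (Suc n)) = Gamma z * (fact n * exp (z * of_real (ln (real n))) / Gamma_series z n)"
    if z: "z \<notin> \<int>\<^sub>\<le>\<^sub>0" for z :: complex and n
  proof -
    have "pochhammer z (n + 1) \<noteq> 0" using z by (auto simp: pochhammer_eq_0_iff)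
    then show ?thesis
      using pochhammer_Gamma[OF z, of "n + 1"] G0[OF z] by (simp add: Gamma_series_def field_simps)
  qed
  have eq: "of_nat (Suc n) * a (Suc n) = (Gamma \<alpha> * Gamma \<beta> / Gamma \<gamma>) *
      (Gamma_series \<gamma> n / (Gamma_series \<alpha> n * Gamma_series \<beta> n))" for n
  proof -
    have e: "exp (\<gamma> * of_real (ln (real n))) = exp (\<alpha> * of_real (ln (real n))) * exp (\<beta> * of_real (ln (real n)))"
      by (simp add: sum[symmetric] distrib_right exp_add)
    have cancel: "k * ((GA * (F * EA / SA)) * (GB * (F * EB / SB)) / ((GC * (F * (EA * EB) / SC)) * (k * F))) =
       GA * GB / GC * (SC / (SA * SB))" if "k \<noteq> 0" "F \<noteq> 0" "EA \<noteq> 0" "EB \<noteq> 0" for k GA F EA SA GB EB SB GC SC :: complex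
      using that by (simp add: field_simps)
    have f: "(fact (Suc n) :: complex) = of_nat (Suc n) * fact n" by simp
    show ?thesis
      unfolding a_def shift[OF \<alpha>] shift[OF \<beta>] shift[OF \<gamma>] e f
      by (rule cancel) (auto simp del: of_nat_Suc)
  qed
  have "(\<lambda>n. (Gamma \<alpha> * Gamma \<beta> / Gamma \<gamma>) *
      (Gamma_series \<gamma> n / (Gamma_series \<alpha> n * Gamma_series \<beta> n)))
      \<longlonglongrightarrow> (Gamma \<alpha> * Gamma \<beta> / Gamma \<gamma>) * (Gamma \<gamma> / (Gamma \<alpha> * Gamma \<beta>))"
    by (intro tendsto_intros Gamma_series_LIMSEQ) (use G0 \<alpha> \<beta> in auto)
  also have "(Gamma \<alpha> * Gamma \<beta> / Gamma \<gamma>) * (Gamma \<gamma> / (Gamma \<alpha> * Gamma \<beta>)) = 1"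
    using G0 \<alpha> \<beta> \<gamma> by simp
  finally have "(\<lambda>n. of_nat (Suc n) * a (Suc n)) \<longlonglongrightarrow> 1" by (simp only: eq)
  then have "(\<lambda>n. of_nat n * a n) \<longlonglongrightarrow> 1" by (rule LIMSEQ_imp_Suc)
  then show ?thesis by (simp add: a_def)
qed

lemma not_nonpos_Ints_Re_pos: "Re z > 0 \<Longrightarrow> z \<notin> \<int>\<^sub>\<le>\<^sub>0"
  by (auto elim!: nonpos_Ints_cases)

text \<open>Only the real numbers \<alpha> + \<beta> and \<alpha> \<beta> enter the recursion, so
  real and complex conjugate parameters need no case distinction. Positivity of \<open>P\<close>
  keeps every ratio of consecutive coefficients positive.\<close>

lemma euler_coefficients_real:
  fixes \<alpha> \<beta> :: complex and \<gamma> P :: real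
  assumes Re: "Re \<alpha> > 0" "Re \<beta> > 0" and sum: "\<alpha> + \<beta> = of_real \<gamma>" and prod: "\<alpha> * \<beta> = of_real P" and P: "P > 0"
  obtains A :: "nat \<Rightarrow> real" where
    "\<And>n. Gamma (\<alpha> + of_nat n) * Gamma (\<beta> + of_nat n) / (of_real (Gamma (\<gamma> + real n)) * fact n) = of_real (A n)"
    "\<And>n. A n > 0"
    "\<And>n. A (Suc n) * (real n + 1) * (\<gamma> + real n) = A n * ((real n)\<^sup>2 + \<gamma> * real n + P)"
    "(\<lambda>n. real n * A n) \<longlonglongrightarrow> 1"
proof -
  define a where "a n = Gamma (\<alpha> + of_nat n) * Gamma (\<beta> + of_nat n) / (of_real (Gamma (\<gamma> + real n)) * fact n)" for n :: nat
  have \<gamma>: "\<gamma> = Re \<alpha> + Re \<beta>" using sum by (metis Re_complex_of_real plus_complex.sel(1))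
  then have \<gamma>pos: "\<gamma> > 0" using Re by simp
  have nz: "Gamma z \<noteq> 0" if "Re z > 0" for z :: complex
    using not_nonpos_Ints_Re_pos[OF that] by (simp add: Gamma_eq_zero_iff)
  have step: "Gamma (z + of_nat (Suc n)) = (z + of_nat n) * Gamma (z + of_nat n)" if "Re z > 0" for z :: complex and n
    using Gamma_plus1[of "z + of_nat n"] not_nonpos_Ints_Re_pos[of "z + of_nat n"] that by (simp add: add_ac)
  have Gr: "complex_of_real (Gamma (\<gamma> + real n)) = Gamma (of_real \<gamma> + of_nat n)" for n
    by (metis Gamma_complex_of_real of_real_add of_real_of_nat_eq)
  have rec: "a (Suc n) * of_real ((real n + 1) * (\<gamma> + real n)) = a n * of_real ((real n)\<^sup>2 + \<gamma> * real n + P)" for n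
  proof -
    have 1: "(\<alpha> + of_nat n) * (\<beta> + of_nat n) = of_real ((real n)\<^sup>2 + \<gamma> * real n + P)"
      by (simp add: algebra_simps power2_eq_square prod[symmetric] sum[symmetric])
    have g: "of_real \<gamma> + of_nat n \<noteq> (0::complex)"
      using \<gamma>pos by (metis add_pos_nonneg of_nat_0_le_iff of_real_add of_real_eq_0_iff of_real_of_nat_eq less_irrefl)
    have nn: "of_nat n + 1 \<noteq> (0::complex)" by (metis of_nat_Suc of_nat_eq_0_iff Suc_not_Zero add.commute)
    have gz: "Gamma (of_real \<gamma> + of_nat n :: complex) \<noteq> 0" using \<gamma>pos by (intro nz) simp
    have cancel: "(xa * GA) * (xb * GB) / ((c * GC) * (k * F)) * (k * c) = GA * GB / (GC * F) * (xa * xb)"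
      if "c \<noteq> 0" "k \<noteq> 0" for xa GA xb GB c GC k F :: complex using that by (simp add: field_simps)
    have "a (Suc n) * of_real ((real n + 1) * (\<gamma> + real n)) =
       ((\<alpha> + of_nat n) * Gamma (\<alpha> + of_nat n)) * ((\<beta> + of_nat n) * Gamma (\<beta> + of_nat n))
       / (((of_real \<gamma> + of_nat n) * Gamma (of_real \<gamma> + of_nat n)) * ((of_nat n + 1) * fact n)) *
       ((of_nat n + 1) * (of_real \<gamma> + of_nat n))"
      unfolding a_def Gr step[OF Re(1)] step[OF Re(2)]
      by (subst step) (use \<gamma>pos in \<open>simp_all add: add_ac\<close>)
    also have "\<dots> = a n * ((\<alpha> + of_nat n) * (\<beta> + of_nat n))"
      unfolding a_def Gr by (rule cancel[OF g nn])
    finally show ?thesis by (simp only: 1)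
  qed
  have lim: "(\<lambda>n. of_nat n * a n) \<longlonglongrightarrow> 1"
    using Gamma_coefficient_limit[of \<alpha> \<beta> "of_real \<gamma>"] not_nonpos_Ints_Re_pos Re sum \<gamma>pos
    by (simp add: a_def Gr not_nonpos_Ints_Re_pos)
  have a0: "a 0 \<noteq> 0" unfolding a_def using Re nz[of \<alpha>] nz[of \<beta>] nz[of "of_real \<gamma>"] \<gamma>pos Gr[of 0] by auto
  text \<open>Each \<open>a n\<close> is a positive multiple of \<open>a 0\<close>, and then the limit 1 of \<open>n * a n\<close> forces \<open>a 0 > 0\<close>.\<close>
  define r where "r n = norm (a n) / norm (a 0)" for n
  have pos: "(real n)\<^sup>2 + \<gamma> * real n + P > 0" "(real n + 1) * (\<gamma> + real n) > 0" for n
    using P \<gamma>pos by (auto intro!: add_nonneg_pos mult_pos_pos)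
  have ar: "a n = a 0 * of_real (r n) \<and> r n > 0" for n
  proof (induction n)
    case 0 then show ?case using a0 by (simp add: r_def)
  next
    case (Suc n)
    define K where "K = ((real n)\<^sup>2 + \<gamma> * real n + P) / ((real n + 1) * (\<gamma> + real n))"
    have K: "K > 0" using pos[of n] by (simp add: K_def)
    have nz': "of_real ((real n + 1) * (\<gamma> + real n)) \<noteq> (0::complex)"
      using pos(2)[of n] by (metis less_irrefl of_real_eq_0_iff)
    have aS: "a (Suc n) = a n * of_real K"
      using rec[of n] nz' unfolding K_def of_real_divide by (simp only: times_divide_eq_right nonzero_eq_divide_eq not_False_eq_True)
    have "r (Suc n) = r n * K" using K by (simp add: r_def aS norm_mult)
    then show ?case using aS Suc.IH K by (simp add: mult_ac)
  qed
  have "(\<lambda>n. norm (of_nat n * a n) / norm (a 0)) \<longlonglongrightarrow> norm (1::complex) / norm (a 0)"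
    by (intro tendsto_intros lim) (use a0 in auto)
  then have rl: "(\<lambda>n. real n * r n) \<longlonglongrightarrow> 1 / norm (a 0)" by (simp add: r_def norm_mult)
  then have "(\<lambda>n. a 0 * of_real (real n * r n)) \<longlonglongrightarrow> a 0 * of_real (1 / norm (a 0))"
    by (intro tendsto_intros)
  moreover have "(\<lambda>n. a 0 * of_real (real n * r n)) = (\<lambda>n. of_nat n * a n)"
    by (subst ar) (auto simp: fun_eq_iff mult_ac)
  ultimately have "a 0 * of_real (1 / norm (a 0)) = 1" using lim LIMSEQ_unique by metis
  then have a0': "a 0 = of_real (norm (a 0))" using a0 by (simp add: field_simps)
  define A where "A n = norm (a n)" for n
  have aA: "a n = of_real (A n)" for n
    using ar[of n] a0' a0 by (metis A_def of_real_mult r_def nonzero_mult_div_cancel_left norm_eq_zero times_divide_eq_right)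
  show thesis
  proof (rule that[of A])
    show "Gamma (\<alpha> + of_nat n) * Gamma (\<beta> + of_nat n) / (of_real (Gamma (\<gamma> + real n)) * fact n) = of_real (A n)" for n
      using aA[of n] by (simp add: a_def)
    show "A n > 0" for n using ar[of n] a0 by (auto simp: A_def)
    have "complex_of_real (A (Suc n) * ((real n + 1) * (\<gamma> + real n))) = of_real (A n * ((real n)\<^sup>2 + \<gamma> * real n + P))" for n
      using rec[of n] by (simp only: aA of_real_mult)
    then show "A (Suc n) * (real n + 1) * (\<gamma> + real n) = A n * ((real n)\<^sup>2 + \<gamma> * real n + P)" for n
      by (simp only: of_real_eq_iff mult.assoc)
    have "(\<lambda>n. norm (of_nat n * a n)) \<longlonglongrightarrow> norm (1::complex)" by (intro tendsto_intros lim)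
    then show "(\<lambda>n. real n * A n) \<longlonglongrightarrow> 1" by (simp add: A_def norm_mult)
  qed
qed

section \<open>Power series whose coefficients are asymptotic to 1/n\<close>

lemma summable_power_series_harmonic:
  fixes A :: "nat \<Rightarrow> real"
  assumes lim: "(\<lambda>n. real n * A n) \<longlonglongrightarrow> 1" and w: "\<bar>w\<bar> < 1"
  shows "summable (\<lambda>n. A n * w ^ n)"
proof -
  obtain B where B: "\<bar>real n * A n\<bar> \<le> B" for n
    using convergent_imp_Bseq[OF convergentI[OF lim]] unfolding Bseq_def real_norm_def by blast
  show ?thesis
  proof (rule summable_comparison_test')
    show "summable (\<lambda>n. B * (\<bar>w\<bar> ^ n))" using w by (intro summable_mult summable_geometric) auto
    fix n :: nat assume n: "1 \<le> n"
    have "\<bar>A n\<bar> \<le> \<bar>real n * A n\<bar>" using n by (simp add: abs_mult mult_le_cancel_right1)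
    also have "\<dots> \<le> B" using B by simp
    finally show "norm (A n * w ^ n) \<le> B * \<bar>w\<bar> ^ n" by (simp add: abs_mult power_abs mult_right_mono)
  qed
qed

text \<open>An Abelian argument: compare with the series of z^n/n, whose sum is -ln(1-z). The
  coefficients differ by o(1/n), so the two series differ by a bounded head plus at most e/2 times
  the logarithm, and the diverging logarithm absorbs the head.\<close>

lemma abelian_log_asymptotics:
  fixes A :: "nat \<Rightarrow> real"
  assumes lim: "(\<lambda>n. real n * A n) \<longlonglongrightarrow> 1"
  shows "((\<lambda>z. (\<Sum>n. A n * z ^ n) / - ln (1 - z)) \<longlongrightarrow> 1) (at_left 1)"
proof -
  \<comment> \<open>Since \<open>1 / real 0\<close> is 0, the logarithmic series may run over all n
    and \<open>D 0\<close> is \<open>A 0\<close>. The maximum in \<open>N'\<close> below keeps this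
    index in the head.\<close>
  define D where "D n = A n - 1 / real n" for n
  have L: "(\<lambda>n. 1 / real n * z ^ n) sums - ln (1 - z)" if "0 < z" "z < 1" for z :: real
  proof -
    have "(\<lambda>n. - ((- (- z)) ^ n) / real n) sums ln (1 + - z)"
      by (rule ln_series') (use that in auto)
    from sums_minus[OF this] show ?thesis by simp
  qed
  have near: "\<forall>\<^sub>F z in at_left (1::real). 0 < z \<and> z < 1"
    using eventually_at_left_real[of 0 "1::real"] by simp
  have "((\<lambda>z. (\<Sum>n. D n * z ^ n) / - ln (1 - z)) \<longlongrightarrow> 0) (at_left 1)"
  proof (rule tendstoI)
    fix e :: real assume e: "e > 0"
    have "(\<lambda>n. real n * A n - 1) \<longlonglongrightarrow> 0" using lim by (simp add: LIM_zero)
    from tendstoD[OF this, of "e / 2"]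
    have "\<forall>\<^sub>F n in sequentially. norm (real n * A n - 1) < e / 2"
      using e by (simp add: dist_norm)
    then obtain N where N: "\<And>n. n \<ge> N \<Longrightarrow> \<bar>real n * A n - 1\<bar> < e / 2"
      by (auto simp: eventually_at_top_linorder)
    define N' where "N' = max N 1"
    have DN: "\<bar>D n\<bar> \<le> e / 2 * (1 / real n)" if "n \<ge> N'" for n
    proof -
      have "n > 0" "n \<ge> N" using that by (auto simp: N'_def)
      then have "D n = (real n * A n - 1) / real n" by (simp add: D_def field_simps)
      then have "\<bar>D n\<bar> = \<bar>real n * A n - 1\<bar> / real n" by simp
      also have "\<dots> \<le> e / 2 / real n" using N[OF \<open>n \<ge> N\<close>] by (intro divide_right_mono) auto
      finally show ?thesis by simp
    qed
    define C where "C = (\<Sum>n<N'. \<bar>D n\<bar>)"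
    have bound: "\<bar>\<Sum>n. D n * z ^ n\<bar> \<le> C + e / 2 * - ln (1 - z)" if z: "0 < z" "z < 1" for z
    proof -
      have le: "norm (D n * z ^ n) \<le> (if n < N' then \<bar>D n\<bar> else 0) + e / 2 * (1 / real n * z ^ n)" for n
      proof (cases "n < N'")
        case True
        have "\<bar>D n\<bar> * z ^ n \<le> \<bar>D n\<bar>" using z by (intro mult_left_le) (auto intro!: power_le_one)
        moreover have "0 \<le> e / 2 * (1 / real n * z ^ n)" using z e by simp
        ultimately show ?thesis using True z by (simp add: abs_mult)
      next
        case False
        then have "\<bar>D n\<bar> * z ^ n \<le> e / 2 * (1 / real n) * z ^ n" using z by (intro mult_right_mono DN) auto
        then show ?thesis using False z by (simp add: abs_mult)
      qed
      have s1: "(\<lambda>n. if n < N' then \<bar>D n\<bar> else 0) sums C"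
        unfolding C_def using sums_If_finite_set[of "{..<N'}" "\<lambda>n. \<bar>D n\<bar>"] by simp
      have s2: "(\<lambda>n. (if n < N' then \<bar>D n\<bar> else 0) + e / 2 * (1 / real n * z ^ n)) sums (C + e / 2 * - ln (1 - z))"
        by (intro sums_add s1 sums_mult L z)
      have "norm (\<Sum>n. D n * z ^ n) \<le> (\<Sum>n. (if n < N' then \<bar>D n\<bar> else 0) + e / 2 * (1 / real n * z ^ n))"
        by (rule norm_suminf_le[OF le]) (use s2 in \<open>simp add: sums_iff\<close>)
      then show ?thesis using s2 by (simp add: sums_iff)
    qed
    have big: "\<forall>\<^sub>F z in at_left 1. 2 * C / e < - ln (1 - z)"
    proof -
      have "filterlim (\<lambda>z::real. - ln (1 - z)) at_top (at_left 1)" by real_asymp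
      then show ?thesis by (simp add: filterlim_at_top_dense)
    qed
    show "\<forall>\<^sub>F z in at_left 1. dist ((\<Sum>n. D n * z ^ n) / - ln (1 - z)) 0 < e"
      using big near
    proof eventually_elim
      case (elim z)
      define l where "l = - ln (1 - z)"
      have l: "l > 0" using elim by (simp add: l_def)
      have "\<bar>\<Sum>n. D n * z ^ n\<bar> < e * l"
        using bound[of z] elim e by (simp add: field_simps l_def)
      then have "\<bar>\<Sum>n. D n * z ^ n\<bar> / l < e" using l by (simp add: pos_divide_less_eq)
      then show ?case using l unfolding l_def[symmetric] by (simp add: dist_norm)
    qed
  qed
  then have T: "((\<lambda>z. 1 + (\<Sum>n. D n * z ^ n) / - ln (1 - z)) \<longlongrightarrow> 1 + 0) (at_left 1)"
    by (intro tendsto_intros)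
  have "\<forall>\<^sub>F z in at_left 1. 1 + (\<Sum>n. D n * z ^ n) / - ln (1 - z) = (\<Sum>n. A n * z ^ n) / - ln (1 - z)"
    using near
  proof eventually_elim
    case (elim z)
    have "summable (\<lambda>n. A n * z ^ n)"
      using summable_power_series_harmonic[OF lim, of z] elim by simp
    then have "(\<lambda>n. A n * z ^ n - 1 / real n * z ^ n) sums ((\<Sum>n. A n * z ^ n) - (- ln (1 - z)))"
      using L[of z] elim by (intro sums_diff) (auto simp: sums_iff)
    then have "(\<Sum>n. D n * z ^ n) = (\<Sum>n. A n * z ^ n) - (- ln (1 - z))"
      by (simp add: D_def left_diff_distrib sums_iff)
    then show ?case using elim by (simp add: field_simps)
  qed
  from Lim_transform_eventually[OF T this] show ?thesis by simp
qed

section \<open>The hypergeometric differential equation\<close>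

text \<open>v is convex, since v'' = 2 V v \<ge> 0. Difference quotients over [r/2, r] and [r, 2r]
  therefore turn the limits of v into limits of its derivative: v' -> 1 at infinity and r v'(r) -> 0
  at 0. These are the boundary terms of the integrations by parts: 2 r V v is the derivative of r v'
  - v, used below x, and 2 x V v is the derivative of x v', used above x.\<close>

lemma convex_ode_green_identity:
  fixes v dv V :: "real \<Rightarrow> real"
  assumes v: "\<And>x. x > 0 \<Longrightarrow> (v has_real_derivative dv x) (at x)"
    and dv: "\<And>x. x > 0 \<Longrightarrow> (dv has_real_derivative 2 * V x * v x) (at x)"
    and cont: "\<And>x. x > 0 \<Longrightarrow> isCont V x"
    and V: "\<And>x. x > 0 \<Longrightarrow> V x \<ge> 0" and v_nonneg: "\<And>x. x > 0 \<Longrightarrow> v x \<ge> 0"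
    and v0: "(v \<longlongrightarrow> 0) (at_right 0)" and vinf: "((\<lambda>x. v x / x) \<longlongrightarrow> 1) at_top"
    and x: "x > 0"
  shows "(\<integral>\<^sup>+r\<in>{0<..}. ennreal (2 * min x r * V r * v r) \<partial>lborel) = ennreal (x - v x)"
    and "v x \<le> x"
proof -
  have mono: "dv a \<le> dv b" if "0 < a" "a \<le> b" for a b
  proof (rule DERIV_nonneg_imp_nondecreasing[OF that(2)], intro exI conjI)
    fix r assume "a \<le> r"
    then have "r > 0" using that by simp
    then show "(dv has_real_derivative 2 * V r * v r) (at r)" "0 \<le> 2 * V r * v r"
      using dv V v_nonneg by (auto intro!: mult_nonneg_nonneg)
  qed
  have slope: "(b - a) * dv a \<le> v b - v a \<and> v b - v a \<le> (b - a) * dv b" if ab: "0 < a" "a < b" for a b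
  proof -
    obtain z where "a < z" "z < b" "v b - v a = (b - a) * dv z"
      using MVT2[of a b v dv, OF ab(2) v] ab(1) by fastforce
    then show ?thesis using mono[of a z] mono[of z b] ab by (auto intro!: mult_left_mono)
  qed
  have dinf: "(dv \<longlongrightarrow> 1) at_top"
  proof (rule tendsto_sandwich)
    show "\<forall>\<^sub>F r in at_top. 2 * (v r / r) - v (1/2 * r) / (1/2 * r) \<le> dv r"
      using eventually_gt_at_top[of 0]
    proof eventually_elim
      case (elim r)
      then show ?case using slope[of "1/2 * r" r] by (simp add: field_simps)
    qed
    show "\<forall>\<^sub>F r in at_top. dv r \<le> 2 * (v (2 * r) / (2 * r)) - v r / r"
      using eventually_gt_at_top[of 0]
    proof eventually_elim
      case (elim r)
      then show ?case using slope[of r "2 * r"] by (simp add: field_simps)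
    qed
    have "filterlim (\<lambda>r::real. 1/2 * r) at_top at_top" "filterlim (\<lambda>r::real. 2 * r) at_top at_top" by real_asymp+
    note c = filterlim_compose[OF vinf this(1)] filterlim_compose[OF vinf this(2)]
    have "((\<lambda>r. 2 * (v r / r) - v (1/2 * r) / (1/2 * r)) \<longlongrightarrow> 2 * 1 - 1) at_top"
      by (intro tendsto_intros vinf c)
    then show "((\<lambda>r. 2 * (v r / r) - v (1/2 * r) / (1/2 * r)) \<longlongrightarrow> 1) at_top" by simp
    have "((\<lambda>r. 2 * (v (2 * r) / (2 * r)) - v r / r) \<longlongrightarrow> 2 * 1 - 1) at_top"
      by (intro tendsto_intros vinf c)
    then show "((\<lambda>r. 2 * (v (2 * r) / (2 * r)) - v r / r) \<longlongrightarrow> 1) at_top" by simp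
  qed
  have d0: "((\<lambda>r. r * dv r) \<longlongrightarrow> 0) (at_right 0)"
  proof (rule tendsto_sandwich)
    have pos: "\<forall>\<^sub>F r in at_right 0. (0::real) < r" by (simp add: eventually_at_right_less)
    show "\<forall>\<^sub>F r in at_right 0. 2 * (v r - v (1/2 * r)) \<le> r * dv r"
      using pos
    proof eventually_elim
      case (elim r)
      then show ?case using slope[of "1/2 * r" r] by (simp add: field_simps)
    qed
    show "\<forall>\<^sub>F r in at_right 0. r * dv r \<le> v (2 * r) - v r"
      using pos
    proof eventually_elim
      case (elim r)
      then show ?case using slope[of r "2 * r"] by (simp add: field_simps)
    qed
    have "filterlim (\<lambda>r::real. 1/2 * r) (at_right 0) (at_right 0)" "filterlim (\<lambda>r::real. 2 * r) (at_right 0) (at_right 0)" by real_asymp+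
    note c = filterlim_compose[OF v0 this(1)] filterlim_compose[OF v0 this(2)]
    have "((\<lambda>r. 2 * (v r - v (1/2 * r))) \<longlongrightarrow> 2 * (0 - 0)) (at_right 0)"
      by (intro tendsto_intros v0 c)
    then show "((\<lambda>r. 2 * (v r - v (1/2 * r))) \<longlongrightarrow> 0) (at_right 0)" by simp
    have "((\<lambda>r. v (2 * r) - v r) \<longlongrightarrow> 0 - 0) (at_right 0)"
      by (intro tendsto_intros v0 c)
    then show "((\<lambda>r. v (2 * r) - v r) \<longlongrightarrow> 0) (at_right 0)" by simp
  qed
  have vc: "isCont v r" and dvc: "isCont dv r" if "r > 0" for r
    using v[OF that] dv[OF that] by (auto intro: DERIV_isCont)
  have dle: "dv x \<le> 1"
    by (rule tendsto_lowerbound[OF dinf eventually_mono[OF eventually_ge_at_top[of x]]])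
      (use mono x in auto)
  have F1: "((\<lambda>r. r * dv r - v r) has_real_derivative 2 * r * V r * v r) (at r)" if "r > 0" for r
    using that by (auto intro!: derivative_eq_intros v dv)
  have F1_lim: "((\<lambda>r. r * dv r - v r) \<longlongrightarrow> 0) (at_right 0)"
    using tendsto_diff[OF d0 v0] by simp
  \<comment> \<open>r v' - v is nondecreasing and has limit 0 at 0. Its sign allows the two halves
    of the integral to be added as \<open>ennreal\<close> numbers, and together with v' \<le> 1 it
    gives v x \<le> x.\<close>
  have vle: "0 \<le> x * dv x - v x"
  proof (rule tendsto_upperbound[OF F1_lim])
    have "\<forall>\<^sub>F r in at_right 0. (0::real) < r \<and> r < x"
      using eventually_at_right_real[OF x] by simp
    then show "\<forall>\<^sub>F r in at_right 0. r * dv r - v r \<le> x * dv x - v x"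
    proof eventually_elim
      case (elim r)
      show ?case
      proof (rule DERIV_nonneg_imp_nondecreasing[of r x "\<lambda>r. r * dv r - v r"], simp add: elim less_imp_le, intro exI conjI)
        fix t assume "r \<le> t"
        then have "t > 0" using elim by simp
        then show "((\<lambda>r. r * dv r - v r) has_real_derivative 2 * t * V t * v t) (at t)" "0 \<le> 2 * t * V t * v t"
          using F1 V v_nonneg by (auto intro!: mult_nonneg_nonneg)
      qed
    qed
  qed simp
  have "(\<integral>\<^sup>+r\<in>{0<..}. ennreal (2 * min x r * V r * v r) \<partial>lborel) =
     (\<integral>\<^sup>+r. (ennreal (2 * r * V r * v r) * indicator (einterval 0 (ereal x)) r +
           ennreal (2 * x * V r * v r) * indicator (einterval (ereal x) \<infinity>) r) \<partial>lborel)"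
    by (rule nn_integral_cong_AE, use AE_lborel_singleton[of x] in eventually_elim)
      (use x in \<open>auto simp: indicator_def einterval_def zero_ereal_def min_def\<close>)
  also have "\<dots> = (\<integral>\<^sup>+r\<in>einterval 0 (ereal x). ennreal (2 * r * V r * v r) \<partial>lborel)
      + (\<integral>\<^sup>+r\<in>einterval (ereal x) \<infinity>. ennreal (2 * x * V r * v r) \<partial>lborel)"
  proof (rule nn_integral_add)
    have m: "(\<lambda>r. ennreal (g r) * indicator (einterval a b) r) \<in> borel_measurable lborel"
      if "0 \<le> a" "\<And>r. r > 0 \<Longrightarrow> isCont g r" for a b and g :: "real \<Rightarrow> real"
    proof -
      have "continuous_on (einterval a b) g"
        by (intro continuous_at_imp_continuous_on ballI that(2))
          (use that(1) in \<open>auto simp: einterval_def zero_ereal_def dest: le_less_trans\<close>)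
      then have "(\<lambda>r. indicator (einterval a b) r *\<^sub>R g r) \<in> borel_measurable borel"
        by (intro borel_measurable_continuous_on_indicator) auto
      then have "(\<lambda>r. ennreal (indicator (einterval a b) r *\<^sub>R g r)) \<in> borel_measurable borel"
        by measurable
      also have "(\<lambda>r. ennreal (indicator (einterval a b) r *\<^sub>R g r)) = (\<lambda>r. ennreal (g r) * indicator (einterval a b) r)"
        by (auto simp: indicator_def)
      finally show ?thesis by simp
    qed
    show "(\<lambda>r. ennreal (2 * r * V r * v r) * indicator (einterval 0 (ereal x)) r) \<in> borel_measurable lborel"
      by (rule m) (auto intro!: continuous_intros cont vc)
    show "(\<lambda>r. ennreal (2 * x * V r * v r) * indicator (einterval (ereal x) \<infinity>) r) \<in> borel_measurable lborel"
      by (rule m) (use x in \<open>auto intro!: continuous_intros cont vc\<close>)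
  qed
  also have "(\<integral>\<^sup>+r\<in>einterval 0 (ereal x). ennreal (2 * r * V r * v r) \<partial>lborel) = ennreal ((x * dv x - v x) - 0)"
  proof (rule nn_integral_FTC_einterval[where F = "\<lambda>r. r * dv r - v r"])
    show "(((\<lambda>r. r * dv r - v r) \<circ> real_of_ereal) \<longlongrightarrow> 0) (at_right 0)"
      using F1_lim by (simp add: zero_ereal_def ereal_tendsto_simps)
    have "((\<lambda>r. r * dv r - v r) \<longlongrightarrow> x * dv x - v x) (at x)"
      by (intro tendsto_intros isContD vc dvc x)
    then have "((\<lambda>r. r * dv r - v r) \<longlongrightarrow> x * dv x - v x) (at_left x)"
      by (rule filterlim_mono) (auto simp: at_le)
    then show "(((\<lambda>r. r * dv r - v r) \<circ> real_of_ereal) \<longlongrightarrow> x * dv x - v x) (at_left (ereal x))"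
      by (simp add: ereal_tendsto_simps)
  qed (use x in \<open>auto simp: zero_ereal_def intro!: F1 continuous_intros cont vc mult_nonneg_nonneg V v_nonneg\<close>)
  also have "(\<integral>\<^sup>+r\<in>einterval (ereal x) \<infinity>. ennreal (2 * x * V r * v r) \<partial>lborel) = ennreal (x * 1 - x * dv x)"
  proof (rule nn_integral_FTC_einterval[where F = "\<lambda>r. x * dv r"])
    have "((\<lambda>r. x * dv r) \<longlongrightarrow> x * dv x) (at x)"
      by (intro tendsto_intros isContD dvc x)
    then have "((\<lambda>r. x * dv r) \<longlongrightarrow> x * dv x) (at_right x)"
      by (rule filterlim_mono) (auto simp: at_le)
    then show "(((\<lambda>r. x * dv r) \<circ> real_of_ereal) \<longlongrightarrow> x * dv x) (at_right (ereal x))"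
      by (simp add: ereal_tendsto_simps)
    have "((\<lambda>r. x * dv r) \<longlongrightarrow> x * 1) at_top" by (intro tendsto_intros dinf)
    then show "(((\<lambda>r. x * dv r) \<circ> real_of_ereal) \<longlongrightarrow> x * 1) (at_left \<infinity>)"
      by (simp add: ereal_tendsto_simps)
    show "((\<lambda>r. x * dv r) has_real_derivative 2 * x * V r * v r) (at r)" if "ereal x < ereal r" for r
      using that x by (auto intro!: derivative_eq_intros dv)
  qed (use x in \<open>auto intro!: continuous_intros cont vc mult_nonneg_nonneg V v_nonneg\<close>)
  also have "ennreal ((x * dv x - v x) - 0) + ennreal (x * 1 - x * dv x) = ennreal (x - v x)"
    using vle dle x by (subst ennreal_plus[symmetric]) auto
  finally show "(\<integral>\<^sup>+r\<in>{0<..}. ennreal (2 * min x r * V r * v r) \<partial>lborel) = ennreal (x - v x)" .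
  have "x * dv x \<le> x * 1" using dle x by (intro mult_left_mono) auto
  then show "v x \<le> x" using vle by simp
qed

text \<open>The recursion says precisely that the coefficient of each z^n in the differential
  equation vanishes. The series may be differentiated termwise in the unit disc because n
  \<open>A n\<close> is bounded.\<close>

lemma hypergeometric_series_ode:
  fixes A :: "nat \<Rightarrow> real"
  assumes lim: "(\<lambda>n. real n * A n) \<longlonglongrightarrow> 1"
    and rec: "\<And>n. A (Suc n) * (real n + 1) * (\<gamma> + real n) = A n * ((real n)\<^sup>2 + \<gamma> * real n + P)"
  defines "S \<equiv> \<lambda>z. \<Sum>n. A n * z ^ n"
  defines "S1 \<equiv> \<lambda>z. \<Sum>n. diffs A n * z ^ n"
  defines "S2 \<equiv> \<lambda>z. \<Sum>n. diffs (diffs A) n * z ^ n"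
  assumes z: "\<bar>z\<bar> < 1"
  shows "(\<lambda>n. A n * z ^ n) sums S z"
    and "(S has_real_derivative S1 z) (at z)" and "(S1 has_real_derivative S2 z) (at z)"
    and "z * (1 - z) * S2 z + (\<gamma> - (\<gamma> + 1) * z) * S1 z - P * S z = 0"
proof -
  have sA: "summable (\<lambda>n. A n * w ^ n)" if "norm w < 1" for w
    using summable_power_series_harmonic[OF lim] that by simp
  have sD: "summable (\<lambda>n. diffs A n * w ^ n)" if "norm w < 1" for w
    by (rule termdiff_converges[OF that]) (rule sA)
  have sDD: "summable (\<lambda>n. diffs (diffs A) n * w ^ n)" if "norm w < 1" for w
    by (rule termdiff_converges[OF that]) (rule sD)
  have s0: "(\<lambda>n. A n * z ^ n) sums S z" and s1: "(\<lambda>n. diffs A n * z ^ n) sums S1 z"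
    and s2: "(\<lambda>n. diffs (diffs A) n * z ^ n) sums S2 z"
    using sA[of z] sD[of z] sDD[of z] z by (auto simp: S_def S1_def S2_def summable_sums)
  show "(\<lambda>n. A n * z ^ n) sums S z" by (fact s0)
  show "(S has_real_derivative S1 z) (at z)" unfolding S_def S1_def
    by (rule termdiffs_strong'[where K = 1]) (use sA z in auto)
  show "(S1 has_real_derivative S2 z) (at z)" unfolding S1_def S2_def
    by (rule termdiffs_strong'[where K = 1]) (use sD z in auto)
  \<comment> \<open>Multiplication by z shifts the coefficients. The 0 inserted at n = 0 agrees with
    the closed forms in \<open>t1\<close>, \<open>t2\<close> and \<open>t3\<close>, since each of
    them carries a factor n.\<close>
  have up: "(\<lambda>n. (if n = 0 then 0 else f (n - 1)) * z ^ n) sums (z * s)" if "(\<lambda>n. f n * z ^ n) sums s" for f s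
    using sums_mult[OF that, of z]
    by (subst sums_Suc_iff[symmetric, where f = "\<lambda>n. (if n = 0 then 0 else f (n - 1)) * z ^ n", simplified])
       (simp add: mult_ac)
  have t1: "(\<lambda>n. real n * A n * z ^ n) sums (z * S1 z)"
    using up[OF s1] by (rule sums_cong[THEN iffD1, rotated]) (auto simp: diffs_def)
  have t2: "(\<lambda>n. real n * (real n + 1) * A (n + 1) * z ^ n) sums (z * S2 z)"
    using up[OF s2] by (rule sums_cong[THEN iffD1, rotated]) (auto simp: diffs_def)
  have t3: "(\<lambda>n. real n * (real n - 1) * A n * z ^ n) sums (z * (z * S2 z))"
    using up[OF t2] by (rule sums_cong[THEN iffD1, rotated]) (auto simp: of_nat_diff)
  have "(\<lambda>n. real n * (real n + 1) * A (n + 1) * z ^ n - real n * (real n - 1) * A n * z ^ n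
      + \<gamma> * (diffs A n * z ^ n) - (\<gamma> + 1) * (real n * A n * z ^ n) - P * (A n * z ^ n))
     sums (z * S2 z - z * (z * S2 z) + \<gamma> * S1 z - (\<gamma> + 1) * (z * S1 z) - P * S z)"
    by (intro sums_add sums_diff sums_mult s0 s1 t1 t2 t3)
  moreover have "real n * (real n + 1) * A (n + 1) * z ^ n - real n * (real n - 1) * A n * z ^ n
      + \<gamma> * (diffs A n * z ^ n) - (\<gamma> + 1) * (real n * A n * z ^ n) - P * (A n * z ^ n) = 0" for n
  proof -
    have "real n * (real n + 1) * A (n + 1) * z ^ n - real n * (real n - 1) * A n * z ^ n
      + \<gamma> * (diffs A n * z ^ n) - (\<gamma> + 1) * (real n * A n * z ^ n) - P * (A n * z ^ n)
      = (A (Suc n) * (real n + 1) * (\<gamma> + real n) - A n * ((real n)\<^sup>2 + \<gamma> * real n + P)) * z ^ n"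
      by (simp add: diffs_def algebra_simps power2_eq_square)
    then show ?thesis by (simp add: rec)
  qed
  ultimately have "z * S2 z - z * (z * S2 z) + \<gamma> * S1 z - (\<gamma> + 1) * (z * S1 z) - P * S z = 0"
    by (simp add: sums_iff)
  then show "z * (1 - z) * S2 z + (\<gamma> - (\<gamma> + 1) * z) * S1 z - P * S z = 0"
    by (simp add: algebra_simps)
qed

section \<open>Euler's integral\<close>

lemma of_real_powr_complex_exp:
  "t > 0 \<Longrightarrow> complex_of_real t powr c = exp (c * of_real (ln t))"
  by (simp add: powr_def Ln_of_real)

text \<open>The integrand of the Gamma integral, with the power written as exp((a-1) ln t):
  measurability is then immediate and products of powers combine by \<open>exp_add\<close>. The Beta
  integrand is encoded in the same way.\<close>

definition gamma_density :: "complex \<Rightarrow> real \<Rightarrow> complex" where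
  "gamma_density a t = indicator {0<..} t *\<^sub>R (exp ((a - 1) * of_real (ln t)) * of_real (exp (- t)))"

definition beta_density :: "complex \<Rightarrow> complex \<Rightarrow> real \<Rightarrow> complex" where
  "beta_density a b t = indicator {0<..<1} t *\<^sub>R (exp ((a - 1) * of_real (ln t)) * exp ((b - 1) * of_real (ln (1 - t))))"

lemma density_measurable [measurable]:
  assumes [measurable]: "g \<in> borel_measurable L"
  shows "(\<lambda>x. gamma_density a (g x)) \<in> borel_measurable L"
    and "(\<lambda>x. beta_density a b (g x)) \<in> borel_measurable L"
  unfolding gamma_density_def beta_density_def by measurable

lemma has_bochner_integral_gamma_density:
  assumes a: "Re a > 0"
  shows "has_bochner_integral lborel (gamma_density a) (Gamma a)"
proof -
  define f where "f t = complex_of_real t powr (a - 1) / of_real (exp t)" for t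
  have eq: "indicator {0<..} t *\<^sub>R f t = gamma_density a t" for t
    by (auto simp: f_def gamma_density_def indicator_def of_real_powr_complex_exp exp_minus divide_inverse)
  have "set_integrable lebesgue {0<..} f"
    using absolutely_integrable_Gamma_integral'[OF a] by (simp add: f_def[abs_def])
  then have "integrable lebesgue (gamma_density a)"
    by (simp add: set_integrable_def eq)
  then have int: "integrable lborel (gamma_density a)"
    by (subst (asm) integrable_completion) simp_all
  then have "set_integrable lborel {0<..} f" by (simp add: set_integrable_def eq)
  from set_borel_integral_eq_integral(2)[OF this]
  have "(\<integral>t. gamma_density a t \<partial>lborel) = integral {0<..} f"
    by (simp add: set_lebesgue_integral_def eq)
  also have "\<dots> = Gamma a" unfolding f_def[abs_def] by (rule integral_unique[OF Gamma_integral_complex'[OF a]])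
  finally show ?thesis using int by (simp add: has_bochner_integral_iff)
qed

lemma beta_density_integrable:
  assumes "Re a > 0" "Re b > 0"
  shows "integrable lborel (beta_density a b)"
proof (rule Bochner_Integration.integrable_bound)
  show "integrable lborel (\<lambda>t. indicator {0..1} t *\<^sub>R (t powr (Re a - 1) * (1 - t) powr (Re b - 1)))"
    using integrable_Beta[OF assms] by (simp add: set_integrable_def)
  show "AE t in lborel. norm (beta_density a b t) \<le> norm (indicator {0..1} t *\<^sub>R (t powr (Re a - 1) * (1 - t) powr (Re b - 1)))"
    by (rule AE_I2) (auto simp: beta_density_def indicator_def norm_mult powr_def)
qed simp

text \<open>Gamma(a) Gamma(b) is the integral of the convolution of two gamma densities. With w the
  sum of the variables and s = w t, the integrand splits into the density for a + b at w and the
  Beta integrand at t, so the convolution is a constant multiple of the former.\<close>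

lemma integral_beta_density:
  assumes a: "Re a > 0" and b: "Re b > 0"
  shows "(\<integral>t. beta_density a b t \<partial>lborel) = Gamma a * Gamma b / Gamma (a + b)"
proof -
  define F where "F s w = gamma_density a s * gamma_density b (w - s)" for s w
  note ha = has_bochner_integral_gamma_density[OF a] and hb = has_bochner_integral_gamma_density[OF b]
  have ab: "Re (a + b) > 0" using a b by simp
  note hab = has_bochner_integral_gamma_density[OF ab]
  have shift: "integrable lborel (\<lambda>w. gamma_density b (w - s))"
      "(\<integral>w. gamma_density b (w - s) \<partial>lborel) = Gamma b"
      "(\<integral>w. norm (gamma_density b (w - s)) \<partial>lborel) = (\<integral>w. norm (gamma_density b w) \<partial>lborel)" for s
    using lborel_integrable_real_affine[of "gamma_density b" 1 "- s"]
      lborel_integral_real_affine[of 1 "gamma_density b" "- s"]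
      lborel_integral_real_affine[of 1 "\<lambda>w. norm (gamma_density b w)" "- s"] hb
    by (auto simp: has_bochner_integral_iff)
  have Fm [measurable]: "case_prod F \<in> borel_measurable (lborel \<Otimes>\<^sub>M lborel)"
    unfolding F_def by measurable
  have int: "integrable (lborel \<Otimes>\<^sub>M lborel) (case_prod F)"
  proof (rule lborel_pair.Fubini_integrable)
    have "integrable lborel (\<lambda>s. norm (gamma_density a s) * (\<integral>w. norm (gamma_density b w) \<partial>lborel))"
      using ha by (intro integrable_mult_left integrable_norm) (simp add: has_bochner_integral_iff)
    then show "integrable lborel (\<lambda>s. \<integral>w. norm (case_prod F (s, w)) \<partial>lborel)"
      by (simp add: F_def norm_mult shift)
    show "AE s in lborel. integrable lborel (\<lambda>w. case_prod F (s, w))"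
      using shift by (simp add: F_def)
  qed simp
  have "Gamma a * Gamma b = (\<integral>s. (\<integral>w. F s w \<partial>lborel) \<partial>lborel)"
    using ha by (simp add: F_def shift has_bochner_integral_iff)
  also have "\<dots> = (\<integral>w. (\<integral>s. F s w \<partial>lborel) \<partial>lborel)"
    by (rule lborel_pair.Fubini_integral[OF int, symmetric])
  also have "\<dots> = (\<integral>w. gamma_density (a + b) w * (\<integral>t. beta_density a b t \<partial>lborel) \<partial>lborel)"
  proof (rule Bochner_Integration.integral_cong[OF refl])
    fix w :: real
    show "(\<integral>s. F s w \<partial>lborel) = gamma_density (a + b) w * (\<integral>t. beta_density a b t \<partial>lborel)"
    proof (cases "w > 0")
      case False
      then have "F s w = 0" for s by (auto simp: F_def gamma_density_def indicator_def)
      then show ?thesis using False by (simp add: gamma_density_def)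
    next
      case True
      have "(\<integral>s. F s w \<partial>lborel) = w *\<^sub>R (\<integral>t. F (w * t) w \<partial>lborel)"
        using lborel_integral_real_affine[of w "\<lambda>s. F s w" 0] True by simp
      also have "\<dots> = (\<integral>t. w *\<^sub>R F (w * t) w \<partial>lborel)" by simp
      also have "\<dots> = (\<integral>t. gamma_density (a + b) w * beta_density a b t \<partial>lborel)"
      proof (rule Bochner_Integration.integral_cong[OF refl])
        fix t :: real
        show "w *\<^sub>R F (w * t) w = gamma_density (a + b) w * beta_density a b t"
        proof (cases "0 < t \<and> t < 1")
          case False
          then have "\<not> (0 < w * t \<and> 0 < w - w * t)"
            using True by (auto simp: zero_less_mult_iff algebra_simps)
          then have "F (w * t) w = 0" by (auto simp: F_def gamma_density_def)
          then show ?thesis using False by (auto simp: beta_density_def)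
        next
          case t: True
          have w1: "w - w * t = w * (1 - t)" by (simp add: algebra_simps)
          have pos: "0 < w * t" "0 < w * (1 - t)" using t True by auto
          have wexp: "of_real w = exp (complex_of_real (ln w))" using True by (simp add: exp_of_real)
          have "w *\<^sub>R F (w * t) w = exp (complex_of_real (ln w)) *
             ((exp ((a - 1) * of_real (ln w + ln t)) * exp (complex_of_real (- (w * t)))) *
              (exp ((b - 1) * of_real (ln w + ln (1 - t))) * exp (complex_of_real (- (w * (1 - t))))))"
            unfolding F_def gamma_density_def w1 scaleR_conv_of_real wexp
            using pos t True by (simp add: ln_mult exp_of_real[symmetric])
          also have "\<dots> = exp ((a + b - 1) * of_real (ln w)) * exp (complex_of_real (- w)) *
             (exp ((a - 1) * of_real (ln t)) * exp ((b - 1) * of_real (ln (1 - t))))"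
            unfolding exp_add[symmetric] by (simp add: algebra_simps)
          also have "\<dots> = gamma_density (a + b) w * beta_density a b t"
            using t True by (simp add: gamma_density_def beta_density_def exp_of_real[symmetric])
          finally show ?thesis .
        qed
      qed
      also have "\<dots> = gamma_density (a + b) w * (\<integral>t. beta_density a b t \<partial>lborel)"
        by simp
      finally show ?thesis .
    qed
  qed
  also have "\<dots> = Gamma (a + b) * (\<integral>t. beta_density a b t \<partial>lborel)"
    using hab by (simp add: has_bochner_integral_iff)
  finally show ?thesis
    using not_nonpos_Ints_Re_pos[OF ab] by (simp add: Gamma_eq_zero_iff field_simps)
qed

text \<open>The exponent \<alpha> - \<gamma> is -\<beta>. Expanding (1 - t z)^(-\<beta>) by the
  binomial series leaves Beta integrals with parameters \<alpha> + n and \<beta>, whose Gamma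
  quotients form the hypergeometric coefficients.\<close>

theorem euler_integral_hypergeometric:
  fixes \<alpha> \<beta> \<gamma> :: complex and z :: real
  assumes \<alpha>: "Re \<alpha> > 0" and \<beta>: "Re \<beta> > 0" and sum: "\<alpha> + \<beta> = \<gamma>" and z: "0 < z" "z < 1"
  shows "(LBINT t:{0..1}. complex_of_real t powr (\<alpha> - 1) * complex_of_real (1 - t) powr (\<beta> - 1)
            * complex_of_real (1 - t * z) powr (\<alpha> - \<gamma>))
    = (\<Sum>n. Gamma (\<alpha> + of_nat n) * Gamma (\<beta> + of_nat n) / (Gamma (\<gamma> + of_nat n) * fact n) * of_real z ^ n)"
proof -
  \<comment> \<open>The coefficient of r^n in (1 - r)^(-\<beta>), that is, the rising factorial of
    \<beta> divided by n!.\<close>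
  define c where "c n = ((- \<beta>) gchoose n) * (- 1) ^ n" for n :: nat
  have c: "c n = Gamma (\<beta> + of_nat n) / (Gamma \<beta> * fact n)" for n
    using pochhammer_Gamma[OF not_nonpos_Ints_Re_pos[OF \<beta>], of n]
    by (simp add: c_def gbinomial_pochhammer mult_ac power_mult_distrib[symmetric])
  have binom: "(\<lambda>n. c n * of_real r ^ n) sums (of_real (1 - r) powr (- \<beta>))" if "0 \<le> r" "r < 1" for r :: real
  proof -
    have "(\<lambda>n. ((- \<beta>) gchoose n) * (- of_real r) ^ n) sums (1 + (- of_real r)) powr (- \<beta>)"
      by (rule gen_binomial_complex) (use that in simp)
    moreover have "(- complex_of_real r) ^ n = (- 1) ^ n * of_real r ^ n" for n
      by (simp add: power_mult_distrib[symmetric])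
    ultimately show ?thesis by (simp add: c_def mult_ac)
  qed
  \<comment> \<open>Convergence at some r strictly between z and 1 gives absolute convergence at z.
    This dominates the expansion uniformly in t \<le> 1.\<close>
  have abs_sum: "summable (\<lambda>n. norm (c n * of_real z ^ n))"
  proof -
    obtain r where r: "z < r" "r < 1" using dense z by blast
    have "summable (\<lambda>n. c n * of_real r ^ n)" using binom[of r] r z by (simp add: sums_iff)
    then show ?thesis by (rule powser_insidea) (use r z in simp)
  qed
  define f where "f n t = (c n * of_real z ^ n) * beta_density (\<alpha> + of_nat n) \<beta> t" for n t
  have \<alpha>n: "Re (\<alpha> + of_nat n) > 0" for n using \<alpha> by simp
  have shift: "beta_density (\<alpha> + of_nat n) \<beta> t = of_real t ^ n * beta_density \<alpha> \<beta> t" for n t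
  proof (cases "0 < t \<and> t < 1")
    case True
    have "exp ((\<alpha> + of_nat n - 1) * of_real (ln t)) = exp (of_nat n * complex_of_real (ln t)) * exp ((\<alpha> - 1) * of_real (ln t))"
      unfolding exp_add[symmetric] by (simp add: algebra_simps)
    also have "exp (of_nat n * complex_of_real (ln t)) = of_real t ^ n"
      using True by (simp add: exp_of_nat_mult exp_of_real)
    finally show ?thesis using True by (simp add: beta_density_def)
  qed (auto simp: beta_density_def)
  have int: "integrable lborel (f n)" for n
    unfolding f_def[abs_def] by (intro integrable_mult_right beta_density_integrable \<alpha>n \<beta>)
  have le: "norm (f n t) \<le> norm (c n * of_real z ^ n) * norm (beta_density \<alpha> \<beta> t)" for n t
  proof (cases "0 < t \<and> t < 1")
    case True
    then have "norm (complex_of_real t ^ n) \<le> 1" by (simp add: norm_power power_le_one)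
    then have "norm (complex_of_real t ^ n) * norm (beta_density \<alpha> \<beta> t) \<le> 1 * norm (beta_density \<alpha> \<beta> t)"
      by (intro mult_right_mono) auto
    then show ?thesis unfolding f_def shift norm_mult by (intro mult_left_mono) (simp_all add: norm_mult)
  qed (auto simp: f_def beta_density_def)
  have nint: "integrable lborel (\<lambda>t. norm (c n * of_real z ^ n) * norm (beta_density \<alpha> \<beta> t))" for n
    by (intro integrable_mult_right integrable_norm beta_density_integrable \<alpha> \<beta>)
  have sums: "(\<lambda>n. \<integral>t. f n t \<partial>lborel) sums (\<integral>t. (\<Sum>n. f n t) \<partial>lborel)"
  proof (rule sums_integral[OF int])
    show "AE t in lborel. summable (\<lambda>n. norm (f n t))"
      by (intro AE_I2 summable_comparison_test'[OF summable_mult2[OF abs_sum]]) (use le in simp)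
    show "summable (\<lambda>n. \<integral>t. norm (f n t) \<partial>lborel)"
    proof (rule summable_comparison_test'[OF summable_mult2[OF abs_sum]])
      fix n
      have "(\<integral>t. norm (f n t) \<partial>lborel) \<le> (\<integral>t. norm (c n * of_real z ^ n) * norm (beta_density \<alpha> \<beta> t) \<partial>lborel)"
        by (intro integral_mono integrable_norm int nint le)
      then show "norm (\<integral>t. norm (f n t) \<partial>lborel) \<le> norm (c n * of_real z ^ n) * (\<integral>t. norm (beta_density \<alpha> \<beta> t) \<partial>lborel)"
        by simp
    qed
  qed
  have "(LBINT t:{0..1}. complex_of_real t powr (\<alpha> - 1) * complex_of_real (1 - t) powr (\<beta> - 1)
            * complex_of_real (1 - t * z) powr (\<alpha> - \<gamma>)) = (\<integral>t. (\<Sum>n. f n t) \<partial>lborel)"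
    unfolding set_lebesgue_integral_def
  proof (rule Bochner_Integration.integral_cong[OF refl])
    fix t :: real
    show "indicator {0..1} t *\<^sub>R (complex_of_real t powr (\<alpha> - 1) * complex_of_real (1 - t) powr (\<beta> - 1)
            * complex_of_real (1 - t * z) powr (\<alpha> - \<gamma>)) = (\<Sum>n. f n t)"
    proof (cases "0 < t \<and> t < 1")
      case False
      \<comment> \<open>At each endpoint one of the bases is 0, and \<open>0 powr c\<close> is 0 for
        complex numbers, in agreement with the open interval in \<open>beta_density\<close>.\<close>
      then have "t < 0 \<or> t = 0 \<or> t = 1 \<or> 1 < t" by auto
      moreover have "f n t = 0" for n using False by (auto simp: f_def beta_density_def)
      ultimately show ?thesis by auto
    next
      case True
      have "0 \<le> t * z" "t * z < 1" using True z mult_strict_mono[of t 1 z 1] by auto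
      from sums_mult[OF binom[OF this], of "beta_density \<alpha> \<beta> t"]
      have "(\<lambda>n. f n t) sums (beta_density \<alpha> \<beta> t * of_real (1 - t * z) powr (- \<beta>))"
        by (simp add: f_def shift power_mult_distrib mult_ac)
      moreover have "\<alpha> - \<gamma> = - \<beta>" using sum by (simp add: algebra_simps)
      moreover have "beta_density \<alpha> \<beta> t = complex_of_real t powr (\<alpha> - 1) * complex_of_real (1 - t) powr (\<beta> - 1)"
        using True of_real_powr_complex_exp[of t] of_real_powr_complex_exp[of "1 - t"]
        by (simp add: beta_density_def)
      ultimately show ?thesis using True by (simp add: sums_iff)
    qed
  qed
  also have "\<dots> = (\<Sum>n. \<integral>t. f n t \<partial>lborel)" using sums by (simp add: sums_iff)
  also have "\<dots> = (\<Sum>n. Gamma (\<alpha> + of_nat n) * Gamma (\<beta> + of_nat n) / (Gamma (\<gamma> + of_nat n) * fact n) * of_real z ^ n)"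
  proof (rule suminf_cong)
    fix n
    have "(\<integral>t. f n t \<partial>lborel) = c n * of_real z ^ n * (Gamma (\<alpha> + of_nat n) * Gamma \<beta> / Gamma (\<alpha> + of_nat n + \<beta>))"
      by (simp add: f_def integral_beta_density[OF \<alpha>n \<beta>])
    also have "\<alpha> + of_nat n + \<beta> = \<gamma> + of_nat n" using sum by (simp add: algebra_simps)
    finally show "(\<integral>t. f n t \<partial>lborel) = Gamma (\<alpha> + of_nat n) * Gamma (\<beta> + of_nat n) / (Gamma (\<gamma> + of_nat n) * fact n) * of_real z ^ n"
      using not_nonpos_Ints_Re_pos[OF \<beta>] by (simp add: c Gamma_eq_zero_iff field_simps)
  qed
  finally show ?thesis .
qed

section \<open>Radial transition kernel of three-dimensional Brownian motion\<close>

text \<open>An orthogonal image of a box need not be a box, so its volume is compared through the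
  completed Lebesgue measure, where invariance under orthogonal maps is known. Agreement on boxes
  then determines the image measure.\<close>

lemma distr_lborel_orthogonal_transformation:
  fixes T :: "real ^ 'n::{finite,wellorder} \<Rightarrow> real ^ 'n::{finite,wellorder}"
  assumes T: "orthogonal_transformation T"
  shows "distr lborel borel T = lborel"
proof (rule lborel_eqI[symmetric])
  have T_borel [measurable]: "T \<in> borel_measurable borel"
    using T by (intro borel_measurable_continuous_onI linear_continuous_on)
      (simp add: orthogonal_transformation_linear linear_linear)
  fix l u :: "real ^ 'n::{finite,wellorder}" assume lu: "\<And>b. b \<in> Basis \<Longrightarrow> l \<bullet> b \<le> u \<bullet> b"
  have pre: "T -` box l u = inv T ` box l u"
    using orthogonal_transformation_bij[OF T] by (simp add: bij_vimage_eq_inv_image)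
  have inv: "orthogonal_transformation (inv T)"
    by (rule orthogonal_transformation_inv[OF T])
  have meas: "T -` box l u \<in> lmeasurable" "measure lebesgue (T -` box l u) = measure lebesgue (box l u)"
    using measurable_orthogonal_image[OF inv, of "box l u"]
      measure_orthogonal_image[OF inv, of "box l u"] pre by auto
  have bor: "T -` box l u \<in> sets lborel"
    using measurable_sets[OF T_borel, of "box l u"] by simp
  have "emeasure (distr lborel borel T) (box l u) = emeasure lborel (T -` box l u)"
    by (subst emeasure_distr) auto
  also have "\<dots> = emeasure lebesgue (T -` box l u)" using bor by simp
  also have "\<dots> = emeasure lebesgue (box l u)"
    using meas by (metis emeasure_eq_measure2 lmeasurable_box)
  also have "\<dots> = emeasure lborel (box l u)" by simp
  also have "\<dots> = (\<Prod>b\<in>Basis. (u - l) \<bullet> b)"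
    using lu by (simp add: emeasure_lborel_box)
  finally show "emeasure (distr lborel borel T) (box l u) = (\<Prod>b\<in>Basis. (u - l) \<bullet> b)" .
qed simp

lemma borel_measurable_vector_3 [measurable]:
  "(\<lambda>p. vector [fst p, fst (snd p), snd (snd p)] :: real ^ 3) \<in> borel_measurable borel"
proof -
  have eq: "(\<lambda>p. vector [fst p, fst (snd p), snd (snd p)] :: real ^ 3) =
      (\<lambda>x. fst x *\<^sub>R vector [1, 0, 0] + fst (snd x) *\<^sub>R vector [0, 1, 0] + snd (snd x) *\<^sub>R vector [0, 0, 1])"
    by (auto simp: fun_eq_iff vec_eq_iff forall_3)
  show ?thesis unfolding eq by (intro borel_measurable_continuous_onI continuous_intros)
qed

text \<open>Identifies \<open>real ^ 3\<close> with an iterated product, so that one coordinate can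
  be integrated separately from the other two.\<close>

lemma distr_lborel_vector_3:
  "distr lborel borel (\<lambda>p. vector [fst p, fst (snd p), snd (snd p)] :: real ^ 3) = lborel"
proof (rule lborel_eqI[symmetric])
  fix l u :: "real ^ 3" assume lu: "\<And>b. b \<in> Basis \<Longrightarrow> l \<bullet> b \<le> u \<bullet> b"
  have le: "l $ i \<le> u $ i" for i
    using lu[of "axis i 1"] by (simp add: inner_axis)
  have B: "Basis = {(1, 0, 0), (0, 1, 0), (0, 0, 1) :: real \<times> real \<times> real}"
    by (auto simp: Basis_prod_def zero_prod_def)
  have "(\<lambda>p. vector [fst p, fst (snd p), snd (snd p)] :: real ^ 3) -` box l u =
      box (l $ 1, l $ 2, l $ 3) (u $ 1, u $ 2, u $ 3)"
    by (auto simp: mem_box_cart forall_3 mem_box B)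
  then have "emeasure (distr lborel borel (\<lambda>p. vector [fst p, fst (snd p), snd (snd p)] :: real ^ 3)) (box l u)
      = emeasure lborel (box (l $ 1, l $ 2, l $ 3) (u $ 1, u $ 2, u $ 3))"
    by (subst emeasure_distr) auto
  also have "\<dots> = (u $ 1 - l $ 1) * ((u $ 2 - l $ 2) * (u $ 3 - l $ 3))"
    using le by (simp add: emeasure_lborel_box_eq B)
  also have "\<dots> = (\<Prod>b\<in>Basis. (u - l) \<bullet> b)"
  proof -
    have "(\<Prod>b\<in>Basis. (u - l) \<bullet> b) = (\<Prod>i\<in>UNIV. (u - l) $ i)"
      by (rule prod.reindex_bij_witness[where i = "\<lambda>i. axis i 1" and j = axis_index])
        (auto simp: Basis_vec_def inner_axis axis_index_axis)
    then show ?thesis unfolding UNIV_3 by simp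
  qed
  finally show "emeasure (distr lborel borel (\<lambda>p. vector [fst p, fst (snd p), snd (snd p)] :: real ^ 3)) (box l u)
      = (\<Prod>b\<in>Basis. (u - l) \<bullet> b)" .
qed simp

text \<open>The pairs (b, c) with sqrt(a^2 + b^2 + c^2) \<le> t form a disc of area pi (t^2 - a^2),
  and its derivative 2 pi t does not depend on a. Half-lines determine the image measure.\<close>

lemma nn_integral_sqrt_sum_3:
  assumes f [measurable]: "f \<in> borel_measurable borel"
  shows "(\<integral>\<^sup>+bc. f (sqrt (a\<^sup>2 + (fst bc)\<^sup>2 + (snd bc)\<^sup>2)) \<partial>(lborel :: (real \<times> real) measure))
     = (\<integral>\<^sup>+r\<in>{\<bar>a\<bar>..}. ennreal (2 * pi * r) * f r \<partial>lborel)"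
proof -
  let ?g = "\<lambda>bc :: real \<times> real. sqrt (a\<^sup>2 + (fst bc)\<^sup>2 + (snd bc)\<^sup>2)"
  have [measurable]: "?g \<in> borel_measurable borel"
    by (intro borel_measurable_continuous_onI continuous_intros)
  have eq: "distr lborel borel ?g = density lborel (\<lambda>r. indicator {\<bar>a\<bar>..} r * ennreal (2 * pi * r))"
    (is "?M = ?N")
  proof (rule measure_eqI_generator_eq[where E = "range atMost" and \<Omega> = UNIV and A = "\<lambda>n. {..real n}"])
    have main: "emeasure ?M {..t} = (if \<bar>a\<bar> \<le> t then ennreal (pi * (t\<^sup>2 - a\<^sup>2)) else 0)"
        "emeasure ?N {..t} = (if \<bar>a\<bar> \<le> t then ennreal (pi * (t\<^sup>2 - a\<^sup>2)) else 0)" for t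
    proof -
      have "emeasure ?M {..t} = emeasure lborel (?g -` {..t})"
        by (subst emeasure_distr) auto
      also have "?g -` {..t} = (if \<bar>a\<bar> \<le> t then cball 0 (sqrt (t\<^sup>2 - a\<^sup>2)) else {})"
      proof (cases "\<bar>a\<bar> \<le> t")
        case True
        then have "0 \<le> t" "a\<^sup>2 \<le> t\<^sup>2" by (auto simp: abs_le_square_iff[symmetric])
        then have "sqrt (a\<^sup>2 + b\<^sup>2 + c\<^sup>2) \<le> t \<longleftrightarrow> sqrt (b\<^sup>2 + c\<^sup>2) \<le> sqrt (t\<^sup>2 - a\<^sup>2)" for b c :: real
          using real_sqrt_le_iff[of "a\<^sup>2 + b\<^sup>2 + c\<^sup>2" "t\<^sup>2"] by (auto simp: algebra_simps)
        then show ?thesis using True by (auto simp: norm_Pair)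
      next
        case False
        have "\<bar>a\<bar> \<le> sqrt (a\<^sup>2 + b\<^sup>2 + c\<^sup>2)" for b c :: real
          by (rule real_le_rsqrt) simp
        then have "\<not> sqrt (a\<^sup>2 + b\<^sup>2 + c\<^sup>2) \<le> t" for b c :: real
          using False by (meson order_trans)
        then show ?thesis using False by auto
      qed
      also have "emeasure lborel \<dots> = (if \<bar>a\<bar> \<le> t then ennreal (pi * (t\<^sup>2 - a\<^sup>2)) else 0)"
        using abs_le_square_iff[of a t]
        by (auto simp: emeasure_cball unit_ball_vol_2)
      finally show "emeasure ?M {..t} = (if \<bar>a\<bar> \<le> t then ennreal (pi * (t\<^sup>2 - a\<^sup>2)) else 0)" .
      have "emeasure ?N {..t} = (\<integral>\<^sup>+r. ennreal (2 * pi * r) * indicator {\<bar>a\<bar>..t} r \<partial>lborel)"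
        by (subst emeasure_density) (auto intro!: nn_integral_cong simp: indicator_def)
      also have "\<dots> = (if \<bar>a\<bar> \<le> t then ennreal (pi * (t\<^sup>2 - a\<^sup>2)) else 0)"
      proof (cases "\<bar>a\<bar> \<le> t")
        case True
        have "(\<integral>\<^sup>+r. ennreal (2 * pi * r) * indicator {\<bar>a\<bar>..t} r \<partial>lborel) = pi * t\<^sup>2 - pi * \<bar>a\<bar>\<^sup>2"
          by (rule nn_integral_FTC_Icc)
            (use True in \<open>auto intro!: derivative_eq_intros\<close>)
        then show ?thesis using True by (simp add: algebra_simps)
      qed (auto simp: not_le)
      finally show "emeasure ?N {..t} = (if \<bar>a\<bar> \<le> t then ennreal (pi * (t\<^sup>2 - a\<^sup>2)) else 0)" .
    qed
    show "emeasure ?M X = emeasure ?N X" if "X \<in> range atMost" for X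
      using that main by auto
    show "emeasure ?M {..real n} \<noteq> \<infinity>" for n using main by simp
    show "(\<Union>i. {..real i}) = UNIV" using real_arch_simple by auto
    show "Int_stable (range atMost :: real set set)"
      by (auto simp: Int_stable_def)
    show "sets ?M = sigma_sets UNIV (range atMost)" "sets ?N = sigma_sets UNIV (range atMost)"
      by (simp_all add: borel_eq_atMost) 
  qed auto
  have "(\<integral>\<^sup>+bc. f (?g bc) \<partial>lborel) = (\<integral>\<^sup>+r. f r \<partial>?M)"
    by (simp add: nn_integral_distr)
  also have "\<dots> = (\<integral>\<^sup>+r\<in>{\<bar>a\<bar>..}. ennreal (2 * pi * r) * f r \<partial>lborel)"
    unfolding eq by (subst nn_integral_density) (auto intro!: nn_integral_cong simp: mult_ac)
  finally show ?thesis .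
qed

text \<open>The density of Brownian motion killed at 0, as given by the reflection principle,
  transformed by the harmonic function h(r) = r. The parameter of \<open>normal_density\<close> is
  the standard deviation, hence \<open>sqrt t\<close>.\<close>

definition bessel_kernel :: "real \<Rightarrow> real \<Rightarrow> real \<Rightarrow> real" where
  "bessel_kernel t y r =
     r / y * (normal_density y (sqrt t) r - normal_density (- y) (sqrt t) r)"

text \<open>The integrand is the density of the first time at which a one-dimensional Brownian
  motion started at distance c reaches 0. The substitution w = c / sqrt(2 s) reduces it to the
  Gaussian integral over the half-line.\<close>

lemma levy_density_total_mass:
  assumes c: "c > 0"
  shows "(\<integral>\<^sup>+s\<in>{0<..}. ennreal (c / s * (exp (- c\<^sup>2 / (2 * s)) / sqrt (2 * pi * s))) \<partial>lborel) = 1"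
proof -
  define \<Psi> where "\<Psi> w = integral {0..w} (\<lambda>x::real. exp (- x\<^sup>2))" for w
  have der\<Psi>: "(\<Psi> has_real_derivative exp (- w\<^sup>2)) (at w)" if "w > 0" for w
  proof -
    have "(\<Psi> has_real_derivative exp (- w\<^sup>2)) (at w within {0..w + 1})"
      unfolding \<Psi>_def by (rule integral_has_real_derivative) (use that in \<open>auto intro!: continuous_intros\<close>)
    then show ?thesis using that by (simp add: at_within_Icc_at)
  qed
  have lim: "(\<Psi> \<longlongrightarrow> sqrt pi / 2) at_top"
  proof -
    have int: "integrable lborel (\<lambda>x::real. indicator {0..} x *\<^sub>R exp (- x\<^sup>2))"
      and val: "(\<integral>x. indicator {0..} x *\<^sub>R exp (- x\<^sup>2) \<partial>lborel) = sqrt pi / 2"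
      using gaussian_moment_0 by (auto simp: has_bochner_integral_iff)
    have eq: "(\<integral>x. indicator {..w} x *\<^sub>R (indicator {0..} x *\<^sub>R exp (- x\<^sup>2)) \<partial>lborel) = \<Psi> w" for w :: real
    proof -
      have "(\<integral>x. indicator {..w} x *\<^sub>R (indicator {0..} x *\<^sub>R exp (- x\<^sup>2)) \<partial>lborel)
        = (LINT x:{0..w}|lborel. exp (- x\<^sup>2))"
        unfolding set_lebesgue_integral_def
        by (rule Bochner_Integration.integral_cong) (auto simp: indicator_def)
      also have "\<dots> = \<Psi> w" unfolding \<Psi>_def
        by (rule set_borel_integral_eq_integral)
          (auto intro!: borel_integrable_atLeastAtMost' continuous_intros)
      finally show ?thesis .
    qed
    show ?thesis
      using tendsto_integral_at_top[OF _ int] unfolding eq val by simp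
  qed
  have \<Psi>0: "(\<Psi> \<longlongrightarrow> 0) (at_right 0)"
  proof -
    have "continuous_on {0..1} \<Psi>" unfolding \<Psi>_def
      by (intro indefinite_integral_continuous_1 integrable_continuous_real continuous_intros)
    then have "(\<Psi> \<longlongrightarrow> \<Psi> 0) (at 0 within {0..1})" by (simp add: continuous_on)
    then show ?thesis by (simp add: at_within_Icc_at_right \<Psi>_def)
  qed
  \<comment> \<open>Scaled to run from -1 at s = 0 to 0 at infinity: \<Psi> increases from 0 to sqrt
    pi / 2, while its argument decreases in s.\<close>
  define F where "F s = - (2 / sqrt pi) * \<Psi> (c / sqrt (2 * s))" for s
  define f where "f s = c / s * (exp (- c\<^sup>2 / (2 * s)) / sqrt (2 * pi * s))" for s
  have der: "(F has_real_derivative f s) (at s)" if "s > 0" for s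
  proof -
    have "((\<lambda>s. c / sqrt (2 * s)) has_real_derivative - (c / (2 * s * sqrt (2 * s)))) (at s)"
      using that by (auto intro!: derivative_eq_intros simp: field_simps)
    note D = DERIV_chain2[OF der\<Psi> this]
    have "((\<lambda>s. \<Psi> (c / sqrt (2 * s))) has_real_derivative
       exp (- (c / sqrt (2 * s))\<^sup>2) * - (c / (2 * s * sqrt (2 * s)))) (at s)"
      using that c by (intro D) auto
    then have "(F has_real_derivative - (2 / sqrt pi) * (exp (- (c / sqrt (2 * s))\<^sup>2) * - (c / (2 * s * sqrt (2 * s))))) (at s)"
      unfolding F_def by (rule DERIV_cmult)
    also have "- (2 / sqrt pi) * (exp (- (c / sqrt (2 * s))\<^sup>2) * - (c / (2 * s * sqrt (2 * s)))) = f s"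
      using that by (simp add: f_def power_divide real_sqrt_mult field_simps)
    finally show ?thesis .
  qed
  have "(\<integral>\<^sup>+s\<in>{0<..}. ennreal (f s) \<partial>lborel) = 1"
  proof -
    have cont: "isCont f s" if "s > 0" for s
      unfolding f_def using that by (intro continuous_intros) auto
    have limA: "((F \<circ> real_of_ereal) \<longlongrightarrow> - 1) (at_right (ereal 0))"
    proof -
      have "filterlim (\<lambda>s. c / sqrt (2 * s)) at_top (at_right 0)"
        using c by real_asymp
      then have "((\<lambda>s. - (2 / sqrt pi) * \<Psi> (c / sqrt (2 * s))) \<longlongrightarrow> - (2 / sqrt pi) * (sqrt pi / 2)) (at_right 0)"
        by (intro tendsto_intros filterlim_compose[OF lim])
      then have "(F \<longlongrightarrow> - 1) (at_right 0)" by (simp add: F_def[abs_def])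
      then show ?thesis by (subst ereal_tendsto_simps) (simp add: zero_ereal_def)
    qed
    have limB: "((F \<circ> real_of_ereal) \<longlongrightarrow> 0) (at_left \<infinity>)"
    proof -
      have "filterlim (\<lambda>s. c / sqrt (2 * s)) (at_right 0) at_top"
        using c by real_asymp
      then have "((\<lambda>s. - (2 / sqrt pi) * \<Psi> (c / sqrt (2 * s))) \<longlongrightarrow> - (2 / sqrt pi) * 0) at_top"
        by (intro tendsto_intros filterlim_compose[OF \<Psi>0])
      then have "(F \<longlongrightarrow> 0) at_top" by (simp add: F_def[abs_def])
      then show ?thesis by (subst ereal_tendsto_simps)
    qed
    have nonneg: "0 \<le> f s" if "s > 0" for s using that c by (simp add: f_def)
    have ei: "einterval 0 \<infinity> = {0::real<..}"
      by (auto simp: einterval_def zero_ereal_def)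
    have "(\<integral>\<^sup>+s\<in>einterval 0 \<infinity>. ennreal (f s) \<partial>lborel) = ennreal (0 - (- 1))"
      by (rule nn_integral_FTC_einterval[where F = F])
        (use der cont nonneg limA limB in \<open>auto simp: zero_ereal_def\<close>)
    then show ?thesis by (simp add: ei)
  qed
  then show ?thesis by (simp add: f_def)
qed

text \<open>Each of the two Gaussian terms alone has an infinite time integral. Their difference is
  therefore written as an integral over c in [a, b] of hitting-time densities; after exchanging the
  integrals each c contributes mass 1.\<close>

lemma nn_integral_gaussian_difference:
  assumes "0 \<le> a" "a \<le> b"
  shows "(\<integral>\<^sup>+s\<in>{0<..}. ennreal ((exp (- a\<^sup>2 / (2 * s)) - exp (- b\<^sup>2 / (2 * s))) / sqrt (2 * pi * s)) \<partial>lborel)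
    = ennreal (b - a)"
proof -
  have "(\<integral>\<^sup>+s\<in>{0<..}. ennreal ((exp (- a\<^sup>2 / (2 * s)) - exp (- b\<^sup>2 / (2 * s))) / sqrt (2 * pi * s)) \<partial>lborel)
    = (\<integral>\<^sup>+s. (\<integral>\<^sup>+c. ennreal (c / s * (exp (- c\<^sup>2 / (2 * s)) / sqrt (2 * pi * s))) *
          indicator {a..b} c * indicator {0<..} s \<partial>lborel) \<partial>lborel)"
  proof (intro nn_integral_cong)
    fix s :: real
    show "ennreal ((exp (- a\<^sup>2 / (2 * s)) - exp (- b\<^sup>2 / (2 * s))) / sqrt (2 * pi * s)) * indicator {0<..} s
      = (\<integral>\<^sup>+c. ennreal (c / s * (exp (- c\<^sup>2 / (2 * s)) / sqrt (2 * pi * s))) *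
          indicator {a..b} c * indicator {0<..} s \<partial>lborel)"
    proof (cases "s > 0")
      case True
      have "(\<integral>\<^sup>+c. ennreal (c / s * (exp (- c\<^sup>2 / (2 * s)) / sqrt (2 * pi * s))) *
          indicator {a..b} c \<partial>lborel) = (- exp (- b\<^sup>2 / (2 * s)) / sqrt (2 * pi * s))
            - (- exp (- a\<^sup>2 / (2 * s)) / sqrt (2 * pi * s))"
        by (rule nn_integral_FTC_Icc)
          (use True assms in \<open>auto intro!: derivative_eq_intros simp: field_simps\<close>)
      with True show ?thesis by (simp add: diff_divide_distrib)
    qed simp
  qed
  also have "\<dots> = (\<integral>\<^sup>+c. (\<integral>\<^sup>+s. ennreal (c / s * (exp (- c\<^sup>2 / (2 * s)) / sqrt (2 * pi * s))) *
          indicator {a..b} c * indicator {0<..} s \<partial>lborel) \<partial>lborel)"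
    by (rule lborel_pair.Fubini') simp
  also have "\<dots> = (\<integral>\<^sup>+c. indicator {a..b} c \<partial>lborel)"
  \<comment> \<open>c = 0 lies in the interval when a = 0; the integrand vanishes there and the
    total mass is not 1, so this single point is left out.\<close>
  proof (rule nn_integral_cong_AE)
    show "AE c in lborel. (\<integral>\<^sup>+s. ennreal (c / s * (exp (- c\<^sup>2 / (2 * s)) / sqrt (2 * pi * s))) *
          indicator {a..b} c * indicator {0<..} s \<partial>lborel) = indicator {a..b} c"
      using AE_lborel_singleton[of 0]
    proof eventually_elim
      case (elim c)
      have "(\<integral>\<^sup>+s. ennreal (c / s * (exp (- c\<^sup>2 / (2 * s)) / sqrt (2 * pi * s))) *
          indicator {a..b} c * indicator {0<..} s \<partial>lborel) =
         indicator {a..b} c * (\<integral>\<^sup>+s\<in>{0<..}. ennreal (c / s * (exp (- c\<^sup>2 / (2 * s)) / sqrt (2 * pi * s))) \<partial>lborel)"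
        by (subst nn_integral_cmult[symmetric]) (auto intro!: nn_integral_cong simp: mult_ac)
      then show ?case using levy_density_total_mass[of c] elim assms
        by (auto simp: indicator_def)
    qed
  qed
  also have "\<dots> = ennreal (b - a)" using assms by simp
  finally show ?thesis .
qed

lemma nn_integral_bessel_kernel_time:
  assumes "y > 0" "r > 0"
  shows "(\<integral>\<^sup>+s\<in>{0<..}. ennreal (bessel_kernel s y r) \<partial>lborel) = ennreal (r / y * (2 * min y r))"
proof -
  have "(\<integral>\<^sup>+s\<in>{0<..}. ennreal (bessel_kernel s y r) \<partial>lborel) =
    (\<integral>\<^sup>+s. ennreal (r / y) * (ennreal ((exp (- \<bar>r - y\<bar>\<^sup>2 / (2 * s)) - exp (- (r + y)\<^sup>2 / (2 * s))) / sqrt (2 * pi * s)) * indicator {0<..} s) \<partial>lborel)"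
    using assms by (intro nn_integral_cong)
      (auto simp: bessel_kernel_def normal_density_def indicator_def ennreal_mult'[symmetric] diff_divide_distrib)
  also have "\<dots> = ennreal (r / y) * ennreal (r + y - \<bar>r - y\<bar>)"
    using assms nn_integral_gaussian_difference[of "\<bar>r - y\<bar>" "r + y"]
    by (subst nn_integral_cmult) auto
  also have "\<dots> = ennreal (r / y * (2 * min y r))"
    using assms by (subst ennreal_mult'[symmetric]) (auto simp: min_def abs_if)
  finally show ?thesis .
qed

section \<open>Gaussian averages of radial functions in dimension three\<close>

lemma prod_normal_density_Basis:
  fixes z :: "'a :: euclidean_space"
  assumes "s > 0"
  shows "(\<Prod>e\<in>Basis. normal_density 0 (sqrt s) (z \<bullet> e))
     = (1 / sqrt (2 * pi * s)) ^ DIM('a) * exp (- (norm z)\<^sup>2 / (2 * s))"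
proof -
  have "(norm z)\<^sup>2 = (\<Sum>e\<in>Basis. (z \<bullet> e)\<^sup>2)"
    by (subst power2_norm_eq_inner, subst euclidean_inner) (simp add: power2_eq_square)
  then have "exp (- (norm z)\<^sup>2 / (2 * s)) = (\<Prod>e\<in>Basis. exp (- (z \<bullet> e)\<^sup>2 / (2 * s)))"
    by (subst exp_sum[symmetric]) (simp_all add: sum_divide_distrib[symmetric] sum_negf)
  then show ?thesis using assms
    by (simp add: normal_density_def prod_dividef power_one_over)
qed

text \<open>A rotation moves y to the first axis, so the integrand depends only on the first
  coordinate a and the radius r. Integrating out the other two coordinates leaves the weight 2 pi r
  on \<bar>a\<bar> \<le> r, as zones of a sphere have area proportional to their height. The
  Gaussian exponent is linear in a for fixed r, and the integral over [-r, r] yields the difference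
  of two one-dimensional Gaussians.\<close>

lemma nn_integral_norm_gaussian_3:
  fixes y :: "real ^ 3"
  assumes y: "y \<noteq> 0" and s: "s > 0" and f [measurable]: "f \<in> borel_measurable borel"
  shows "(\<integral>\<^sup>+z. f (norm (y + z)) * ennreal (\<Prod>e\<in>Basis. normal_density 0 (sqrt s) (z \<bullet> e)) \<partial>lborel)
    = (\<integral>\<^sup>+r\<in>{0<..}. ennreal (bessel_kernel s (norm y) r) * f r \<partial>lborel)"
proof -
  define n where "n = norm y"
  define C where "C = (1 / sqrt (2 * pi * s)) ^ 3"
  have n: "n > 0" using y by (simp add: n_def)
  have C: "C > 0" using s by (simp add: C_def)
  obtain T :: "real ^ 3 \<Rightarrow> real ^ 3" where T: "orthogonal_transformation T" "T (n *\<^sub>R axis 1 1) = y"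
    using orthogonal_transformation_exists[of "n *\<^sub>R axis 1 1 :: real ^ 3" y] n
    by (auto simp: n_def norm_axis_1)
  have [measurable]: "T \<in> borel_measurable borel"
    using T by (intro borel_measurable_continuous_onI linear_continuous_on)
      (simp add: orthogonal_transformation_linear linear_linear)
  have comp [measurable]: "(\<lambda>w :: real ^ 3. w $ 1) \<in> borel_measurable borel"
    by (intro borel_measurable_continuous_onI continuous_intros)
  define h where "h a r = f r * ennreal (C * exp (- (r\<^sup>2 - 2 * n * a + n\<^sup>2) / (2 * s)))" for a r
  have h [measurable]: "(\<lambda>x. h (p x) (q x)) \<in> borel_measurable L"
    if [measurable]: "p \<in> borel_measurable L" "q \<in> borel_measurable L" for p q and L :: "'c measure"
    unfolding h_def by measurable
  have "(\<integral>\<^sup>+z. f (norm (y + z)) * ennreal (\<Prod>e\<in>Basis. normal_density 0 (sqrt s) (z \<bullet> e)) \<partial>lborel)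
    = (\<integral>\<^sup>+z. f (norm (y + z)) * ennreal (C * exp (- (norm ((y + z) - y))\<^sup>2 / (2 * s))) \<partial>lborel)"
    using s by (simp add: prod_normal_density_Basis C_def)
  also have "\<dots> = (\<integral>\<^sup>+w. f (norm w) * ennreal (C * exp (- (norm (w - y))\<^sup>2 / (2 * s))) \<partial>distr lborel borel ((+) y))"
    by (subst nn_integral_distr) auto
  also have "\<dots> = (\<integral>\<^sup>+w. f (norm w) * ennreal (C * exp (- (norm (w - y))\<^sup>2 / (2 * s))) \<partial>distr lborel borel T)"
    by (simp add: lborel_distr_plus distr_lborel_orthogonal_transformation[OF T(1)])
  also have "\<dots> = (\<integral>\<^sup>+w. f (norm (T w)) * ennreal (C * exp (- (norm (T w - y))\<^sup>2 / (2 * s))) \<partial>lborel)"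
    by (subst nn_integral_distr) auto
  also have "\<dots> = (\<integral>\<^sup>+w. h (w $ 1) (norm w) \<partial>(lborel :: (real ^ 3) measure))"
  proof (rule nn_integral_cong)
    fix w :: "real ^ 3"
    have "T w \<bullet> y = n * w $ 1"
      using T unfolding orthogonal_transformation_def 
      by (metis inner_axis inner_scaleR_right inner_real_def mult.right_neutral)
    then have "(norm (T w - y))\<^sup>2 = (norm w)\<^sup>2 - 2 * n * w $ 1 + n\<^sup>2"
      using orthogonal_transformation_norm[OF T(1), of w] dot_norm_neg[of "T w" y]
      by (simp add: n_def)
    then show "f (norm (T w)) * ennreal (C * exp (- (norm (T w - y))\<^sup>2 / (2 * s))) = h (w $ 1) (norm w)"
      using orthogonal_transformation_norm[OF T(1), of w] by (simp add: h_def)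
  qed
  also have "\<dots> = (\<integral>\<^sup>+x. h (fst x) (sqrt ((fst x)\<^sup>2 + (fst (snd x))\<^sup>2 + (snd (snd x))\<^sup>2)) \<partial>(lborel :: (real \<times> real \<times> real) measure))"
  proof -
    show ?thesis
      by (subst distr_lborel_vector_3[symmetric], subst nn_integral_distr)
        (auto simp: case_prod_unfold norm_vec_def L2_set_def sum_3)
  qed
  also have "\<dots> = (\<integral>\<^sup>+a. (\<integral>\<^sup>+bc. h a (sqrt (a\<^sup>2 + (fst bc)\<^sup>2 + (snd bc)\<^sup>2)) \<partial>(lborel :: (real \<times> real) measure)) \<partial>lborel)"
  proof -
    have [measurable]: "(fst :: real \<times> real \<Rightarrow> real) \<in> borel_measurable borel"
        "(snd :: real \<times> real \<Rightarrow> real) \<in> borel_measurable borel"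
      by (auto intro!: borel_measurable_continuous_onI continuous_intros)
    show ?thesis
      by (subst lborel_prod[symmetric], subst lborel.nn_integral_fst[symmetric]) auto
  qed
  also have "\<dots> = (\<integral>\<^sup>+a. (\<integral>\<^sup>+r\<in>{\<bar>a\<bar>..}. ennreal (2 * pi * r) * h a r \<partial>lborel) \<partial>lborel)"
    by (intro nn_integral_cong nn_integral_sqrt_sum_3) measurable
  also have "\<dots> = (\<integral>\<^sup>+r. (\<integral>\<^sup>+a. ennreal (2 * pi * r) * h a r * indicator {x. \<bar>fst x\<bar> \<le> snd x} (a, r) \<partial>lborel) \<partial>lborel)"
    by (subst lborel_pair.Fubini') (auto intro!: nn_integral_cong simp: indicator_def)
  also have "\<dots> = (\<integral>\<^sup>+r\<in>{0<..}. ennreal (bessel_kernel s n r) * f r \<partial>lborel)"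
  proof (rule nn_integral_cong_AE, use AE_lborel_singleton[of 0] in eventually_elim)
    case (elim r)
    show ?case
    proof (cases "r > 0")
      case False
      then have E: "(\<lambda>a. ennreal (2 * pi * r) * h a r * indicator {x. \<bar>fst x\<bar> \<le> snd x} (a, r)) = (\<lambda>a. 0)"
        by (auto simp: fun_eq_iff indicator_def ennreal_neg mult_nonneg_nonpos)
      show ?thesis unfolding E using False by simp
    next
      case True
      define g where "g a = exp (- (r\<^sup>2 - 2 * n * a + n\<^sup>2) / (2 * s))" for a
      have [measurable]: "g \<in> borel_measurable borel" by (simp add: g_def[abs_def])
      have g: "(\<integral>\<^sup>+a. ennreal (g a) * indicator {-r..r} a \<partial>lborel) = s / n * g r - s / n * g (- r)"
        by (rule nn_integral_FTC_Icc)
          (use True n s in \<open>auto simp: g_def intro!: derivative_eq_intros\<close>)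
      have "(\<integral>\<^sup>+a. ennreal (2 * pi * r) * h a r * indicator {x. \<bar>fst x\<bar> \<le> snd x} (a, r) \<partial>lborel)
         = (\<integral>\<^sup>+a. (ennreal (2 * pi * r * C) * f r) * (ennreal (g a) * indicator {-r..r} a) \<partial>lborel)"
        using True C by (intro nn_integral_cong)
          (auto simp: indicator_def h_def g_def ennreal_mult'' mult_ac)
      also have "\<dots> = ennreal (2 * pi * r * C) * f r * ennreal (s / n * g r - s / n * g (- r))"
        by (subst nn_integral_cmult) (simp_all add: g)
      also have "\<dots> = ennreal (2 * pi * r * C * (s / n * g r - s / n * g (- r))) * f r"
      proof -
        have E: "ennreal (2 * pi * r * C * D) = ennreal (2 * pi * r * C) * ennreal D" for D
          using True C by (intro ennreal_mult') simp
        show ?thesis unfolding E by (simp only: mult.assoc mult.commute mult.left_commute)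
      qed
      also have "2 * pi * r * C * (s / n * g r - s / n * g (- r)) = bessel_kernel s n r"
      proof -
        \<comment> \<open>The normalising constant drops from dimension three to dimension one: 2 pi
          comes from the area of the zones, s from the integration over a.\<close>
        have "2 * pi * s * C = 1 / sqrt (2 * pi * s)"
          using s by (simp add: C_def power3_eq_cube field_simps)
        moreover have "g r = exp (- (r - n)\<^sup>2 / (2 * s))" "g (- r) = exp (- (r + n)\<^sup>2 / (2 * s))"
          by (simp_all add: g_def power2_diff power2_sum algebra_simps)
        moreover have "2 * pi * r * C * (s / n * g r - s / n * g (- r)) = r / n * ((2 * pi * s * C) * g r - (2 * pi * s * C) * g (- r))"
          by (simp add: algebra_simps)
        ultimately show ?thesis using s
          by (simp add: bessel_kernel_def normal_density_def)
      qed
      finally show ?thesis using True by simp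
    qed
  qed
  finally show ?thesis by (simp add: n_def)
qed

section \<open>Semigroup and Green operator of the radial kernel\<close>

definition bessel_semigroup :: "real \<Rightarrow> (real \<Rightarrow> ennreal) \<Rightarrow> real \<Rightarrow> ennreal" where
  "bessel_semigroup s f y = (\<integral>\<^sup>+r\<in>{0<..}. ennreal (bessel_kernel s y r) * f r \<partial>lborel)"

definition bessel_green :: "(real \<Rightarrow> ennreal) \<Rightarrow> real \<Rightarrow> ennreal" where
  "bessel_green f y = (\<integral>\<^sup>+r\<in>{0<..}. ennreal (r / y * (2 * min y r)) * f r \<partial>lborel)"

lemma bessel_kernel_measurable [measurable]:
  assumes [measurable]: "g \<in> borel_measurable L" "h \<in> borel_measurable L" "k \<in> borel_measurable L"
  shows "(\<lambda>x. bessel_kernel (g x) (h x) (k x)) \<in> borel_measurable L"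
  unfolding bessel_kernel_def normal_density_def by measurable

lemma bessel_semigroup_measurable [measurable]:
  assumes [measurable]: "f \<in> borel_measurable borel" "g \<in> borel_measurable L" "h \<in> borel_measurable L"
  shows "(\<lambda>x. bessel_semigroup (g x) f (h x)) \<in> borel_measurable L"
  unfolding bessel_semigroup_def by measurable

lemma bessel_green_measurable [measurable]:
  assumes [measurable]: "f \<in> borel_measurable borel"
  shows "bessel_green f \<in> borel_measurable borel"
  unfolding bessel_green_def by measurable

lemma nn_integral_bessel_semigroup_time:
  assumes y: "y > 0" and [measurable]: "f \<in> borel_measurable borel"
  shows "(\<integral>\<^sup>+s\<in>{0<..}. bessel_semigroup s f y \<partial>lborel) = bessel_green f y"
proof -
  have "(\<integral>\<^sup>+s\<in>{0<..}. bessel_semigroup s f y \<partial>lborel)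
    = (\<integral>\<^sup>+s. (\<integral>\<^sup>+r. ennreal (bessel_kernel s y r) * f r * indicator {0<..} r * indicator {0<..} s \<partial>lborel) \<partial>lborel)"
    unfolding bessel_semigroup_def by (intro nn_integral_cong, subst nn_integral_multc) auto
  also have "\<dots> = (\<integral>\<^sup>+r. (\<integral>\<^sup>+s. ennreal (bessel_kernel s y r) * f r * indicator {0<..} r * indicator {0<..} s \<partial>lborel) \<partial>lborel)"
    by (rule lborel_pair.Fubini') simp
  also have "\<dots> = (\<integral>\<^sup>+r. f r * indicator {0<..} r * (\<integral>\<^sup>+s\<in>{0<..}. ennreal (bessel_kernel s y r) \<partial>lborel) \<partial>lborel)"
    by (intro nn_integral_cong, subst nn_integral_cmult[symmetric]) (auto simp: mult_ac)
  also have "\<dots> = bessel_green f y"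
    unfolding bessel_green_def
  proof (intro nn_integral_cong)
    fix r :: real
    show "f r * indicator {0<..} r * (\<integral>\<^sup>+s\<in>{0<..}. ennreal (bessel_kernel s y r) \<partial>lborel)
      = ennreal (r / y * (2 * min y r)) * f r * indicator {0<..} r"
      using nn_integral_bessel_kernel_time[OF y, of r] by (cases "r > 0") (simp_all add: mult.commute)
  qed
  finally show ?thesis .
qed

section \<open>The Bessel potential and its Green equation\<close>

definition bessel_potential :: "real \<Rightarrow> real \<Rightarrow> real \<Rightarrow> real \<Rightarrow> real" where
  "bessel_potential \<theta> p q r = p / (exp (\<theta> * r) - 1) + q / (exp (\<theta> * r) - 1)\<^sup>2"

lemma bessel_potential_measurable [measurable]: "bessel_potential \<theta> p q \<in> borel_measurable borel"
  unfolding bessel_potential_def[abs_def] by measurable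

lemma bessel_potential_nonneg:
  "\<lbrakk>\<theta> > 0; p \<ge> 0; q \<ge> 0; r > 0\<rbrakk> \<Longrightarrow> 0 \<le> bessel_potential \<theta> p q r"
  by (simp add: bessel_potential_def)

lemma bessel_potential_isCont:
  "\<lbrakk>\<theta> > 0; r > 0\<rbrakk> \<Longrightarrow> isCont (bessel_potential \<theta> p q) r"
  unfolding bessel_potential_def[abs_def] by (intro continuous_intros) auto

lemma bessel_potential_antimono:
  assumes "\<theta> > 0" "p \<ge> 0" "q \<ge> 0" "0 < r" "r \<le> r'"
  shows "bessel_potential \<theta> p q r' \<le> bessel_potential \<theta> p q r"
proof -
  have "0 < exp (\<theta> * r) - 1" "exp (\<theta> * r) - 1 \<le> exp (\<theta> * r') - 1" using assms by auto
  then show ?thesis unfolding bessel_potential_def using assms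
    by (intro add_mono divide_left_mono power_mono mult_pos_pos) auto
qed

text \<open>The potential is at most of order 1/r^2 at 0, which the factor r min(y, r) of the Green
  kernel balances, and it decays exponentially at infinity. Both effects are put into one bound by a
  multiple of exp(-\<theta> r / 2).\<close>

lemma bessel_green_potential_finite:
  assumes \<theta>: "\<theta> > 0" and p: "p \<ge> 0" and q: "q \<ge> 0" and y: "y > 0"
  shows "bessel_green (\<lambda>r. ennreal (bessel_potential \<theta> p q r)) y < \<infinity>"
proof -
  define C where "C = 4 * p / \<theta> + 8 * q / (y * \<theta>\<^sup>2)"
  have C: "C \<ge> 0" using assms by (simp add: C_def)
  have bound: "r / y * (2 * min y r) * bessel_potential \<theta> p q r \<le> C * exp (- (\<theta> / 2) * r)" if r: "r > 0" for r
  proof -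
    define w where "w = \<theta> * r"
    define e where "e = exp (- (\<theta> / 2) * r)"
    have w: "w > 0" using r \<theta> by (simp add: w_def)
    have e: "0 < e" "e \<le> 1" using r \<theta> by (auto simp: e_def)
    have ew: "exp (w / 2) = 1 / e" by (simp add: e_def w_def exp_minus field_simps)
    \<comment> \<open>Of the two factors, the first is at least w/2 and controls the singularity at
      0, while the second is at least e^(w/2) and provides the decay.\<close>
    have "exp w - 1 = (exp (w / 2) - 1) * (exp (w / 2) + 1)"
      by (simp add: algebra_simps exp_add[symmetric])
    also have "\<dots> \<ge> (w / 2) * exp (w / 2)"
    proof (rule mult_mono)
      show "w / 2 \<le> exp (w / 2) - 1" using exp_ge_add_one_self[of "w / 2"] by linarith
    qed (use w in auto)
    finally have "w / (2 * e) \<le> exp w - 1" by (simp add: ew)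
    then have le: "1 / (exp w - 1) \<le> 2 * e / w"
      using w e by (simp add: field_simps)
    have "p / (exp w - 1) \<le> p * (2 * e / w)"
      using mult_left_mono[OF le p] by simp
    moreover have "q / (exp w - 1)\<^sup>2 \<le> q * (2 * e / w)\<^sup>2"
      using mult_left_mono[OF power_mono[OF le, of 2] q] w by (simp add: power_divide)
    ultimately have "bessel_potential \<theta> p q r \<le> p * (2 * e / w) + q * (2 * e / w)\<^sup>2"
      by (simp add: bessel_potential_def w_def)
    also have "q * (2 * e / w)\<^sup>2 \<le> q * (4 * e / w\<^sup>2)"
      using e q by (intro mult_left_mono) (auto simp: power2_eq_square divide_right_mono mult_left_le)
    finally have V: "bessel_potential \<theta> p q r \<le> p * (2 * e / w) + q * (4 * e / w\<^sup>2)" by simp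
    have "r / y * (2 * min y r) * bessel_potential \<theta> p q r \<le> r / y * (2 * min y r) * (p * (2 * e / w) + q * (4 * e / w\<^sup>2))"
      using r y by (intro mult_left_mono V) auto
    also have "\<dots> = r / y * (2 * min y r) * (p * (2 * e / w)) + r / y * (2 * min y r) * (q * (4 * e / w\<^sup>2))"
      by (simp add: distrib_left)
    \<comment> \<open>The minimum is bounded by y in the term of order 1/w and by r in the term of
      order 1/w^2, so that all powers of r cancel; the two summands of \<open>C\<close> are what
      remains.\<close>
    also have "\<dots> \<le> r / y * (2 * y) * (p * (2 * e / w)) + r / y * (2 * r) * (q * (4 * e / w\<^sup>2))"
      using r y p q e w by (intro add_mono mult_right_mono mult_left_mono) auto
    also have "\<dots> = C * e"
      using r y \<theta> by (simp add: C_def w_def field_simps power2_eq_square)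
    finally show ?thesis by (simp add: e_def)
  qed
  have "bessel_green (\<lambda>r. ennreal (bessel_potential \<theta> p q r)) y
    \<le> (\<integral>\<^sup>+r. ennreal (C * exp (- (\<theta> / 2) * r)) * indicator {0..} r \<partial>lborel)"
    unfolding bessel_green_def
  proof (rule nn_integral_mono)
    fix r :: real
    show "ennreal (r / y * (2 * min y r)) * ennreal (bessel_potential \<theta> p q r) * indicator {0<..} r
      \<le> ennreal (C * exp (- (\<theta> / 2) * r)) * indicator {0..} r"
      using bound[of r] y by (cases "r > 0") (auto simp: ennreal_mult'[symmetric] intro!: ennreal_leI)
  qed
  also have "\<dots> = ennreal (0 - (- (2 * C / \<theta>) * exp (- (\<theta> / 2) * 0)))"
  proof (rule nn_integral_FTC_atLeast)
    show "((\<lambda>r. - (2 * C / \<theta>) * exp (- (\<theta> / 2) * r)) \<longlongrightarrow> 0) at_top"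
      using \<theta> by real_asymp
  qed (use \<theta> C in \<open>auto intro!: derivative_eq_intros\<close>)
  also have "\<dots> < \<infinity>" by simp
  finally show ?thesis .
qed

text \<open>In the variable z = 1 - e^(-\<theta> x), with z^(\<gamma>/2) split off, v'' = 2 V v is
  the hypergeometric equation with constants \<gamma> and \<open>P\<close>. The relation g (g - 1) =
  2q/\<theta>^2 for g = \<gamma>/2 cancels the q-term of V, and its p-term is absorbed by
  \<open>P\<close>.\<close>

lemma hypergeometric_green_equation:
  fixes A :: "nat \<Rightarrow> real"
  assumes \<theta>: "\<theta> > 0" and p: "p \<ge> 0" and q: "q \<ge> 0"
    and \<gamma>: "\<gamma> = 1 + sqrt (1 + 8 * q / \<theta>\<^sup>2)"
    and P: "P = \<gamma> / 2 + 2 * p / \<theta>\<^sup>2"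
    and Apos: "\<And>n. A n > 0"
    and rec: "\<And>n. A (Suc n) * (real n + 1) * (\<gamma> + real n) = A n * ((real n)\<^sup>2 + \<gamma> * real n + P)"
    and lim: "(\<lambda>n. real n * A n) \<longlonglongrightarrow> 1"
  defines "u \<equiv> \<lambda>x. (1 - exp (- \<theta> * x)) powr (\<gamma> / 2) * (\<Sum>n. A n * (1 - exp (- \<theta> * x)) ^ n) / (x * \<theta>)"
  assumes y: "y > 0"
  shows "bessel_green (\<lambda>r. ennreal (bessel_potential \<theta> p q r * u r)) y = ennreal (1 - u y)"
    and "0 \<le> u y" and "u y \<le> 1"
proof -
  define g where "g = \<gamma> / 2"
  have gg: "g * (g - 1) = 2 * q / \<theta>\<^sup>2"
  proof -
    have "(sqrt (1 + 8 * q / \<theta>\<^sup>2))\<^sup>2 = 1 + 8 * q / \<theta>\<^sup>2" using q by simp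
    then show ?thesis unfolding g_def \<gamma> by (simp add: field_simps power2_eq_square)
  qed
  have g1: "g \<ge> 1" using q by (simp add: g_def \<gamma>)
  define z where "z x = 1 - exp (- \<theta> * x)" for x
  define S where "S z = (\<Sum>n. A n * z ^ n)" for z
  define S1 where "S1 z = (\<Sum>n. diffs A n * z ^ n)" for z
  define S2 where "S2 z = (\<Sum>n. diffs (diffs A) n * z ^ n)" for z
  note series = hypergeometric_series_ode[OF lim rec, folded S_def S1_def S2_def]
  have z: "0 < z x" "z x < 1" if "x > 0" for x using that \<theta> by (auto simp: z_def)
  have S0: "0 \<le> S w" if "0 \<le> w" "w < 1" for w
  proof -
    have s: "(\<lambda>n. A n * w ^ n) sums S w" using that by (intro series(1)) auto
    have "0 \<le> A n * w ^ n" for n using Apos[of n] that by simp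
    then show ?thesis by (rule sums_le[OF _ sums_zero s])
  qed
  define v where "v x = 1 / \<theta> * (z x powr g * S (z x))" for x
  define dv where "dv x = exp (- \<theta> * x) * (g * z x powr (g - 1) * S (z x) + z x powr g * S1 (z x))" for x
  have uv: "u x = v x / x" for x by (simp add: u_def v_def z_def S_def g_def)
  have vu: "v x = x * u x" if "x > 0" for x using that by (simp add: uv)
  have Dz: "(z has_real_derivative \<theta> * exp (- \<theta> * x)) (at x)" for x
    unfolding z_def by (auto intro!: derivative_eq_intros)
  have Dp: "((\<lambda>x. z x powr c) has_real_derivative c * z x powr (c - 1) * (\<theta> * exp (- \<theta> * x))) (at x)" if "x > 0" for x c
    by (rule DERIV_chain2[OF has_real_derivative_powr Dz]) (rule z[OF that])
  have DS: "((\<lambda>x. S (z x)) has_real_derivative S1 (z x) * (\<theta> * exp (- \<theta> * x))) (at x)" if "x > 0" for x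
    by (rule DERIV_chain2[OF series(2) Dz]) (use z[OF that] in auto)
  have DS1: "((\<lambda>x. S1 (z x)) has_real_derivative S2 (z x) * (\<theta> * exp (- \<theta> * x))) (at x)" if "x > 0" for x
    by (rule DERIV_chain2[OF series(3) Dz]) (use z[OF that] in auto)
  have Dv: "(v has_real_derivative dv x) (at x)" if "x > 0" for x
  proof -
    have "((\<lambda>x. 1 / \<theta> * (z x powr g * S (z x))) has_real_derivative
      1 / \<theta> * (g * z x powr (g - 1) * (\<theta> * exp (- \<theta> * x)) * S (z x) + S1 (z x) * (\<theta> * exp (- \<theta> * x)) * z x powr g)) (at x)"
      by (intro DERIV_cmult DERIV_mult Dp DS that)
    also have "1 / \<theta> * (g * z x powr (g - 1) * (\<theta> * exp (- \<theta> * x)) * S (z x) + S1 (z x) * (\<theta> * exp (- \<theta> * x)) * z x powr g) = dv x"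
      using \<theta> by (simp add: dv_def field_simps)
    finally show ?thesis by (simp add: v_def[abs_def])
  qed
  have Ddv: "(dv has_real_derivative 2 * bessel_potential \<theta> p q x * v x) (at x)" if x: "x > 0" for x
  proof -
    define E where "E = exp (- \<theta> * x)"
    \<comment> \<open>The lowest power of z left by two differentiations. With it factored out, what
      remains to be checked is polynomial in z.\<close>
    define w where "w = z x powr (g - 2)"
    have zE: "z x = 1 - E" by (simp add: z_def E_def)
    have E: "0 < E" "E < 1" using z[OF x] by (auto simp: zE E_def)
    have w1: "z x powr (g - 1) = w * z x"
      using z[OF x] powr_add[of "z x" "g - 2" 1] by (simp add: w_def)
    have w2: "z x powr g = w * (z x)\<^sup>2"
      using z[OF x] powr_add[of "z x" "g - 2" 2] by (simp add: w_def)
    have "((\<lambda>x. exp (- \<theta> * x) * (g * z x powr (g - 1) * S (z x) + z x powr g * S1 (z x))) has_real_derivative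
       - \<theta> * E * (g * z x powr (g - 1) * S (z x) + z x powr g * S1 (z x)) +
       ((g * ((g - 1) * z x powr (g - 1 - 1) * (\<theta> * E))) * S (z x) + S1 (z x) * (\<theta> * E) * (g * z x powr (g - 1)) +
        (g * z x powr (g - 1) * (\<theta> * E) * S1 (z x) + S2 (z x) * (\<theta> * E) * z x powr g)) * E) (at x)"
      unfolding E_def
      by (intro DERIV_mult DERIV_add DERIV_cmult Dp DS DS1 x) (auto intro!: derivative_eq_intros)
    moreover have "- \<theta> * E * (g * z x powr (g - 1) * S (z x) + z x powr g * S1 (z x)) +
       ((g * ((g - 1) * z x powr (g - 1 - 1) * (\<theta> * E))) * S (z x) + S1 (z x) * (\<theta> * E) * (g * z x powr (g - 1)) +
        (g * z x powr (g - 1) * (\<theta> * E) * S1 (z x) + S2 (z x) * (\<theta> * E) * z x powr g)) * E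
      = 2 * bessel_potential \<theta> p q x * v x"
    proof -
      have ode: "z x * (1 - z x) * S2 (z x) + (\<gamma> - (\<gamma> + 1) * z x) * S1 (z x) - P * S (z x) = 0"
        by (rule series(4)) (use z[OF x] in auto)
      have pot: "bessel_potential \<theta> p q x = p * E / z x + q * E\<^sup>2 / (z x)\<^sup>2"
      proof -
        have "exp (\<theta> * x) - 1 = z x / E" by (simp add: z_def E_def exp_minus field_simps)
        then show ?thesis by (simp add: bessel_potential_def power_divide)
      qed
      have Vv: "2 * bessel_potential \<theta> p q x * v x = \<theta> * E * w * ((P - g) * z x + g * (g - 1) * E) * S (z x)"
      proof -
        have Pg: "P - g = 2 * p / \<theta>\<^sup>2" by (simp add: P g_def)
        show ?thesis
          unfolding pot v_def w2 gg Pg using z[OF x] \<theta> by (simp add: field_simps power2_eq_square)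
      qed
      have w3: "z x powr (g - 1 - 1) = w" by (simp add: w_def)
      have \<gamma>g: "\<gamma> = 2 * g" by (simp add: g_def)
      \<comment> \<open>The second derivative of v differs from the required right-hand side exactly
        by \<theta> E w Z times the left side of the hypergeometric equation.\<close>
      have alg: "- \<theta> * E * (g * (w * Z) * s + (w * Z\<^sup>2) * s1) +
       ((g * ((g - 1) * w * (\<theta> * E))) * s + s1 * (\<theta> * E) * (g * (w * Z)) +
        (g * (w * Z) * (\<theta> * E) * s1 + s2 * (\<theta> * E) * (w * Z\<^sup>2))) * E
        = \<theta> * E * w * ((P - g) * Z + g * (g - 1) * E) * s
          + \<theta> * E * w * Z * (Z * (1 - Z) * s2 + (2 * g - (2 * g + 1) * Z) * s1 - P * s)"
        if "E = 1 - Z" for Z s s1 s2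
        unfolding that by (simp add: algebra_simps power2_eq_square)
      show ?thesis
        unfolding w3 w1 w2 Vv
        using alg[of "z x" "S (z x)" "S1 (z x)" "S2 (z x)"] ode unfolding \<gamma>g by (simp add: zE)
    qed
    ultimately show ?thesis by (simp add: dv_def[abs_def])
  qed
  have v_nonneg: "0 \<le> v x" if "x > 0" for x
    using z[OF that] S0[of "z x"] \<theta> by (simp add: v_def)
  have v0: "(v \<longlongrightarrow> 0) (at_right 0)"
  proof -
    have z0: "(z \<longlongrightarrow> 0) (at_right 0)"
    proof -
      have "isCont z 0" using Dz by (rule DERIV_isCont)
      then have "(z \<longlongrightarrow> z 0) (at 0)" by (simp add: isCont_def)
      then show ?thesis by (simp add: filterlim_at_split z_def[of 0])
    qed
    have "\<forall>\<^sub>F x in at_right 0. 0 \<le> z x"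
      using eventually_at_right_less[of 0] by eventually_elim (use z in \<open>auto intro: less_imp_le\<close>)
    then have "((\<lambda>x. z x powr g) \<longlongrightarrow> 0 powr g) (at_right 0)"
      using g1 by (intro tendsto_powr' z0 tendsto_const) auto
    moreover have "isCont S 0" by (rule DERIV_isCont[OF series(2)]) simp
    then have "((\<lambda>x. S (z x)) \<longlongrightarrow> S 0) (at_right 0)" using z0 by (rule isCont_tendsto_compose)
    ultimately have "((\<lambda>x. 1 / \<theta> * (z x powr g * S (z x))) \<longlongrightarrow> 1 / \<theta> * (0 powr g * S 0)) (at_right 0)"
      by (intro tendsto_mult tendsto_const)
    then show ?thesis using g1 by (simp add: v_def[abs_def])
  qed
  have vinf: "((\<lambda>x. v x / x) \<longlongrightarrow> 1) at_top"
  proof -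
    have zl: "filterlim z (at_left 1) at_top" unfolding z_def using \<theta> by real_asymp
    then have z1: "(z \<longlongrightarrow> 1) at_top" by (simp add: filterlim_at)
    have "((\<lambda>x. S (z x) / - ln (1 - z x)) \<longlongrightarrow> 1) at_top"
      using filterlim_compose[OF abelian_log_asymptotics[OF lim] zl] by (simp add: S_def)
    moreover have "((\<lambda>x. z x powr g) \<longlongrightarrow> 1 powr g) at_top"
      by (intro tendsto_powr z1 tendsto_const) auto
    ultimately have "((\<lambda>x. z x powr g * (S (z x) / - ln (1 - z x))) \<longlongrightarrow> 1 powr g * 1) at_top"
      by (intro tendsto_mult)
    moreover have "z x powr g * (S (z x) / - ln (1 - z x)) = v x / x" for x
      by (simp add: v_def z_def)
    ultimately show ?thesis by simp
  qed
  note G = convex_ode_green_identity[OF Dv Ddv bessel_potential_isCont[OF \<theta>] bessel_potential_nonneg[OF \<theta> p q] v_nonneg v0 vinf y]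
  show "0 \<le> u y" using v_nonneg[OF y] y by (simp add: uv)
  show "u y \<le> 1" using G(2) y by (simp add: uv)
  have vm [measurable]: "(\<lambda>r. ennreal (2 * min y r * bessel_potential \<theta> p q r * v r) * indicator {0<..} r) \<in> borel_measurable lborel"
  proof -
    have "continuous_on {0<..} v" using Dv by (intro continuous_at_imp_continuous_on) (auto intro: DERIV_isCont)
    then have "(\<lambda>r. indicator {0<..} r *\<^sub>R v r) \<in> borel_measurable borel"
      by (intro borel_measurable_continuous_on_indicator) auto
    then have "(\<lambda>r. ennreal (2 * min y r * bessel_potential \<theta> p q r * (indicator {0<..} r *\<^sub>R v r))) \<in> borel_measurable borel"
      by measurable
    also have "(\<lambda>r. ennreal (2 * min y r * bessel_potential \<theta> p q r * (indicator {0<..} r *\<^sub>R v r)))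
       = (\<lambda>r. ennreal (2 * min y r * bessel_potential \<theta> p q r * v r) * indicator {0<..} r)"
      by (auto simp: indicator_def)
    finally show ?thesis by simp
  qed
  have "bessel_green (\<lambda>r. ennreal (bessel_potential \<theta> p q r * u r)) y
    = (\<integral>\<^sup>+r. ennreal (1 / y) * (ennreal (2 * min y r * bessel_potential \<theta> p q r * v r) * indicator {0<..} r) \<partial>lborel)"
    unfolding bessel_green_def
  proof (rule nn_integral_cong)
    fix r :: real
    show "ennreal (r / y * (2 * min y r)) * ennreal (bessel_potential \<theta> p q r * u r) * indicator {0<..} r
      = ennreal (1 / y) * (ennreal (2 * min y r * bessel_potential \<theta> p q r * v r) * indicator {0<..} r)"
    proof (cases "r > 0")
      case True
      have "ennreal (r / y * (2 * min y r)) * ennreal (bessel_potential \<theta> p q r * u r)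
        = ennreal (r / y * (2 * min y r) * (bessel_potential \<theta> p q r * u r))"
        using y True by (intro ennreal_mult'[symmetric]) auto
      also have "r / y * (2 * min y r) * (bessel_potential \<theta> p q r * u r)
        = 1 / y * (2 * min y r * bessel_potential \<theta> p q r * v r)"
        using True by (simp add: vu)
      also have "ennreal \<dots> = ennreal (1 / y) * ennreal (2 * min y r * bessel_potential \<theta> p q r * v r)"
        using y by (intro ennreal_mult') auto
      finally show ?thesis using True by simp
    qed simp
  qed
  also have "\<dots> = ennreal (1 / y) * ennreal (y - v y)"
    by (subst nn_integral_cmult) (simp_all add: G(1))
  also have "\<dots> = ennreal (1 - u y)"
    using y by (subst ennreal_mult'[symmetric]) (auto simp: uv field_simps)
  finally show "bessel_green (\<lambda>r. ennreal (bessel_potential \<theta> p q r * u r)) y = ennreal (1 - u y)" .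
qed

section \<open>Markov property of the Bessel process\<close>

lemma brownian_motion_increment:
  "brownian_motion N B b \<Longrightarrow> 0 \<le> s \<Longrightarrow> s < t \<Longrightarrow> distributed N lborel (\<lambda>\<omega>. B t \<omega> - B s \<omega>)
    (\<lambda>y. ennreal (\<Prod>e\<in>Basis. normal_density 0 (sqrt (t - s)) (y \<bullet> e)))"
  unfolding brownian_motion_def by blast

text \<open>At a positive time the increment has a density and so almost surely avoids the single
  point -b. Only fixed times are covered; exchanging integrals later extends this to almost every
  time, which is all that time integrals see.\<close>

lemma brownian_motion_AE_neq_0:
  assumes bm: "brownian_motion N B (b :: real ^ 3)" and b: "b \<noteq> 0" and t: "t \<ge> 0"
  shows "AE \<omega> in N. B t \<omega> \<noteq> 0"
proof (cases "t = 0")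
  case True
  have "AE \<omega> in N. B 0 \<omega> = b" using bm by (simp add: brownian_motion_def)
  then show ?thesis using True b by auto
next
  case False
  define g where "g = (\<lambda>y :: real ^ 3. ennreal (\<Prod>e\<in>Basis. normal_density 0 (sqrt (t - 0)) (y \<bullet> e)))"
  have d: "distributed N lborel (\<lambda>\<omega>. B t \<omega> - B 0 \<omega>) g"
    unfolding g_def by (rule brownian_motion_increment[OF bm]) (use False t in auto)
  have [measurable]: "(\<lambda>\<omega>. B t \<omega> - B 0 \<omega>) \<in> borel_measurable N" "g \<in> borel_measurable borel"
    using distributed_measurable[OF d] distributed_borel_measurable[OF d] by simp_all
  have "AE y in density lborel g. y \<noteq> - b"
    by (subst AE_density) (use AE_lborel_singleton[of "- b"] in auto)
  then have "AE y in distr N lborel (\<lambda>\<omega>. B t \<omega> - B 0 \<omega>). y \<noteq> - b"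
    by (simp only: distributed_distr_eq_density[OF d])
  then have "AE \<omega> in N. B t \<omega> - B 0 \<omega> \<noteq> - b"
    by (subst (asm) AE_distr_iff) auto
  moreover have "AE \<omega> in N. B 0 \<omega> = b" using bm by (simp add: brownian_motion_def)
  ultimately show ?thesis by eventually_elim auto
qed

text \<open>The independent increment is integrated out with the whole past position y held fixed.
  By rotation invariance the Gaussian average of f(norm(y + z)) depends on y only through its norm,
  which is why the norms alone are Markov. That y is almost surely nonzero is needed, as the kernel
  divides by the norm.\<close>

lemma brownian_motion_norm_markov:
  fixes B :: "real \<Rightarrow> 'w \<Rightarrow> real ^ 3" and \<tau> :: "nat \<Rightarrow> real"
  assumes bm: "brownian_motion N B b" and b: "b \<noteq> 0"
    and \<tau>: "mono \<tau>" "0 \<le> \<tau> 0" "\<tau> n < t"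
    and \<phi> [measurable]: "\<phi> \<in> borel_measurable (PiM {..n} (\<lambda>_. borel))"
    and f [measurable]: "f \<in> borel_measurable borel"
  shows "(\<integral>\<^sup>+\<omega>. \<phi> (\<lambda>i\<in>{..n}. norm (B (\<tau> i) \<omega>)) * f (norm (B t \<omega>)) \<partial>N)
    = (\<integral>\<^sup>+\<omega>. \<phi> (\<lambda>i\<in>{..n}. norm (B (\<tau> i) \<omega>)) * bessel_semigroup (t - \<tau> n) f (norm (B (\<tau> n) \<omega>)) \<partial>N)"
proof -
  interpret prob_space N using bm by (simp add: brownian_motion_def)
  have \<tau>0: "0 \<le> \<tau> i" for i using order_trans[OF \<tau>(2) monoD[OF \<tau>(1) le0]] .
  have t0: "0 \<le> t" using \<tau>0[of n] \<tau> by simp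
  have Bm [measurable]: "B r \<in> borel_measurable N" if "0 \<le> r" for r
    using bm that by (simp add: brownian_motion_def)
  have B0: "AE \<omega> in N. B 0 \<omega> = b" using bm by (simp add: brownian_motion_def)
  \<comment> \<open>Time 0 is put in front and t at the end: \<open>D 0\<close> leads from the
    starting point to time \<open>\<tau> 0\<close>, \<open>D 1\<close> to \<open>D n\<close> join
    the observed times, and \<open>D (Suc n)\<close> is the future increment. Staying at t
    afterwards keeps the sequence monotone.\<close>
  define \<sigma> where "\<sigma> i = (if i = 0 then 0 else if i - 1 \<le> n then \<tau> (i - 1) else t)" for i :: nat
  define D where "D i \<omega> = B (\<sigma> (Suc i)) \<omega> - B (\<sigma> i) \<omega>" for i \<omega>
  have \<sigma>_mono: "mono \<sigma>"
  proof (rule mono_iff_le_Suc[THEN iffD2], intro allI)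
    fix i show "\<sigma> i \<le> \<sigma> (Suc i)"
    proof (cases i)
      case 0 then show ?thesis using \<tau>0 t0 by (simp add: \<sigma>_def)
    next
      case (Suc j)
      have "\<tau> j \<le> \<tau> (Suc j)" using \<tau>(1) by (simp add: monoD)
      moreover have "\<tau> j \<le> t" if "j \<le> n" using monoD[OF \<tau>(1) that] \<tau>(3) by simp
      ultimately show ?thesis by (auto simp: \<sigma>_def Suc)
    qed
  qed
  have \<sigma>0: "0 \<le> \<sigma> i" for i using \<tau>0 t0 by (simp add: \<sigma>_def)
  have Dm [measurable]: "D i \<in> borel_measurable N" for i
    unfolding D_def[abs_def] using \<sigma>0 by measurable
  have ind: "indep_vars (\<lambda>_. borel) D {..<Suc (Suc n)}"
    using bm \<sigma>_mono \<sigma>0[of 0] unfolding brownian_motion_def D_def[abs_def] by blast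
  define X where "X \<omega> = restrict (\<lambda>i. D i \<omega>) {..n}" for \<omega>
  define Y where "Y \<omega> = restrict (\<lambda>i. D i \<omega>) {Suc n}" for \<omega>
  have XY: "indep_var (PiM {..n} (\<lambda>_. borel)) X (PiM {Suc n} (\<lambda>_. borel)) Y"
    unfolding X_def[abs_def] Y_def[abs_def] by (rule indep_var_restrict[OF ind]) auto
  have Xm [measurable]: "X \<in> measurable N (PiM {..n} (\<lambda>_. borel))"
    and Ym [measurable]: "Y \<in> measurable N (PiM {Suc n} (\<lambda>_. borel))"
    and joint: "distr N (PiM {..n} (\<lambda>_. borel) \<Otimes>\<^sub>M PiM {Suc n} (\<lambda>_. borel)) (\<lambda>\<omega>. (X \<omega>, Y \<omega>))
     = distr N (PiM {..n} (\<lambda>_. borel)) X \<Otimes>\<^sub>M distr N (PiM {Suc n} (\<lambda>_. borel)) Y"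
    using XY by (simp_all add: indep_var_distribution_eq)
  define g where "g = (\<lambda>y :: real ^ 3. ennreal (\<Prod>e\<in>Basis. normal_density 0 (sqrt (t - \<tau> n)) (y \<bullet> e)))"
  have d: "distributed N lborel (D (Suc n)) g"
  proof -
    have "D (Suc n) = (\<lambda>\<omega>. B t \<omega> - B (\<tau> n) \<omega>)" by (simp add: D_def[abs_def] \<sigma>_def)
    then show ?thesis unfolding g_def using brownian_motion_increment[OF bm \<tau>0 \<tau>(3)] by simp
  qed
  have gm [measurable]: "g \<in> borel_measurable borel"
    using distributed_borel_measurable[OF d] by simp
  \<comment> \<open>Rebuilds the positions from the increments, so that the past is a function of
    \<open>X\<close>, which is independent of the future increment.\<close>
  define pos where "pos d i = b + (\<Sum>j\<le>i. d j)" for d :: "nat \<Rightarrow> real ^ 3" and i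
  have posm [measurable]: "(\<lambda>d. pos d i) \<in> borel_measurable (PiM {..n} (\<lambda>_. borel))" if "i \<le> n" for i
  proof -
    have "(\<lambda>d. \<Sum>j\<le>i. d j) \<in> borel_measurable (PiM {..n} (\<lambda>_. borel :: (real ^ 3) measure))"
      using that by (intro borel_measurable_sum measurable_component_singleton) auto
    then show ?thesis unfolding pos_def by measurable
  qed
  have pos_X: "AE \<omega> in N. \<forall>i\<le>n. pos (X \<omega>) i = B (\<tau> i) \<omega>"
    using B0
  proof eventually_elim
    case (elim \<omega>)
    have "(\<Sum>j\<le>i. X \<omega> j) = B (\<tau> i) \<omega> - B 0 \<omega>" if "i \<le> n" for i
    proof -
      have "(\<Sum>j\<le>i. X \<omega> j) = (\<Sum>j<Suc i. B (\<sigma> (Suc j)) \<omega> - B (\<sigma> j) \<omega>)"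
        using that unfolding lessThan_Suc_atMost by (intro sum.cong) (auto simp: X_def D_def)
      also have "\<dots> = B (\<sigma> (Suc i)) \<omega> - B (\<sigma> 0) \<omega>" by (rule sum_lessThan_telescope)
      finally show ?thesis using that by (simp add: \<sigma>_def)
    qed
    then show ?case using elim by (simp add: pos_def)
  qed
  define \<Phi> where "\<Phi> d = \<phi> (\<lambda>i\<in>{..n}. norm (pos d i))" for d
  have \<Phi>m [measurable]: "\<Phi> \<in> borel_measurable (PiM {..n} (\<lambda>_. borel))"
  proof -
    have "(\<lambda>d. \<lambda>i\<in>{..n}. norm (pos d i)) \<in> measurable (PiM {..n} (\<lambda>_. borel)) (PiM {..n} (\<lambda>_. borel))"
      by (rule measurable_restrict) (rule measurable_compose[OF posm borel_measurable_norm], simp)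
    then show ?thesis unfolding \<Phi>_def[abs_def] by (rule measurable_compose) (rule \<phi>)
  qed
  have posn [measurable]: "(\<lambda>d. pos d n) \<in> borel_measurable (PiM {..n} (\<lambda>_. borel))" by (rule posm) simp
  define H where "H = (\<lambda>(d, y). \<Phi> d * f (norm (pos d n + y)))"
  have Hm [measurable]: "H \<in> borel_measurable (PiM {..n} (\<lambda>_. borel) \<Otimes>\<^sub>M borel)"
    unfolding H_def by measurable
  have "(\<integral>\<^sup>+\<omega>. \<phi> (\<lambda>i\<in>{..n}. norm (B (\<tau> i) \<omega>)) * f (norm (B t \<omega>)) \<partial>N)
     = (\<integral>\<^sup>+\<omega>. H (X \<omega>, D (Suc n) \<omega>) \<partial>N)"
  proof (rule nn_integral_cong_AE, use pos_X in eventually_elim)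
    case (elim \<omega>)
    have "D (Suc n) \<omega> = B t \<omega> - B (\<tau> n) \<omega>" by (simp add: D_def \<sigma>_def)
    then show ?case using elim by (simp add: H_def \<Phi>_def cong: restrict_cong)
  qed
  also have "\<dots> = (\<integral>\<^sup>+z. H (fst z, snd z (Suc n)) \<partial>distr N (PiM {..n} (\<lambda>_. borel) \<Otimes>\<^sub>M PiM {Suc n} (\<lambda>_. borel)) (\<lambda>\<omega>. (X \<omega>, Y \<omega>)))"
    by (subst nn_integral_distr) (auto simp: Y_def)
  also have "\<dots> = (\<integral>\<^sup>+d. (\<integral>\<^sup>+h. H (d, h (Suc n)) \<partial>distr N (PiM {Suc n} (\<lambda>_. borel)) Y) \<partial>distr N (PiM {..n} (\<lambda>_. borel)) X)"
  proof -
    interpret Y: prob_space "distr N (PiM {Suc n} (\<lambda>_. borel)) Y" by (rule prob_space_distr) simp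
    show ?thesis unfolding joint by (subst Y.nn_integral_fst[symmetric]) auto
  qed
  also have "\<dots> = (\<integral>\<^sup>+d. (\<integral>\<^sup>+y. g y * H (d, y) \<partial>lborel) \<partial>distr N (PiM {..n} (\<lambda>_. borel)) X)"
  proof (rule nn_integral_cong)
    fix d assume "d \<in> space (distr N (PiM {..n} (\<lambda>_. borel)) X)"
    then have [measurable]: "d \<in> space (PiM {..n} (\<lambda>_. borel))" by simp
    have "(\<integral>\<^sup>+h. H (d, h (Suc n)) \<partial>distr N (PiM {Suc n} (\<lambda>_. borel)) Y) = (\<integral>\<^sup>+\<omega>. H (d, D (Suc n) \<omega>) \<partial>N)"
      by (subst nn_integral_distr) (auto simp: Y_def)
    also have "\<dots> = (\<integral>\<^sup>+y. g y * H (d, y) \<partial>lborel)"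
      by (rule distributed_nn_integral[OF d, symmetric]) simp
    finally show "(\<integral>\<^sup>+h. H (d, h (Suc n)) \<partial>distr N (PiM {Suc n} (\<lambda>_. borel)) Y) = (\<integral>\<^sup>+y. g y * H (d, y) \<partial>lborel)" .
  qed
  also have "\<dots> = (\<integral>\<^sup>+\<omega>. (\<integral>\<^sup>+y. g y * H (X \<omega>, y) \<partial>lborel) \<partial>N)"
    by (subst nn_integral_distr) auto
  also have "\<dots> = (\<integral>\<^sup>+\<omega>. \<phi> (\<lambda>i\<in>{..n}. norm (B (\<tau> i) \<omega>)) * bessel_semigroup (t - \<tau> n) f (norm (B (\<tau> n) \<omega>)) \<partial>N)"
  proof (rule nn_integral_cong_AE, use pos_X brownian_motion_AE_neq_0[OF bm b \<tau>0[of n]] in eventually_elim)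
    case (elim \<omega>)
    have "(\<integral>\<^sup>+y. g y * H (X \<omega>, y) \<partial>lborel)
      = (\<integral>\<^sup>+y. \<phi> (\<lambda>i\<in>{..n}. norm (B (\<tau> i) \<omega>)) * (f (norm (B (\<tau> n) \<omega> + y)) * g y) \<partial>lborel)"
      using elim by (intro nn_integral_cong) (simp add: H_def \<Phi>_def mult_ac cong: restrict_cong)
    also have "\<dots> = \<phi> (\<lambda>i\<in>{..n}. norm (B (\<tau> i) \<omega>)) * (\<integral>\<^sup>+y. f (norm (B (\<tau> n) \<omega> + y)) * g y \<partial>lborel)"
      by (rule nn_integral_cmult) simp
    also have "(\<integral>\<^sup>+y. f (norm (B (\<tau> n) \<omega> + y)) * g y \<partial>lborel) = bessel_semigroup (t - \<tau> n) f (norm (B (\<tau> n) \<omega>))"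
      unfolding g_def bessel_semigroup_def
      by (rule nn_integral_norm_gaussian_3) (use elim \<tau> in auto)
    finally show ?case .
  qed
  finally show ?thesis .
qed

text \<open>The Brownian motion lives on another probability space, so properties of
  \<open>R\<close> are transferred as integrals and not as statements on paths. Functions of
  finitely many positions suffice for this; the remaining path properties come from
  continuity.\<close>

lemma bessel3_process_brownian:
  assumes R: "bessel3_process M R x"
  obtains N :: "(real \<Rightarrow> real ^ 3) measure" and B :: "real \<Rightarrow> (real \<Rightarrow> real ^ 3) \<Rightarrow> real ^ 3" and b where "brownian_motion N B b" "norm b = x"
    "\<forall>(n :: nat) \<tau> G. (\<forall>i. 0 \<le> \<tau> i) \<longrightarrow> G \<in> borel_measurable (PiM {..n} (\<lambda>_. borel)) \<longrightarrow>
      (\<integral>\<^sup>+\<omega>. (G (\<lambda>i\<in>{..n}. R (\<tau> i) \<omega>) :: ennreal) \<partial>M) = (\<integral>\<^sup>+\<omega>. G (\<lambda>i\<in>{..n}. norm (B (\<tau> i) \<omega>)) \<partial>N)"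
proof -
  obtain N :: "(real \<Rightarrow> real ^ 3) measure" and B :: "real \<Rightarrow> (real \<Rightarrow> real ^ 3) \<Rightarrow> real ^ 3" and b
    where bm: "brownian_motion N B b" "norm b = x"
    and law: "distr M (\<Pi>\<^sub>M t\<in>{0..}. borel) (\<lambda>\<omega>. \<lambda>t\<in>{0..}. R t \<omega>) =
        distr N (\<Pi>\<^sub>M t\<in>{0..}. borel) (\<lambda>\<omega>. \<lambda>t\<in>{0..}. norm (B t \<omega>))"
    using R unfolding bessel3_process_def by blast
  have [measurable]: "R t \<in> borel_measurable M" "B t \<in> borel_measurable N" if "t \<ge> 0" for t
    using R bm that by (auto simp: bessel3_process_def brownian_motion_def)
  have mR [measurable]: "(\<lambda>\<omega>. \<lambda>t\<in>{0..}. R t \<omega>) \<in> measurable M (\<Pi>\<^sub>M t\<in>{0..}. borel)"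
    by (rule measurable_restrict) simp
  have mB [measurable]: "(\<lambda>\<omega>. \<lambda>t\<in>{0..}. norm (B t \<omega>)) \<in> measurable N (\<Pi>\<^sub>M t\<in>{0..}. borel)"
    by (rule measurable_restrict) simp
  show thesis
  proof (rule that[OF bm], intro allI impI)
    fix n :: nat and \<tau> :: "nat \<Rightarrow> real" and G :: "(nat \<Rightarrow> real) \<Rightarrow> ennreal"
    assume "\<forall>i. 0 \<le> \<tau> i" and G [measurable]: "G \<in> borel_measurable (PiM {..n} (\<lambda>_. borel))"
    then have \<tau>: "\<And>i. 0 \<le> \<tau> i" by simp
    define G' where "G' h = G (\<lambda>i\<in>{..n}. h (\<tau> i))" for h
    have "(\<lambda>h. \<lambda>i\<in>{..n}. h (\<tau> i)) \<in> measurable (\<Pi>\<^sub>M t\<in>{0..}. borel) (PiM {..n} (\<lambda>_. borel :: real measure))"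
      using \<tau> by (intro measurable_restrict measurable_component_singleton) auto
    then have [measurable]: "G' \<in> borel_measurable (\<Pi>\<^sub>M t\<in>{0..}. borel)"
      unfolding G'_def[abs_def] by (rule measurable_compose) (rule G)
    have "(\<integral>\<^sup>+\<omega>. G (\<lambda>i\<in>{..n}. R (\<tau> i) \<omega>) \<partial>M) = (\<integral>\<^sup>+\<omega>. G' (\<lambda>t\<in>{0..}. R t \<omega>) \<partial>M)"
      using \<tau> by (simp add: G'_def cong: restrict_cong)
    also have "\<dots> = (\<integral>\<^sup>+h. G' h \<partial>distr M (\<Pi>\<^sub>M t\<in>{0..}. borel) (\<lambda>\<omega>. \<lambda>t\<in>{0..}. R t \<omega>))"
      by (subst nn_integral_distr) auto
    also have "\<dots> = (\<integral>\<^sup>+\<omega>. G' (\<lambda>t\<in>{0..}. norm (B t \<omega>)) \<partial>N)"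
      unfolding law by (subst nn_integral_distr) auto
    also have "\<dots> = (\<integral>\<^sup>+\<omega>. G (\<lambda>i\<in>{..n}. norm (B (\<tau> i) \<omega>)) \<partial>N)"
      using \<tau> by (simp add: G'_def cong: restrict_cong)
    finally show "(\<integral>\<^sup>+\<omega>. G (\<lambda>i\<in>{..n}. R (\<tau> i) \<omega>) \<partial>M) = (\<integral>\<^sup>+\<omega>. G (\<lambda>i\<in>{..n}. norm (B (\<tau> i) \<omega>)) \<partial>N)" .
  qed
qed

section \<open>Properties of the process drawn from its Brownian representation\<close>

locale bessel3 =
  fixes M :: "'w measure" and R :: "real \<Rightarrow> 'w \<Rightarrow> real" and x :: real
  assumes process: "bessel3_process M R x" and x_pos: "x > 0"
begin

sublocale prob_space M using process by (simp add: bessel3_process_def)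

lemma R_measurable [measurable]: "t \<ge> 0 \<Longrightarrow> R t \<in> borel_measurable M"
  using process by (simp add: bessel3_process_def)

text \<open>Nothing is known of \<open>R t\<close> for negative t. Composing with
  \<open>max 0\<close> extends the path by its value at time 0 and makes it a continuous function on
  the whole line, ready for integrals over \<open>lborel\<close>.\<close>

lemma continuous_path: "\<omega> \<in> space M \<Longrightarrow> continuous_on UNIV (\<lambda>t. R (max 0 t) \<omega>)"
proof -
  assume "\<omega> \<in> space M"
  then have "continuous_on {0..} (\<lambda>t. R t \<omega>)" using process by (simp add: bessel3_process_def)
  then show ?thesis
    by (rule continuous_on_compose2) (auto intro!: continuous_intros)
qed

lemma AE_start: "AE \<omega> in M. R 0 \<omega> = x"
proof -
  obtain N :: "(real \<Rightarrow> real ^ 3) measure" and B :: "real \<Rightarrow> (real \<Rightarrow> real ^ 3) \<Rightarrow> real ^ 3" and b where bm: "brownian_motion N B b" "norm b = x"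
    and fd: "\<forall>(n :: nat) \<tau> G. (\<forall>i. 0 \<le> \<tau> i) \<longrightarrow> G \<in> borel_measurable (PiM {..n} (\<lambda>_. borel)) \<longrightarrow>
      (\<integral>\<^sup>+\<omega>. (G (\<lambda>i\<in>{..n}. R (\<tau> i) \<omega>) :: ennreal) \<partial>M) = (\<integral>\<^sup>+\<omega>. G (\<lambda>i\<in>{..n}. norm (B (\<tau> i) \<omega>)) \<partial>N)"
    by (rule bessel3_process_brownian[OF process], rule that, assumption+)
  \<comment> \<open>An almost sure property of a single position passes between the two spaces as
    the vanishing integral of an indicator.\<close>
  have "(\<integral>\<^sup>+\<omega>. indicator (- {x}) (R 0 \<omega>) \<partial>M) = (\<integral>\<^sup>+\<omega>. indicator (- {x}) (norm (B 0 \<omega>)) \<partial>N)"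
    using fd[rule_format, of "\<lambda>_. 0" "\<lambda>h. indicator (- {x}) (h 0)" 0] by simp
  also have "\<dots> = (\<integral>\<^sup>+\<omega>. 0 \<partial>N)"
  proof (rule nn_integral_cong_AE)
    have "AE \<omega> in N. B 0 \<omega> = b" using bm by (simp add: brownian_motion_def)
    then show "AE \<omega> in N. indicator (- {x}) (norm (B 0 \<omega>)) = (0 :: ennreal)"
      by eventually_elim (simp add: bm)
  qed
  finally have "(\<integral>\<^sup>+\<omega>. indicator (- {x}) (R 0 \<omega>) \<partial>M) = 0" by simp
  then have "AE \<omega> in M. indicator (- {x}) (R 0 \<omega>) = (0 :: ennreal)"
    by (rule nn_integral_0_iff_AE[THEN iffD1, rotated]) simp
  then show ?thesis by eventually_elim (auto simp: indicator_def split: if_splits)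
qed

lemma AE_pos:
  assumes t: "t \<ge> 0" shows "AE \<omega> in M. R t \<omega> > 0"
proof -
  obtain N :: "(real \<Rightarrow> real ^ 3) measure" and B :: "real \<Rightarrow> (real \<Rightarrow> real ^ 3) \<Rightarrow> real ^ 3" and b where bm: "brownian_motion N B b" "norm b = x"
    and fd: "\<forall>(n :: nat) \<tau> G. (\<forall>i. 0 \<le> \<tau> i) \<longrightarrow> G \<in> borel_measurable (PiM {..n} (\<lambda>_. borel)) \<longrightarrow>
      (\<integral>\<^sup>+\<omega>. (G (\<lambda>i\<in>{..n}. R (\<tau> i) \<omega>) :: ennreal) \<partial>M) = (\<integral>\<^sup>+\<omega>. G (\<lambda>i\<in>{..n}. norm (B (\<tau> i) \<omega>)) \<partial>N)"
    by (rule bessel3_process_brownian[OF process], rule that, assumption+)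
  have "b \<noteq> 0" using bm x_pos by auto
  have "(\<integral>\<^sup>+\<omega>. indicator {..0} (R t \<omega>) \<partial>M) = (\<integral>\<^sup>+\<omega>. indicator {..0} (norm (B t \<omega>)) \<partial>N)"
    using fd[rule_format, of "\<lambda>_. t" "\<lambda>h. indicator {..0} (h 0)" 0] t by simp
  also have "\<dots> = (\<integral>\<^sup>+\<omega>. 0 \<partial>N)"
    by (rule nn_integral_cong_AE, use brownian_motion_AE_neq_0[OF bm(1) \<open>b \<noteq> 0\<close> t] in eventually_elim)
      (auto simp: indicator_def)
  finally have "(\<integral>\<^sup>+\<omega>. indicator {..0} (R t \<omega>) \<partial>M) = 0" by simp
  then have "AE \<omega> in M. indicator {..0} (R t \<omega>) = (0 :: ennreal)"
    by (rule nn_integral_0_iff_AE[THEN iffD1, rotated]) (use t in simp)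
  then show ?thesis by eventually_elim (auto simp: indicator_def split: if_splits)
qed

lemma markov:
  fixes \<tau> :: "nat \<Rightarrow> real"
  assumes \<tau>: "mono \<tau>" "0 \<le> \<tau> 0" "\<tau> n < t"
    and \<phi> [measurable]: "\<phi> \<in> borel_measurable (PiM {..n} (\<lambda>_. borel))"
    and f [measurable]: "f \<in> borel_measurable borel"
  shows "(\<integral>\<^sup>+\<omega>. \<phi> (\<lambda>i\<in>{..n}. R (\<tau> i) \<omega>) * f (R t \<omega>) \<partial>M)
    = (\<integral>\<^sup>+\<omega>. \<phi> (\<lambda>i\<in>{..n}. R (\<tau> i) \<omega>) * bessel_semigroup (t - \<tau> n) f (R (\<tau> n) \<omega>) \<partial>M)"
proof -
  obtain N :: "(real \<Rightarrow> real ^ 3) measure" and B :: "real \<Rightarrow> (real \<Rightarrow> real ^ 3) \<Rightarrow> real ^ 3" and b where bm: "brownian_motion N B b" "norm b = x"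
    and fd: "\<forall>(n :: nat) \<tau> G. (\<forall>i. 0 \<le> \<tau> i) \<longrightarrow> G \<in> borel_measurable (PiM {..n} (\<lambda>_. borel)) \<longrightarrow>
      (\<integral>\<^sup>+\<omega>. (G (\<lambda>i\<in>{..n}. R (\<tau> i) \<omega>) :: ennreal) \<partial>M) = (\<integral>\<^sup>+\<omega>. G (\<lambda>i\<in>{..n}. norm (B (\<tau> i) \<omega>)) \<partial>N)"
    by (rule bessel3_process_brownian[OF process], rule that, assumption+)
  have b: "b \<noteq> 0" using bm x_pos by auto
  have \<tau>0: "0 \<le> \<tau> i" for i using order_trans[OF \<tau>(2) monoD[OF \<tau>(1) le0]] .
  \<comment> \<open>Appends t as coordinate \<open>Suc n\<close>, which makes the left-hand side a
    function of finitely many positions. The right-hand side needs only the original times.\<close>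
  define \<tau>' where "\<tau>' i = (if i \<le> n then \<tau> i else t)" for i
  have \<tau>'0: "0 \<le> \<tau>' i" for i using \<tau>0[of i] \<tau>0[of n] \<tau>(3) by (auto simp: \<tau>'_def)
  have [measurable]: "(\<lambda>h. restrict h {..n}) \<in> measurable (PiM {..Suc n} (\<lambda>_. borel :: real measure)) (PiM {..n} (\<lambda>_. borel))"
    by (rule measurable_restrict_subset) auto
  have [measurable]: "(\<lambda>h. h (Suc n)) \<in> borel_measurable (PiM {..Suc n} (\<lambda>_. borel :: real measure))"
    by (rule measurable_component_singleton) auto
  have [measurable]: "(\<lambda>h. h n) \<in> borel_measurable (PiM {..n} (\<lambda>_. borel :: real measure))"
    by (rule measurable_component_singleton) auto
  have r1: "restrict (\<lambda>i\<in>{..Suc n}. g (\<tau>' i)) {..n} = (\<lambda>i\<in>{..n}. g (\<tau> i))"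
    and r2: "(\<lambda>i\<in>{..Suc n}. g (\<tau>' i)) (Suc n) = g t" for g :: "real \<Rightarrow> real"
    by (auto simp: fun_eq_iff \<tau>'_def)
  have "(\<integral>\<^sup>+\<omega>. \<phi> (\<lambda>i\<in>{..n}. R (\<tau> i) \<omega>) * f (R t \<omega>) \<partial>M)
     = (\<integral>\<^sup>+\<omega>. \<phi> (\<lambda>i\<in>{..n}. norm (B (\<tau> i) \<omega>)) * f (norm (B t \<omega>)) \<partial>N)"
    using fd[rule_format, of \<tau>' "\<lambda>h. \<phi> (restrict h {..n}) * f (h (Suc n))" "Suc n", OF \<tau>'0]
    unfolding r1[of "\<lambda>t. R t _"] r2[of "\<lambda>t. R t _"] r1[of "\<lambda>t. norm (B t _)"] r2[of "\<lambda>t. norm (B t _)"]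
    by simp
  also have "\<dots> = (\<integral>\<^sup>+\<omega>. \<phi> (\<lambda>i\<in>{..n}. norm (B (\<tau> i) \<omega>)) * bessel_semigroup (t - \<tau> n) f (norm (B (\<tau> n) \<omega>)) \<partial>N)"
    by (rule brownian_motion_norm_markov[OF bm(1) b \<tau> \<phi> f])
  also have "\<dots> = (\<integral>\<^sup>+\<omega>. \<phi> (\<lambda>i\<in>{..n}. R (\<tau> i) \<omega>) * bessel_semigroup (t - \<tau> n) f (R (\<tau> n) \<omega>) \<partial>M)"
    using fd[rule_format, of \<tau> "\<lambda>h. \<phi> h * bessel_semigroup (t - \<tau> n) f (h n)" n, OF \<tau>0] by simp
  finally show ?thesis .
qed

text \<open>Each \<open>R t\<close> is measurable in \<omega> alone. Reading the process at the next
  point of a grid involves only countably many times and is jointly measurable; by continuity of the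
  paths these approximations converge.\<close>

lemma joint_measurable [measurable]:
  "(\<lambda>(t, \<omega>). R (max 0 t) \<omega>) \<in> borel_measurable (borel \<Otimes>\<^sub>M M)"
proof (rule borel_measurable_LIMSEQ_metric)
  \<comment> \<open>For negative t, \<open>nat\<close> truncates the ceiling to 0, in agreement with
    \<open>max 0 t\<close>.\<close>
  define F :: "nat \<Rightarrow> real \<times> 'w \<Rightarrow> real" where "F k = (\<lambda>(t, \<omega>). R (real (nat \<lceil>real (Suc k) * t\<rceil>) / real (Suc k)) \<omega>)" for k
  show "F k \<in> borel_measurable (borel \<Otimes>\<^sub>M M)" for k
  proof -
    have "(\<lambda>z. (\<lambda>i z. R (real i / real (Suc k)) (snd z)) (nat \<lceil>real (Suc k) * fst z\<rceil>) z)
       \<in> borel_measurable (borel \<Otimes>\<^sub>M M)"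
      by (rule measurable_compose_countable) simp_all
    then show ?thesis by (simp add: F_def case_prod_unfold)
  qed
  fix z :: "real \<times> 'w" assume "z \<in> space (borel \<Otimes>\<^sub>M M)"
  then obtain t :: real and \<omega> where z: "z = (t, \<omega>)" "\<omega> \<in> space M" by (auto simp: space_pair_measure)
  have lim: "(\<lambda>k. real (nat \<lceil>real (Suc k) * t\<rceil>) / real (Suc k)) \<longlonglongrightarrow> max 0 t"
  proof (cases "t \<ge> 0")
    case True
    have "(\<lambda>k. real_of_int \<lceil>real (Suc k) * t\<rceil> / real (Suc k)) \<longlonglongrightarrow> t" by real_asymp
    then show ?thesis using True by (simp add: max_def)
  next
    case False
    then have "nat \<lceil>real (Suc k) * t\<rceil> = 0" for k
      by (simp add: mult_nonneg_nonpos ceiling_le_zero del: of_nat_Suc)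
    then show ?thesis using False by (simp add: max_def)
  qed
  have "continuous_on {0..} (\<lambda>t. R t \<omega>)" using process z by (simp add: bessel3_process_def)
  from continuous_on_tendsto_compose[OF this lim]
  show "(\<lambda>k. F k z) \<longlonglongrightarrow> (case z of (t, \<omega>) \<Rightarrow> R (max 0 t) \<omega>)"
    by (simp add: F_def z)
qed

end

section \<open>Feynman-Kac formula\<close>

lemma riemann_sum_tendsto_integral:
  fixes g :: "real \<Rightarrow> real"
  assumes g: "continuous_on UNIV g" and s: "s \<ge> 0"
  shows "(\<lambda>k. s / real (Suc k) * (\<Sum>i<Suc k. g (s * real i / real (Suc k)))) \<longlonglongrightarrow> integral {0..s} g"
proof (rule LIMSEQ_I)
  fix e :: real assume e: "e > 0"
  \<comment> \<open>The base point -1 makes \<open>G\<close> differentiable from both sides at 0, as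
    the mean value theorem requires on the first cell.\<close>
  define G where "G y = integral {-1..y} g" for y
  have G: "(G has_real_derivative g y) (at y)" if "0 \<le> y" for y
  proof -
    have "(G has_real_derivative g y) (at y within {-1..y + 1})"
      unfolding G_def using that g by (intro integral_has_real_derivative) (auto intro: continuous_on_subset)
    then show ?thesis using that by (simp add: at_within_Icc_at)
  qed
  have Gs: "G s - G 0 = integral {0..s} g"
    using Henstock_Kurzweil_Integration.integral_combine[of "-1" 0 s g] s
      integrable_continuous_real[OF continuous_on_subset[OF g subset_UNIV], of "-1" s]
    by (simp add: G_def)
  have uc: "uniformly_continuous_on {0..s} g"
    using g by (intro compact_uniformly_continuous) (auto intro: continuous_on_subset)
  \<comment> \<open>Dividing by s + 1 and not by s covers s = 0, and since s/(s+1) < 1 the final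
    inequality is strict.\<close>
  have "0 < e / (s + 1)" using e s by simp
  from uniformly_continuous_onE[OF uc this] obtain d where d: "d > 0"
    "\<And>y z. y \<in> {0..s} \<Longrightarrow> z \<in> {0..s} \<Longrightarrow> dist z y < d \<Longrightarrow> dist (g z) (g y) < e / (s + 1)"
    by metis
  obtain K where K: "s / d < real K" using reals_Archimedean2 by blast
  show "\<exists>K. \<forall>k\<ge>K. norm (s / real (Suc k) * (\<Sum>i<Suc k. g (s * real i / real (Suc k))) - integral {0..s} g) < e"
  proof (intro exI allI impI)
    fix k assume k: "k \<ge> K"
    define n where "n = real (Suc k)"
    have n: "n > 0" by (simp add: n_def)
    have "s / d < n" using K k by (simp add: n_def)
    then have sn: "s / n < d" using d n by (simp add: field_simps)
    define t where "t i = s * real i / n" for i :: nat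
    have t: "t (Suc i) - t i = s / n" "0 \<le> t i" for i
      using n s by (simp_all add: t_def field_simps)
    have ts: "t i \<le> s" if "i \<le> Suc k" for i
    proof -
      have "s * real i \<le> s * n" using that s by (intro mult_left_mono) (auto simp: n_def)
      then show ?thesis using n by (simp add: t_def field_simps)
    qed
    have cell: "\<bar>s / n * g (t i) - (G (t (Suc i)) - G (t i))\<bar> \<le> s / n * (e / (s + 1))" if i: "i < Suc k" for i
    proof (cases "s = 0")
      case True then show ?thesis by (simp add: t_def)
    next
      case False
      then have lt: "t i < t (Suc i)" using t(1)[of i] s n by (smt (verit) divide_pos_pos)
      have "\<exists>z. t i < z \<and> z < t (Suc i) \<and> G (t (Suc i)) - G (t i) = (t (Suc i) - t i) * g z"
      proof (rule MVT2[OF lt])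
        fix y assume "t i \<le> y"
        then show "(G has_real_derivative g y) (at y)" using t(2)[of i] by (intro G) simp
      qed
      then obtain z where z: "t i < z" "z < t (Suc i)" "G (t (Suc i)) - G (t i) = s / n * g z"
        using t by auto
      have "dist (g (t i)) (g z) < e / (s + 1)"
        using z ts[of "Suc i"] i t(1)[of i] t(2)[of i] sn by (intro d(2)) (auto simp: dist_real_def)
      then have "\<bar>g (t i) - g z\<bar> \<le> e / (s + 1)" by (simp add: dist_real_def)
      then have "s / n * \<bar>g (t i) - g z\<bar> \<le> s / n * (e / (s + 1))" using s n by (intro mult_left_mono) auto
      moreover have "s / n * g (t i) - (G (t (Suc i)) - G (t i)) = s / n * (g (t i) - g z)"
        using z by (simp add: right_diff_distrib)
      ultimately show ?thesis using s n by (simp add: abs_mult)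
    qed
    have "s / n * (\<Sum>i<Suc k. g (t i)) - integral {0..s} g = (\<Sum>i<Suc k. s / n * g (t i) - (G (t (Suc i)) - G (t i)))"
    proof -
      have "t (Suc k) = s" using n by (simp add: t_def n_def)
      then have "(\<Sum>i<Suc k. G (t (Suc i)) - G (t i)) = integral {0..s} g"
        unfolding Gs[symmetric] by (subst sum_lessThan_telescope) (simp add: t_def)
      then show ?thesis by (simp add: sum_subtractf sum_distrib_left del: sum.lessThan_Suc)
    qed
    also have "\<bar>\<dots>\<bar> \<le> (\<Sum>i<Suc k. s / n * (e / (s + 1)))"
      by (rule order_trans[OF sum_abs sum_mono]) (use cell in auto)
    also have "\<dots> = s * (e / (s + 1))" using n by (simp add: n_def)
    also have "\<dots> < e" using s e by (simp add: field_simps)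
    finally show "norm (s / real (Suc k) * (\<Sum>i<Suc k. g (s * real i / real (Suc k))) - integral {0..s} g) < e"
      by (simp add: n_def t_def)
  qed
qed

text \<open>The integrand is the derivative of -exp(-G). Both parts are applied path by path: the
  bounded range integrates out an earlier time s < t, the unbounded one gives 1 - exp(-a) with a the
  total integral.\<close>

lemma nn_integral_exp_neg_primitive:
  fixes g :: "real \<Rightarrow> real"
  assumes g: "continuous_on UNIV g" "\<And>s. 0 \<le> g s"
  defines "G \<equiv> \<lambda>s. integral {0..s} g"
  shows "0 < r \<Longrightarrow> (\<integral>\<^sup>+s\<in>{0<..<r}. ennreal (g s * exp (- G s)) \<partial>lborel) = ennreal (1 - exp (- G r))"
    and "(\<integral>\<^sup>+s\<in>{0<..}. ennreal (g s) \<partial>lborel) = ennreal a \<Longrightarrow> 0 \<le> a \<Longrightarrow>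
      (\<integral>\<^sup>+s\<in>{0<..}. ennreal (g s * exp (- G s)) \<partial>lborel) = ennreal (1 - exp (- a))"
proof -
  have gc: "isCont g s" for s using g(1) by (simp add: continuous_on_eq_continuous_at)
  have G: "(G has_real_derivative g s) (at s)" if "0 < s" for s
  proof -
    have "(G has_real_derivative g s) (at s within {0..s + 1})"
      unfolding G_def using that g(1) by (intro integral_has_real_derivative) (auto intro: continuous_on_subset)
    then show ?thesis using that by (simp add: at_within_Icc_at)
  qed
  have D: "((\<lambda>s. - exp (- G s)) has_real_derivative g s * exp (- G s)) (at s)" if "0 < s" for s
    using G[OF that] by (auto intro!: derivative_eq_intros)
  have "continuous_on {0..1} G" unfolding G_def
    by (intro indefinite_integral_continuous_1 integrable_continuous_real continuous_on_subset[OF g(1)]) auto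
  then have "(G \<longlongrightarrow> G 0) (at 0 within {0..1})" by (simp add: continuous_on)
  then have G0: "(G \<longlongrightarrow> 0) (at_right 0)" by (simp add: at_within_Icc_at_right G_def)
  have "((\<lambda>s. - exp (- G s)) \<longlongrightarrow> - exp (- 0)) (at_right 0)"
    by (intro tendsto_intros G0)
  then have L: "((\<lambda>s. - exp (- G s)) \<longlongrightarrow> - 1) (at_right 0)" by simp
  have cont: "isCont (\<lambda>s. g s * exp (- G s)) s" if "0 < s" for s
    using G[OF that] gc by (intro continuous_intros) (auto intro: DERIV_isCont)
  show "(\<integral>\<^sup>+s\<in>{0<..<r}. ennreal (g s * exp (- G s)) \<partial>lborel) = ennreal (1 - exp (- G r))" if r: "0 < r" for r
  proof -
    have "einterval 0 (ereal r) = {0<..<r}" by (auto simp: einterval_def zero_ereal_def)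
    moreover have "(\<integral>\<^sup>+s\<in>einterval 0 (ereal r). ennreal (g s * exp (- G s)) \<partial>lborel) = ennreal (- exp (- G r) - (- 1))"
    proof (rule nn_integral_FTC_einterval[where F = "\<lambda>s. - exp (- G s)"])
      show "(((\<lambda>s. - exp (- G s)) \<circ> real_of_ereal) \<longlongrightarrow> - 1) (at_right 0)"
        using L by (simp add: zero_ereal_def ereal_tendsto_simps)
      have "((\<lambda>s. - exp (- G s)) \<longlongrightarrow> - exp (- G r)) (at r)"
        using DERIV_isCont[OF D[OF r]] by (simp add: isCont_def)
      then have "((\<lambda>s. - exp (- G s)) \<longlongrightarrow> - exp (- G r)) (at_left r)"
        by (rule filterlim_mono) (auto simp: at_le)
      then show "(((\<lambda>s. - exp (- G s)) \<circ> real_of_ereal) \<longlongrightarrow> - exp (- G r)) (at_left (ereal r))"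
        by (simp add: ereal_tendsto_simps)
    qed (use r D cont g in \<open>auto simp: zero_ereal_def\<close>)
    ultimately show ?thesis by simp
  qed
  show "(\<integral>\<^sup>+s\<in>{0<..}. ennreal (g s * exp (- G s)) \<partial>lborel) = ennreal (1 - exp (- a))"
    if fin: "(\<integral>\<^sup>+s\<in>{0<..}. ennreal (g s) \<partial>lborel) = ennreal a" and a: "0 \<le> a"
  proof -
    have gm [measurable]: "g \<in> borel_measurable borel" using g(1) by (rule borel_measurable_continuous_onI)
    have "(\<integral>\<^sup>+s. ennreal (indicator {0<..} s *\<^sub>R g s) \<partial>lborel) = ennreal a"
      unfolding fin[symmetric] by (intro nn_integral_cong) (auto simp: indicator_def)
    then have hbi: "has_bochner_integral lborel (\<lambda>s. indicator {0<..} s *\<^sub>R g s) a"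
      by (intro has_bochner_integral_nn_integral) (use g a in auto)
    then have int: "integrable lborel (\<lambda>s. indicator {0<..} s *\<^sub>R g s)"
      and val: "(\<integral>s. indicator {0<..} s *\<^sub>R g s \<partial>lborel) = a"
      by (auto simp: has_bochner_integral_iff)
    have eq: "(\<integral>s. indicator {..w} s *\<^sub>R (indicator {0<..} s *\<^sub>R g s) \<partial>lborel) = G w" for w
    proof -
      have "(\<integral>s. indicator {..w} s *\<^sub>R (indicator {0<..} s *\<^sub>R g s) \<partial>lborel) = (LINT s:{0..w}|lborel. g s)"
        unfolding set_lebesgue_integral_def
        by (rule Bochner_Integration.integral_cong_AE, simp, simp, use AE_lborel_singleton[of 0] in eventually_elim) (auto simp: indicator_def)
      also have "\<dots> = G w" unfolding G_def
        by (rule set_borel_integral_eq_integral)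
          (intro borel_integrable_atLeastAtMost' continuous_on_subset[OF g(1)], auto)
      finally show ?thesis .
    qed
    have lim: "(G \<longlongrightarrow> a) at_top"
      using tendsto_integral_at_top[OF _ int] unfolding eq val by simp
    have "einterval 0 \<infinity> = {0::real<..}" by (auto simp: einterval_def zero_ereal_def)
    moreover have "(\<integral>\<^sup>+s\<in>einterval 0 \<infinity>. ennreal (g s * exp (- G s)) \<partial>lborel) = ennreal (- exp (- a) - (- 1))"
    proof (rule nn_integral_FTC_einterval[where F = "\<lambda>s. - exp (- G s)"])
      show "(((\<lambda>s. - exp (- G s)) \<circ> real_of_ereal) \<longlongrightarrow> - 1) (at_right 0)"
        using L by (simp add: zero_ereal_def ereal_tendsto_simps)
      have "((\<lambda>s. - exp (- G s)) \<longlongrightarrow> - exp (- a)) at_top"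
        by (intro tendsto_intros lim)
      then show "(((\<lambda>s. - exp (- G s)) \<circ> real_of_ereal) \<longlongrightarrow> - exp (- a)) (at_left \<infinity>)"
        by (simp add: ereal_tendsto_simps)
    qed (use D cont g in \<open>auto simp: zero_ereal_def\<close>)
    ultimately show ?thesis by simp
  qed
qed

lemma exp_neg_measurable [measurable]: "exp_neg \<in> borel_measurable borel"
  unfolding exp_neg_def[abs_def] by measurable

lemma exp_neg_bounds: "0 \<le> exp_neg a" "exp_neg a \<le> 1"
  by (auto simp: exp_neg_def)

section \<open>Occupation integrals and the discounted Markov property\<close>

context bessel3
begin

lemma R_max_measurable [measurable (raw)]:
  assumes [measurable]: "g \<in> borel_measurable L" "h \<in> measurable L M"
  shows "(\<lambda>z. R (max 0 (g z)) (h z)) \<in> borel_measurable L"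
proof -
  have "(\<lambda>z. (\<lambda>(t, \<omega>). R (max 0 t) \<omega>) (g z, h z)) \<in> borel_measurable L"
    by (rule measurable_compose[OF _ joint_measurable]) measurable
  then show ?thesis by simp
qed

text \<open>The Markov property integrated over all future times. The shift by
  \<open>\<tau> n\<close> removes the starting time, and the time integral of the semigroup is the
  Green operator, provided the current position is positive.\<close>

lemma markov_occupation:
  fixes \<tau> :: "nat \<Rightarrow> real"
  assumes \<tau>: "mono \<tau>" "0 \<le> \<tau> 0"
    and \<phi> [measurable]: "\<phi> \<in> borel_measurable (PiM {..n} (\<lambda>_. borel))"
    and f [measurable]: "f \<in> borel_measurable borel"
  shows "(\<integral>\<^sup>+\<omega>. \<phi> (\<lambda>i\<in>{..n}. R (\<tau> i) \<omega>) * (\<integral>\<^sup>+t\<in>{\<tau> n<..}. f (R (max 0 t) \<omega>) \<partial>lborel) \<partial>M)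
    = (\<integral>\<^sup>+\<omega>. \<phi> (\<lambda>i\<in>{..n}. R (\<tau> i) \<omega>) * bessel_green f (R (\<tau> n) \<omega>) \<partial>M)"
proof -
  interpret P: pair_sigma_finite M lborel ..
  have \<tau>0: "0 \<le> \<tau> i" for i using order_trans[OF \<tau>(2) monoD[OF \<tau>(1) le0]] .
  have "(\<lambda>\<omega>. \<lambda>i\<in>{..n}. R (\<tau> i) \<omega>) \<in> measurable M (PiM {..n} (\<lambda>_. borel))"
    by (rule measurable_restrict) (use \<tau>0 in simp)
  then have \<phi>R [measurable]: "(\<lambda>\<omega>. \<phi> (\<lambda>i\<in>{..n}. R (\<tau> i) \<omega>)) \<in> borel_measurable M"
    by (rule measurable_compose) (rule \<phi>)
  have Rn [measurable]: "R (\<tau> n) \<in> borel_measurable M" using \<tau>0 by simp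
  have "(\<integral>\<^sup>+\<omega>. \<phi> (\<lambda>i\<in>{..n}. R (\<tau> i) \<omega>) * (\<integral>\<^sup>+t\<in>{\<tau> n<..}. f (R (max 0 t) \<omega>) \<partial>lborel) \<partial>M)
    = (\<integral>\<^sup>+\<omega>. (\<integral>\<^sup>+t. \<phi> (\<lambda>i\<in>{..n}. R (\<tau> i) \<omega>) * f (R (max 0 t) \<omega>) * indicator {\<tau> n<..} t \<partial>lborel) \<partial>M)"
    by (intro nn_integral_cong, subst nn_integral_cmult[symmetric]) (auto simp: mult_ac)
  also have "\<dots> = (\<integral>\<^sup>+t. (\<integral>\<^sup>+\<omega>. \<phi> (\<lambda>i\<in>{..n}. R (\<tau> i) \<omega>) * f (R (max 0 t) \<omega>) * indicator {\<tau> n<..} t \<partial>M) \<partial>lborel)"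
    by (rule P.Fubini'[symmetric]) simp
  also have "\<dots> = (\<integral>\<^sup>+t. (\<integral>\<^sup>+\<omega>. \<phi> (\<lambda>i\<in>{..n}. R (\<tau> i) \<omega>) * bessel_semigroup (t - \<tau> n) f (R (\<tau> n) \<omega>) * indicator {\<tau> n<..} t \<partial>M) \<partial>lborel)"
  proof (rule nn_integral_cong)
    fix t
    show "(\<integral>\<^sup>+\<omega>. \<phi> (\<lambda>i\<in>{..n}. R (\<tau> i) \<omega>) * f (R (max 0 t) \<omega>) * indicator {\<tau> n<..} t \<partial>M)
      = (\<integral>\<^sup>+\<omega>. \<phi> (\<lambda>i\<in>{..n}. R (\<tau> i) \<omega>) * bessel_semigroup (t - \<tau> n) f (R (\<tau> n) \<omega>) * indicator {\<tau> n<..} t \<partial>M)"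
    proof (cases "\<tau> n < t")
      case True
      then have "max 0 t = t" using \<tau>0[of n] by simp
      then show ?thesis using markov[OF \<tau> True \<phi> f] True by simp
    qed simp
  qed
  also have "\<dots> = (\<integral>\<^sup>+\<omega>. (\<integral>\<^sup>+t. \<phi> (\<lambda>i\<in>{..n}. R (\<tau> i) \<omega>) * bessel_semigroup (t - \<tau> n) f (R (\<tau> n) \<omega>) * indicator {\<tau> n<..} t \<partial>lborel) \<partial>M)"
    by (rule P.Fubini') simp
  also have "\<dots> = (\<integral>\<^sup>+\<omega>. \<phi> (\<lambda>i\<in>{..n}. R (\<tau> i) \<omega>) * bessel_green f (R (\<tau> n) \<omega>) \<partial>M)"
  proof (rule nn_integral_cong_AE, use AE_pos[OF \<tau>0[of n]] in eventually_elim)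
    case (elim \<omega>)
    have "(\<integral>\<^sup>+t. \<phi> (\<lambda>i\<in>{..n}. R (\<tau> i) \<omega>) * bessel_semigroup (t - \<tau> n) f (R (\<tau> n) \<omega>) * indicator {\<tau> n<..} t \<partial>lborel)
      = (\<integral>\<^sup>+t. \<phi> (\<lambda>i\<in>{..n}. R (\<tau> i) \<omega>) * (bessel_semigroup t f (R (\<tau> n) \<omega>) * indicator {0<..} t) \<partial>lborel)"
      by (subst nn_integral_real_affine[where c = 1 and t = "\<tau> n"])
        (auto intro!: nn_integral_cong simp: indicator_def mult_ac)
    also have "\<dots> = \<phi> (\<lambda>i\<in>{..n}. R (\<tau> i) \<omega>) * bessel_green f (R (\<tau> n) \<omega>)"
      by (subst nn_integral_cmult) (auto simp: nn_integral_bessel_semigroup_time[OF elim f])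
    finally show ?case .
  qed
  finally show ?thesis .
qed

lemma occupation_integral:
  assumes s: "s \<ge> 0" and f [measurable]: "f \<in> borel_measurable borel"
  shows "(\<integral>\<^sup>+\<omega>. (\<integral>\<^sup>+t\<in>{s<..}. f (R (max 0 t) \<omega>) \<partial>lborel) \<partial>M) = (\<integral>\<^sup>+\<omega>. bessel_green f (R s \<omega>) \<partial>M)"
  using markov_occupation[of "\<lambda>_. s" "\<lambda>_. 1" 0 f] s by (simp add: mono_def)

lemma discounted_path_limit:
  fixes w :: "real \<Rightarrow> real"
  assumes w: "continuous_on UNIV w" and s: "s \<ge> 0" and \<omega>: "\<omega> \<in> space M"
  shows "(\<lambda>k. s / real (Suc k) * (\<Sum>i<Suc k. w (R (max 0 (s * real i / real (Suc k))) \<omega>)))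
     \<longlonglongrightarrow> integral {0..s} (\<lambda>r. w (R (max 0 r) \<omega>))"
  using continuous_on_compose2[OF w continuous_path[OF \<omega>]] s
  by (intro riemann_sum_tendsto_integral) auto

lemma path_integral_measurable:
  fixes w :: "real \<Rightarrow> real"
  assumes w: "continuous_on UNIV w"
  shows "(\<lambda>(s, \<omega>). integral {0..max 0 s} (\<lambda>r. w (R (max 0 r) \<omega>))) \<in> borel_measurable (borel \<Otimes>\<^sub>M M)"
proof (rule borel_measurable_LIMSEQ_metric)
  have [measurable]: "w \<in> borel_measurable borel" using w by (rule borel_measurable_continuous_onI)
  show "(\<lambda>(s, \<omega>). max 0 s / real (Suc k) * (\<Sum>i<Suc k. w (R (max 0 (max 0 s * real i / real (Suc k))) \<omega>)))
     \<in> borel_measurable (borel \<Otimes>\<^sub>M M)" for k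
    by measurable
  fix z assume "z \<in> space ((borel :: real measure) \<Otimes>\<^sub>M M)"
  then show "(\<lambda>k. case z of (s, \<omega>) \<Rightarrow> max 0 s / real (Suc k) * (\<Sum>i<Suc k. w (R (max 0 (max 0 s * real i / real (Suc k))) \<omega>)))
     \<longlonglongrightarrow> (case z of (s, \<omega>) \<Rightarrow> integral {0..max 0 s} (\<lambda>r. w (R (max 0 r) \<omega>)))"
    using discounted_path_limit[OF w, of "max 0 (fst z)" "snd z"] by (auto simp: space_pair_measure case_prod_unfold)
qed

text \<open>The discount factor depends on the whole path up to s, while
  \<open>markov_occupation\<close> admits finitely many positions. Riemann sums bridge the gap: the
  discounted weights are bounded by \<open>C\<close>, and the hypothesis \<open>bound\<close> makes
  the quantities they multiply integrable, so dominated convergence applies on both sides.\<close>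

lemma markov_discounted:
  fixes w :: "real \<Rightarrow> real"
  assumes w: "continuous_on UNIV w" "\<And>r. 0 \<le> w r" "\<And>r. w r \<le> C"
    and s: "s \<ge> 0" and f [measurable]: "f \<in> borel_measurable borel"
    and bound: "\<And>y. y > 0 \<Longrightarrow> bessel_green f y \<le> 1"
  shows "(\<integral>\<^sup>+\<omega>. ennreal (w (R s \<omega>) * exp (- integral {0..s} (\<lambda>r. w (R (max 0 r) \<omega>)))) *
        (\<integral>\<^sup>+t\<in>{s<..}. f (R (max 0 t) \<omega>) \<partial>lborel) \<partial>M)
    = (\<integral>\<^sup>+\<omega>. ennreal (w (R s \<omega>) * exp (- integral {0..s} (\<lambda>r. w (R (max 0 r) \<omega>)))) * bessel_green f (R s \<omega>) \<partial>M)"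
proof -
  have wm [measurable]: "w \<in> borel_measurable borel" using w(1) by (rule borel_measurable_continuous_onI)
  have C: "C \<ge> 0" using w(2,3) order_trans by blast
  \<comment> \<open>Index \<open>Suc k\<close> is the time s itself: it carries the weight
    \<open>w (R s \<omega>)\<close> and is the time at which the Markov property is applied. The
    left-endpoint Riemann sum uses the indices below it.\<close>
  define \<tau> where "\<tau> k i = s * real i / real (Suc k)" for k i
  have \<tau>: "mono (\<tau> k)" "0 \<le> \<tau> k i" "\<tau> k (Suc k) = s" for k i
    using s unfolding \<tau>_def by (auto intro!: monoI divide_right_mono mult_left_mono simp del: of_nat_Suc)
  define \<phi> where "\<phi> k h = ennreal (w (h (Suc k)) * exp (- (s / real (Suc k) * (\<Sum>i<Suc k. w (h i)))))"
    for k and h :: "nat \<Rightarrow> real"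
  have \<phi>m: "\<phi> k \<in> borel_measurable (PiM {..Suc k} (\<lambda>_. borel))" for k
  proof -
    have c: "(\<lambda>h. h i) \<in> borel_measurable (PiM {..Suc k} (\<lambda>_. borel :: real measure))" if "i \<le> Suc k" for i
      using that by (intro measurable_component_singleton) auto
    have "(\<lambda>h. \<Sum>i<Suc k. w (h i)) \<in> borel_measurable (PiM {..Suc k} (\<lambda>_. borel))"
      by (intro borel_measurable_sum measurable_compose[OF c wm]) auto
    moreover have "(\<lambda>h. w (h (Suc k))) \<in> borel_measurable (PiM {..Suc k} (\<lambda>_. borel))"
      by (intro measurable_compose[OF c wm]) auto
    ultimately show ?thesis unfolding \<phi>_def[abs_def] by measurable
  qed
  define \<Phi> where "\<Phi> k \<omega> = \<phi> k (\<lambda>i\<in>{..Suc k}. R (\<tau> k i) \<omega>)" for k \<omega>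
  define \<Psi> where "\<Psi> \<omega> = ennreal (w (R s \<omega>) * exp (- integral {0..s} (\<lambda>r. w (R (max 0 r) \<omega>))))" for \<omega>
  have \<Phi>_eq: "\<Phi> k \<omega> = ennreal (w (R s \<omega>) *
      exp (- (s / real (Suc k) * (\<Sum>i<Suc k. w (R (max 0 (s * real i / real (Suc k))) \<omega>)))))" for k \<omega>
  proof -
    have "(\<Sum>i<Suc k. w ((\<lambda>i\<in>{..Suc k}. R (\<tau> k i) \<omega>) i)) = (\<Sum>i<Suc k. w (R (max 0 (s * real i / real (Suc k))) \<omega>))"
    proof (intro sum.cong refl)
      fix i assume "i \<in> {..<Suc k}"
      then show "w ((\<lambda>i\<in>{..Suc k}. R (\<tau> k i) \<omega>) i) = w (R (max 0 (s * real i / real (Suc k))) \<omega>)"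
        using \<tau>(2)[of k i] by (simp add: \<tau>_def max_absorb2 del: of_nat_Suc)
    qed
    then show ?thesis unfolding \<Phi>_def \<phi>_def using \<tau>(3)[of k] by (simp del: sum.lessThan_Suc of_nat_Suc)
  qed
  have [measurable]: "\<Phi> k \<in> borel_measurable M" for k
    using s unfolding \<Phi>_eq[abs_def] by measurable
  have lim: "(\<lambda>k. \<Phi> k \<omega>) \<longlonglongrightarrow> \<Psi> \<omega>" if "\<omega> \<in> space M" for \<omega>
    unfolding \<Phi>_eq \<Psi>_def by (intro tendsto_ennrealI tendsto_intros discounted_path_limit w(1) s that)
  have [measurable]: "\<Psi> \<in> borel_measurable M"
    by (rule borel_measurable_LIMSEQ_order[OF lim]) auto
  have \<Phi>_le: "\<Phi> k \<omega> \<le> ennreal C" for k \<omega>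
  proof -
    have "exp (- (s / real (Suc k) * (\<Sum>i<Suc k. w (R (max 0 (s * real i / real (Suc k))) \<omega>)))) \<le> 1"
      using s w(2) by (simp add: sum_nonneg del: sum.lessThan_Suc)
    then have "w (R s \<omega>) * exp (- (s / real (Suc k) * (\<Sum>i<Suc k. w (R (max 0 (s * real i / real (Suc k))) \<omega>)))) \<le> C * 1"
      using w(2,3) C by (intro mult_mono) auto
    then show ?thesis unfolding \<Phi>_eq by (intro ennreal_leI) simp
  qed
  define Z where "Z \<omega> = (\<integral>\<^sup>+t\<in>{s<..}. f (R (max 0 t) \<omega>) \<partial>lborel)" for \<omega>
  have [measurable]: "Z \<in> borel_measurable M" "R s \<in> borel_measurable M"
    unfolding Z_def[abs_def] using s by measurable
  have conv: "(\<lambda>k. \<integral>\<^sup>+\<omega>. \<Phi> k \<omega> * Y \<omega> \<partial>M) \<longlonglongrightarrow> (\<integral>\<^sup>+\<omega>. \<Psi> \<omega> * Y \<omega> \<partial>M)"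
    if [measurable]: "Y \<in> borel_measurable M" and fin: "(\<integral>\<^sup>+\<omega>. Y \<omega> \<partial>M) < \<infinity>" for Y
  proof (rule nn_integral_dominated_convergence[where w = "\<lambda>\<omega>. ennreal C * Y \<omega>"])
    show "(\<integral>\<^sup>+\<omega>. ennreal C * Y \<omega> \<partial>M) < \<infinity>"
      using fin by (simp add: nn_integral_cmult ennreal_mult_less_top)
    show "AE \<omega> in M. \<Phi> k \<omega> * Y \<omega> \<le> ennreal C * Y \<omega>" for k
      using \<Phi>_le by (intro AE_I2 mult_right_mono) auto
    \<comment> \<open>Multiplication by \<infinity> is not continuous at 0 in
      \<open>ennreal\<close>, so the products converge only where \<open>Y\<close> is
      finite.\<close>
    have "AE \<omega> in M. Y \<omega> \<noteq> \<infinity>" using fin by (intro nn_integral_PInf_AE) auto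
    moreover have "AE \<omega> in M. \<omega> \<in> space M" by simp
    ultimately show "AE \<omega> in M. (\<lambda>k. \<Phi> k \<omega> * Y \<omega>) \<longlonglongrightarrow> \<Psi> \<omega> * Y \<omega>"
    proof eventually_elim
      case (elim \<omega>)
      then show ?case using ennreal_tendsto_cmult[OF _ lim[of \<omega>], of "Y \<omega>"]
        by (simp add: mult.commute less_top)
    qed
  qed auto
  have "(\<integral>\<^sup>+\<omega>. bessel_green f (R s \<omega>) \<partial>M) \<le> (\<integral>\<^sup>+\<omega>. 1 \<partial>M)"
    by (rule nn_integral_mono_AE, use AE_pos[OF s] in eventually_elim) (rule bound)
  also have "\<dots> < \<infinity>" by (simp add: emeasure_space_1)
  finally have fin: "(\<integral>\<^sup>+\<omega>. bessel_green f (R s \<omega>) \<partial>M) < \<infinity>" .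
  have finZ: "(\<integral>\<^sup>+\<omega>. Z \<omega> \<partial>M) < \<infinity>"
    using fin occupation_integral[OF s f] by (simp add: Z_def)
  have eq: "(\<integral>\<^sup>+\<omega>. \<Phi> k \<omega> * Z \<omega> \<partial>M) = (\<integral>\<^sup>+\<omega>. \<Phi> k \<omega> * bessel_green f (R s \<omega>) \<partial>M)" for k
    using markov_occupation[OF \<tau>(1,2) \<phi>m f, of k k] unfolding \<tau>(3) \<Phi>_def Z_def .
  have "(\<integral>\<^sup>+\<omega>. \<Psi> \<omega> * Z \<omega> \<partial>M) = (\<integral>\<^sup>+\<omega>. \<Psi> \<omega> * bessel_green f (R s \<omega>) \<partial>M)"
  proof (rule LIMSEQ_unique)
    show "(\<lambda>k. \<integral>\<^sup>+\<omega>. \<Phi> k \<omega> * Z \<omega> \<partial>M) \<longlonglongrightarrow> (\<integral>\<^sup>+\<omega>. \<Psi> \<omega> * Z \<omega> \<partial>M)"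
      by (rule conv[OF _ finZ]) simp
    show "(\<lambda>k. \<integral>\<^sup>+\<omega>. \<Phi> k \<omega> * Z \<omega> \<partial>M) \<longlonglongrightarrow> (\<integral>\<^sup>+\<omega>. \<Psi> \<omega> * bessel_green f (R s \<omega>) \<partial>M)"
      unfolding eq by (rule conv[OF _ fin]) simp
  qed
  then show ?thesis unfolding \<Psi>_def Z_def .
qed

lemma R_max_pos: "AE \<omega> in M. 0 < s \<longrightarrow> 0 < R (max 0 s) \<omega>"
  by (rule eventually_mono[OF AE_pos[of "max 0 s"]]) auto

text \<open>Exchanging the quantifiers: positivity at each fixed time yields, for almost every path,
  positivity at almost every time. This is weaker than never hitting 0 but enough for time
  integrals.\<close>

lemma AE_path_pos: "AE \<omega> in M. AE s in lborel. 0 < s \<longrightarrow> 0 < R (max 0 s) \<omega>"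
proof -
  interpret P: pair_sigma_finite "lborel :: real measure" M ..
  have "AE s in lborel. AE \<omega> in M. 0 < s \<longrightarrow> 0 < R (max 0 s) \<omega>"
    by (intro AE_I2 R_max_pos)
  then show ?thesis by (subst (asm) P.AE_commute) measurable
qed

text \<open>Monotonicity of V makes the cutoff at 1/(m+1) bounded by V(1/(m+1)) and nowhere larger
  than V on (0, \<infinity>). Finiteness of the Green potential of V serves twice: it makes the
  exponent finite almost surely, and it is the majorant that removes the error of the
  cutoff.\<close>

theorem feynman_kac_total:
  fixes V u :: "real \<Rightarrow> real"
  assumes V [measurable]: "V \<in> borel_measurable borel" and u [measurable]: "u \<in> borel_measurable borel"
    and Vcont: "\<And>r. r > 0 \<Longrightarrow> isCont V r" and Vnn: "\<And>r. r > 0 \<Longrightarrow> 0 \<le> V r"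
    and Vanti: "\<And>r r'. 0 < r \<Longrightarrow> r \<le> r' \<Longrightarrow> V r' \<le> V r"
    and u01: "\<And>r. r > 0 \<Longrightarrow> 0 \<le> u r" "\<And>r. r > 0 \<Longrightarrow> u r \<le> 1"
    and green: "\<And>y. y > 0 \<Longrightarrow> bessel_green (\<lambda>r. ennreal (V r * u r)) y = ennreal (1 - u y)"
    and fin: "bessel_green (\<lambda>r. ennreal (V r)) x < \<infinity>"
  shows "(\<integral>\<omega>. exp_neg (\<integral>\<^sup>+s\<in>{0<..}. ennreal (V (R (max 0 s) \<omega>)) \<partial>lborel) \<partial>M) = u x"
proof -
  interpret P: pair_sigma_finite "lborel :: real measure" M ..
  define Q where "Q = (lborel :: real measure) \<Otimes>\<^sub>M M"
  have sQ [measurable_cong]: "sets Q = sets (borel \<Otimes>\<^sub>M M)"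
    unfolding Q_def by (intro sets_pair_measure_cong) auto
  define X where "X z = R (max 0 (fst z)) (snd z)" for z :: "real \<times> 'w"
  have Xm [measurable]: "X \<in> borel_measurable Q"
    unfolding X_def[abs_def] Q_def by measurable
  define I where "I z = (indicator {0<..} (fst z) :: ennreal)" for z :: "real \<times> 'w"
  have Im [measurable]: "I \<in> borel_measurable Q" unfolding I_def[abs_def] Q_def by measurable
  \<comment> \<open>The expected integral over positive times. It can be evaluated with the
    expectation inside (\<open>J_time\<close>) or path by path (\<open>J_path\<close>), and the
    argument moves between the two.\<close>
  define J where "J F = (\<integral>\<^sup>+z. F z * I z \<partial>Q)" for F :: "real \<times> 'w \<Rightarrow> ennreal"
  have J_add: "J (\<lambda>z. F z + G z) = J F + J G"
    if [measurable]: "F \<in> borel_measurable Q" "G \<in> borel_measurable Q" for F G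
    unfolding J_def by (simp add: distrib_right nn_integral_add)
  have J_time: "J F = (\<integral>\<^sup>+s\<in>{0<..}. (\<integral>\<^sup>+\<omega>. F (s, \<omega>) \<partial>M) \<partial>lborel)"
    if [measurable]: "F \<in> borel_measurable Q" for F
  proof -
    have [measurable]: "F \<in> borel_measurable (lborel \<Otimes>\<^sub>M M)" using that by (simp add: Q_def)
    have "J F = (\<integral>\<^sup>+s. (\<integral>\<^sup>+\<omega>. F (s, \<omega>) * I (s, \<omega>) \<partial>M) \<partial>lborel)"
      unfolding J_def Q_def by (rule nn_integral_fst[symmetric]) (simp add: I_def)
    also have "\<dots> = (\<integral>\<^sup>+s\<in>{0<..}. (\<integral>\<^sup>+\<omega>. F (s, \<omega>) \<partial>M) \<partial>lborel)"
      by (intro nn_integral_cong) (simp add: I_def nn_integral_multc)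
    finally show ?thesis .
  qed
  have J_path: "J F = (\<integral>\<^sup>+\<omega>. (\<integral>\<^sup>+s\<in>{0<..}. F (s, \<omega>) \<partial>lborel) \<partial>M)"
    if [measurable]: "F \<in> borel_measurable Q" for F
  proof -
    have [measurable]: "F \<in> borel_measurable (lborel \<Otimes>\<^sub>M M)" using that by (simp add: Q_def)
    show ?thesis
      unfolding J_def Q_def by (subst P.nn_integral_snd[symmetric]) (auto simp: I_def)
  qed
  have Xpos: "AE z in Q. 0 < fst z \<longrightarrow> 0 < X z"
    unfolding Q_def
  proof (rule P.AE_pair_measure)
    show "{z \<in> space (lborel \<Otimes>\<^sub>M M). 0 < fst z \<longrightarrow> 0 < X z} \<in> sets (lborel \<Otimes>\<^sub>M M)"
      using Xm unfolding Q_def by measurable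
    show "AE s in lborel. AE \<omega> in M. 0 < fst (s, \<omega>) \<longrightarrow> 0 < X (s, \<omega>)"
    proof (rule AE_I2)
      fix s :: real
      show "AE \<omega> in M. 0 < fst (s, \<omega>) \<longrightarrow> 0 < X (s, \<omega>)"
        unfolding X_def fst_conv snd_conv by (rule R_max_pos)
    qed
  qed
  have J_cong: "J F = J G" if "\<And>z. 0 < fst z \<Longrightarrow> 0 < X z \<Longrightarrow> F z = G z" for F G
    unfolding J_def
    by (rule nn_integral_cong_AE, use Xpos in eventually_elim) (use that in \<open>auto simp: I_def indicator_def\<close>)
  define f where "f r = ennreal (V r * u r)" for r
  have fm [measurable]: "f \<in> borel_measurable borel" unfolding f_def[abs_def] by measurable
  have fgreen: "bessel_green f y = ennreal (1 - u y)" if "y > 0" for y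
    using green[OF that] by (simp add: f_def[abs_def])
  have J_green: "J (\<lambda>z. g (X z)) = bessel_green g x" if [measurable]: "g \<in> borel_measurable borel" for g
  proof -
    have "J (\<lambda>z. g (X z)) = (\<integral>\<^sup>+\<omega>. bessel_green g (R 0 \<omega>) \<partial>M)"
      using occupation_integral[of 0 g] by (subst J_path) (simp_all add: X_def)
    also have "\<dots> = (\<integral>\<^sup>+\<omega>. bessel_green g x \<partial>M)"
      by (rule nn_integral_cong_AE, use AE_start in eventually_elim) simp
    finally show ?thesis by (simp add: emeasure_space_1)
  qed
  define a where "a \<omega> = (\<integral>\<^sup>+s\<in>{0<..}. ennreal (V (R (max 0 s) \<omega>)) \<partial>lborel)" for \<omega>
  have am [measurable]: "a \<in> borel_measurable M" unfolding a_def[abs_def] by measurable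
  have a_fin: "AE \<omega> in M. a \<omega> \<noteq> \<infinity>"
  proof (rule nn_integral_PInf_AE)
    have "(\<integral>\<^sup>+\<omega>. a \<omega> \<partial>M) = bessel_green (\<lambda>r. ennreal (V r)) x"
      using J_green[of "\<lambda>r. ennreal (V r)"] J_path[of "\<lambda>z. ennreal (V (X z))"] by (simp add: a_def X_def)
    then show "(\<integral>\<^sup>+\<omega>. a \<omega> \<partial>M) \<noteq> \<infinity>" using fin by simp
  qed simp
  define W where "W m r = V (max r (1 / real (Suc m)))" for m r
  have Wm [measurable]: "W m \<in> borel_measurable borel" for m unfolding W_def[abs_def] by measurable
  have Wcont: "continuous_on UNIV (W m)" for m
  proof -
    have "continuous_on {0<..} V" using Vcont by (intro continuous_at_imp_continuous_on) auto
    then show ?thesis unfolding W_def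
      by (rule continuous_on_compose2) (auto intro!: continuous_intros simp: less_max_iff_disj)
  qed
  have Wnn: "0 \<le> W m r" for m r unfolding W_def by (rule Vnn) (simp add: less_max_iff_disj)
  have Wb: "W m r \<le> V (1 / real (Suc m))" for m r unfolding W_def by (rule Vanti) auto
  have WV: "W m r \<le> V r" if "0 < r" for m r unfolding W_def by (rule Vanti) (use that in auto)
  have Wlim: "(\<lambda>m. W m r) \<longlonglongrightarrow> V r" if "0 < r" for r
  proof (rule tendsto_eventually)
    have "\<forall>\<^sub>F m in sequentially. 1 / real (Suc m) < r" using that by real_asymp
    then show "\<forall>\<^sub>F m in sequentially. W m r = V r"
      by eventually_elim (simp add: W_def max_def)
  qed
  define b where "b m \<omega> = (\<integral>\<^sup>+s\<in>{0<..}. ennreal (W m (R (max 0 s) \<omega>)) \<partial>lborel)" for m \<omega>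
  have bm [measurable]: "b m \<in> borel_measurable M" for m unfolding b_def[abs_def] by measurable
  define E where "E m z = exp (- integral {0..max 0 (fst z)} (\<lambda>r. W m (R (max 0 r) (snd z))))" for m z
  have Em [measurable]: "E m \<in> borel_measurable Q" for m
  proof -
    have "(\<lambda>z. integral {0..max 0 (fst z)} (\<lambda>r. W m (R (max 0 r) (snd z)))) \<in> borel_measurable Q"
      using path_integral_measurable[OF Wcont[of m]] by (simp add: case_prod_unfold measurable_cong_sets[OF sQ refl])
    then show ?thesis unfolding E_def[abs_def] by measurable
  qed
  have E0: "0 \<le> E m z" "E m z \<le> 1" for m z
  proof -
    show "0 \<le> E m z" by (simp add: E_def)
    \<comment> \<open>The bound is claimed for every z, also off \<open>space M\<close>, where
      integrability of the path is unknown; the integral is then 0 by default.\<close>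
    have "0 \<le> integral {0..max 0 (fst z)} (\<lambda>r. W m (R (max 0 r) (snd z)))"
      using Wnn by (cases "(\<lambda>r. W m (R (max 0 r) (snd z))) integrable_on {0..max 0 (fst z)}")
        (auto simp: not_integrable_integral intro!: Henstock_Kurzweil_Integration.integral_nonneg)
    then show "E m z \<le> 1" by (simp add: E_def)
  qed
  \<comment> \<open>The defect caused by discounting with \<open>W m\<close> although u solves the
    equation for V.\<close>
  define \<epsilon> where "\<epsilon> m = J (\<lambda>z. ennreal ((V (X z) - W m (X z)) * u (X z) * E m z))" for m
  text \<open>All terms are moved to the side where they are added, so that the identity can be proved in
    \<open>ennreal\<close> without subtraction.\<close>
  have main: "(\<integral>\<^sup>+\<omega>. ennreal (1 - exp_neg (b m \<omega>)) \<partial>M) + \<epsilon> m = ennreal (1 - u x)" for m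
  proof -
    have "(\<lambda>z. \<integral>\<^sup>+t\<in>{fst z<..}. f (R (max 0 t) (snd z)) \<partial>lborel) \<in> borel_measurable (borel \<Otimes>\<^sub>M M)"
      by measurable (simp only: greaterThan_iff, measurable)
    then have [measurable]: "(\<lambda>z. \<integral>\<^sup>+t\<in>{fst z<..}. f (R (max 0 t) (snd z)) \<partial>lborel) \<in> borel_measurable Q"
      by (simp add: measurable_cong_sets[OF sQ refl])
    \<comment> \<open>The Markov property acts at a fixed time s, so the expectation is taken inside
      first. The exchange of s and t is made on a fixed path, where the integral over s < t is
      explicit.\<close>
    have *: "J (\<lambda>z. ennreal (W m (X z) * E m z) * bessel_green f (X z))
      = J (\<lambda>z. f (X z) * ennreal (1 - E m z))"
    proof -
      have "J (\<lambda>z. ennreal (W m (X z) * E m z) * bessel_green f (X z))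
         = (\<integral>\<^sup>+s\<in>{0<..}. (\<integral>\<^sup>+\<omega>. ennreal (W m (X (s, \<omega>)) * E m (s, \<omega>)) * bessel_green f (X (s, \<omega>)) \<partial>M) \<partial>lborel)"
        by (rule J_time) measurable
      also have "\<dots> = (\<integral>\<^sup>+s\<in>{0<..}. (\<integral>\<^sup>+\<omega>. ennreal (W m (X (s, \<omega>)) * E m (s, \<omega>)) *
          (\<integral>\<^sup>+t\<in>{s<..}. f (X (t, \<omega>)) \<partial>lborel) \<partial>M) \<partial>lborel)"
      proof (intro nn_integral_cong)
        fix s :: real
        show "(\<integral>\<^sup>+\<omega>. ennreal (W m (X (s, \<omega>)) * E m (s, \<omega>)) * bessel_green f (X (s, \<omega>)) \<partial>M) * indicator {0<..} s
          = (\<integral>\<^sup>+\<omega>. ennreal (W m (X (s, \<omega>)) * E m (s, \<omega>)) *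
          (\<integral>\<^sup>+t\<in>{s<..}. f (X (t, \<omega>)) \<partial>lborel) \<partial>M) * indicator {0<..} s"
        proof (cases "0 < s")
          case True
          have "bessel_green f y \<le> 1" if "y > 0" for y
            using u01[OF that] by (simp add: fgreen[OF that] ennreal_le_1)
          from markov_discounted[OF Wcont Wnn Wb _ fm this, of s] True
          show ?thesis by (simp add: X_def E_def)
        qed simp
      qed
      also have "\<dots> = J (\<lambda>z. ennreal (W m (X z) * E m z) * (\<integral>\<^sup>+t\<in>{fst z<..}. f (R (max 0 t) (snd z)) \<partial>lborel))"
        by (subst J_time) (measurable, simp add: X_def)
      also have "\<dots> = (\<integral>\<^sup>+\<omega>. (\<integral>\<^sup>+s\<in>{0<..}. ennreal (W m (X (s, \<omega>)) * E m (s, \<omega>)) * (\<integral>\<^sup>+t\<in>{s<..}. f (X (t, \<omega>)) \<partial>lborel) \<partial>lborel) \<partial>M)"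
        by (subst J_path) (measurable, simp add: X_def)
      also have "\<dots> = (\<integral>\<^sup>+\<omega>. (\<integral>\<^sup>+t\<in>{0<..}. f (X (t, \<omega>)) * ennreal (1 - E m (t, \<omega>)) \<partial>lborel) \<partial>M)"
      proof (rule nn_integral_cong)
        fix \<omega> assume \<omega>: "\<omega> \<in> space M"
        define g where "g r = W m (R (max 0 r) \<omega>)" for r
        have g: "continuous_on UNIV g" "\<And>r. 0 \<le> g r"
          unfolding g_def using continuous_on_compose2[OF Wcont continuous_path[OF \<omega>]] Wnn by auto
        have XE: "W m (X (s, \<omega>)) * E m (s, \<omega>) = g s * exp (- integral {0..s} g)" if "0 < s" for s
          using that by (simp add: X_def E_def g_def[abs_def])
        define h where "h t = f (X (t, \<omega>))" for t
        define k where "k s = ennreal (W m (X (s, \<omega>)) * E m (s, \<omega>))" for s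
        have [measurable]: "h \<in> borel_measurable borel"
          unfolding h_def[abs_def] X_def using \<omega> by measurable
        have [measurable]: "k \<in> borel_measurable borel"
        proof -
          have "(\<lambda>z. ennreal (W m (X z) * E m z)) \<in> borel_measurable (borel \<Otimes>\<^sub>M M)"
            by (subst measurable_cong_sets[OF sQ[symmetric] refl]) measurable
          from measurable_compose[OF measurable_Pair2'[OF \<omega>] this] show ?thesis
            by (simp add: k_def[abs_def])
        qed
        have "(\<integral>\<^sup>+s\<in>{0<..}. k s * (\<integral>\<^sup>+t\<in>{s<..}. h t \<partial>lborel) \<partial>lborel)
          = (\<integral>\<^sup>+s. (\<integral>\<^sup>+t. k s * h t * indicator {0<..} s * indicator {z. fst z < snd z} (s, t) \<partial>lborel) \<partial>lborel)"
          by (intro nn_integral_cong, subst nn_integral_cmult[symmetric], simp, subst nn_integral_multc[symmetric], simp)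
            (auto intro!: nn_integral_cong simp: indicator_def)
        also have "\<dots> = (\<integral>\<^sup>+t. (\<integral>\<^sup>+s. k s * h t * indicator {0<..} s * indicator {z. fst z < snd z} (s, t) \<partial>lborel) \<partial>lborel)"
          by (rule lborel_pair.Fubini') simp
        also have "\<dots> = (\<integral>\<^sup>+t\<in>{0<..}. h t * ennreal (1 - E m (t, \<omega>)) \<partial>lborel)"
        proof (intro nn_integral_cong)
          fix t :: real
          have "(\<integral>\<^sup>+s. k s * h t * indicator {0<..} s * indicator {z. fst z < snd z} (s, t) \<partial>lborel)
            = (\<integral>\<^sup>+s. h t * (ennreal (g s * exp (- integral {0..s} g)) * indicator {0<..<t} s) \<partial>lborel)"
            using XE by (intro nn_integral_cong) (auto simp: indicator_def k_def mult_ac)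
          also have "\<dots> = h t * (\<integral>\<^sup>+s\<in>{0<..<t}. ennreal (g s * exp (- integral {0..s} g)) \<partial>lborel)"
          proof (rule nn_integral_cmult)
            have "(\<lambda>s. k s * indicator {0<..<t} s) \<in> borel_measurable lborel" by simp
            also have "(\<lambda>s. k s * indicator {0<..<t} s) = (\<lambda>s. ennreal (g s * exp (- integral {0..s} g)) * indicator {0<..<t} s)"
              using XE by (auto simp: fun_eq_iff indicator_def k_def)
            finally show "(\<lambda>s. ennreal (g s * exp (- integral {0..s} g)) * indicator {0<..<t} s) \<in> borel_measurable lborel" .
          qed
          also have "\<dots> = h t * ennreal (1 - E m (t, \<omega>)) * indicator {0<..} t"
            using nn_integral_exp_neg_primitive(1)[OF g, of t]
            by (cases "0 < t") (simp_all add: E_def g_def[abs_def])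
          finally show "(\<integral>\<^sup>+s. k s * h t * indicator {0<..} s * indicator {z. fst z < snd z} (s, t) \<partial>lborel)
            = h t * ennreal (1 - E m (t, \<omega>)) * indicator {0<..} t" .
        qed
        finally show "(\<integral>\<^sup>+s\<in>{0<..}. ennreal (W m (X (s, \<omega>)) * E m (s, \<omega>)) * (\<integral>\<^sup>+t\<in>{s<..}. f (X (t, \<omega>)) \<partial>lborel) \<partial>lborel)
          = (\<integral>\<^sup>+t\<in>{0<..}. f (X (t, \<omega>)) * ennreal (1 - E m (t, \<omega>)) \<partial>lborel)"
          by (simp add: k_def h_def)
      qed
      also have "\<dots> = J (\<lambda>z. f (X z) * ennreal (1 - E m z))"
        by (rule J_path[symmetric]) measurable
      finally show ?thesis .
    qed
    have P: "(\<integral>\<^sup>+\<omega>. ennreal (1 - exp_neg (b m \<omega>)) \<partial>M) = J (\<lambda>z. ennreal (W m (X z) * E m z))"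
    proof -
      have "J (\<lambda>z. ennreal (W m (X z) * E m z)) = (\<integral>\<^sup>+\<omega>. (\<integral>\<^sup>+s\<in>{0<..}. ennreal (W m (X (s, \<omega>)) * E m (s, \<omega>)) \<partial>lborel) \<partial>M)"
        by (rule J_path) measurable
      also have "\<dots> = (\<integral>\<^sup>+\<omega>. ennreal (1 - exp_neg (b m \<omega>)) \<partial>M)"
      proof (rule nn_integral_cong_AE)
        have "AE \<omega> in M. \<omega> \<in> space M" by simp
        with a_fin AE_path_pos
        show "AE \<omega> in M. (\<integral>\<^sup>+s\<in>{0<..}. ennreal (W m (X (s, \<omega>)) * E m (s, \<omega>)) \<partial>lborel) = ennreal (1 - exp_neg (b m \<omega>))"
        proof eventually_elim
          case (elim \<omega>)
          define g where "g r = W m (R (max 0 r) \<omega>)" for r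
          have g: "continuous_on UNIV g" "\<And>r. 0 \<le> g r"
            unfolding g_def using continuous_on_compose2[OF Wcont continuous_path[OF elim(3)]] Wnn by auto
          have "b m \<omega> \<le> a \<omega>"
            unfolding a_def b_def
            by (rule nn_integral_mono_AE, use elim(2) in eventually_elim)
              (auto simp: indicator_def intro!: ennreal_leI WV)
          then obtain c where c: "b m \<omega> = ennreal c" "0 \<le> c"
            using elim(1) by (cases "b m \<omega>") (auto simp: top_unique)
          have "(\<integral>\<^sup>+s\<in>{0<..}. ennreal (g s) \<partial>lborel) = ennreal c"
            using c(1) by (simp add: b_def g_def)
          from nn_integral_exp_neg_primitive(2)[OF g this c(2)]
          have "(\<integral>\<^sup>+s\<in>{0<..}. ennreal (g s * exp (- integral {0..s} g)) \<partial>lborel) = ennreal (1 - exp_neg (b m \<omega>))"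
            using c by (simp add: exp_neg_def)
          also have "(\<integral>\<^sup>+s\<in>{0<..}. ennreal (g s * exp (- integral {0..s} g)) \<partial>lborel)
             = (\<integral>\<^sup>+s\<in>{0<..}. ennreal (W m (X (s, \<omega>)) * E m (s, \<omega>)) \<partial>lborel)"
            by (intro nn_integral_cong) (auto simp: indicator_def X_def E_def g_def[abs_def])
          finally show ?case .
        qed
      qed
      finally show ?thesis by simp
    qed
    have "(\<integral>\<^sup>+\<omega>. ennreal (1 - exp_neg (b m \<omega>)) \<partial>M) + \<epsilon> m
      = J (\<lambda>z. ennreal (W m (X z) * E m z) + ennreal ((V (X z) - W m (X z)) * u (X z) * E m z))"
      unfolding P \<epsilon>_def by (rule J_add[symmetric]) measurable
    \<comment> \<open>The defect is chosen so that W + (V - W) u = W (1 - u) + V u. Here 1 - u is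
      the Green potential of f, and V u is f itself.\<close>
    also have "\<dots> = J (\<lambda>z. ennreal (W m (X z) * E m z) * bessel_green f (X z) + ennreal (V (X z) * u (X z) * E m z))"
    proof (rule J_cong)
      fix z :: "real \<times> 'w" assume z: "0 < fst z" "0 < X z"
      note nn = Vnn[OF z(2)] Wnn[of m "X z"] WV[OF z(2), of m] u01[OF z(2)] E0[of m z]
      have "ennreal (W m (X z) * E m z) + ennreal ((V (X z) - W m (X z)) * u (X z) * E m z)
        = ennreal (W m (X z) * E m z + (V (X z) - W m (X z)) * u (X z) * E m z)"
        using nn by (intro ennreal_plus[symmetric]) auto
      also have "W m (X z) * E m z + (V (X z) - W m (X z)) * u (X z) * E m z
        = W m (X z) * E m z * (1 - u (X z)) + V (X z) * u (X z) * E m z" by (simp add: algebra_simps)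
      also have "ennreal \<dots> = ennreal (W m (X z) * E m z * (1 - u (X z))) + ennreal (V (X z) * u (X z) * E m z)"
        using nn by (intro ennreal_plus) auto
      also have "ennreal (W m (X z) * E m z * (1 - u (X z))) = ennreal (W m (X z) * E m z) * bessel_green f (X z)"
        unfolding fgreen[OF z(2)] using nn by (intro ennreal_mult) auto
      finally show "ennreal (W m (X z) * E m z) + ennreal ((V (X z) - W m (X z)) * u (X z) * E m z)
        = ennreal (W m (X z) * E m z) * bessel_green f (X z) + ennreal (V (X z) * u (X z) * E m z)" .
    qed
    also have "\<dots> = J (\<lambda>z. f (X z) * ennreal (1 - E m z)) + J (\<lambda>z. ennreal (V (X z) * u (X z) * E m z))"
      unfolding *[symmetric] by (rule J_add) measurable
    also have "\<dots> = J (\<lambda>z. f (X z) * ennreal (1 - E m z) + ennreal (V (X z) * u (X z) * E m z))"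
      by (rule J_add[symmetric]) measurable
    also have "\<dots> = J (\<lambda>z. f (X z))"
    proof (rule J_cong)
      fix z :: "real \<times> 'w" assume z: "0 < fst z" "0 < X z"
      note nn = Vnn[OF z(2)] u01[OF z(2)] E0[of m z]
      have "f (X z) * ennreal (1 - E m z) + ennreal (V (X z) * u (X z) * E m z)
        = ennreal (V (X z) * u (X z) * (1 - E m z)) + ennreal (V (X z) * u (X z) * E m z)"
        unfolding f_def using nn by (subst ennreal_mult) auto
      also have "\<dots> = ennreal (V (X z) * u (X z) * (1 - E m z) + V (X z) * u (X z) * E m z)"
        using nn by (intro ennreal_plus[symmetric]) auto
      also have "V (X z) * u (X z) * (1 - E m z) + V (X z) * u (X z) * E m z = V (X z) * u (X z)"
        by (simp add: algebra_simps)
      finally show "f (X z) * ennreal (1 - E m z) + ennreal (V (X z) * u (X z) * E m z) = f (X z)"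
        by (simp add: f_def)
    qed
    also have "\<dots> = ennreal (1 - u x)"
      using J_green[OF fm] fgreen[OF x_pos] by simp
    finally show ?thesis .
  qed
  \<comment> \<open>At a positive position the integrand is eventually 0, since \<open>W m\<close>
    agrees with V above 1/(m+1). The majorant is V, whose expected time integral is finite.\<close>
  have \<epsilon>_lim: "\<epsilon> \<longlonglongrightarrow> 0"
  proof -
    have "(\<lambda>m. \<integral>\<^sup>+z. ennreal ((V (X z) - W m (X z)) * u (X z) * E m z) * I z \<partial>Q) \<longlonglongrightarrow> (\<integral>\<^sup>+z. 0 \<partial>Q)"
    proof (rule nn_integral_dominated_convergence[where w = "\<lambda>z. ennreal (V (X z)) * I z"])
      show "(\<integral>\<^sup>+z. ennreal (V (X z)) * I z \<partial>Q) < \<infinity>"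
        using fin J_green[of "\<lambda>r. ennreal (V r)"] by (simp add: J_def)
      show "AE z in Q. ennreal ((V (X z) - W m (X z)) * u (X z) * E m z) * I z \<le> ennreal (V (X z)) * I z" for m
        using Xpos
      proof eventually_elim
        case (elim z)
        show ?case
        proof (cases "0 < fst z")
          case True
          then have z: "0 < X z" using elim by simp
          note nn = Vnn[OF z] Wnn[of m "X z"] WV[OF z, of m] u01[OF z] E0[of m z]
          have "(V (X z) - W m (X z)) * u (X z) * E m z \<le> V (X z) * 1 * 1"
            using nn by (intro mult_mono) auto
          then show ?thesis by (intro mult_right_mono ennreal_leI) auto
        qed (simp add: I_def)
      qed
      show "AE z in Q. (\<lambda>m. ennreal ((V (X z) - W m (X z)) * u (X z) * E m z) * I z) \<longlonglongrightarrow> 0"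
        using Xpos
      proof eventually_elim
        case (elim z)
        show ?case
        proof (cases "0 < fst z")
          case True
          then have z: "0 < X z" using elim by simp
          have "\<forall>\<^sub>F m in sequentially. 1 / real (Suc m) < X z" using z by real_asymp
          then have "\<forall>\<^sub>F m in sequentially. ennreal ((V (X z) - W m (X z)) * u (X z) * E m z) * I z = 0"
            by eventually_elim (simp add: W_def max_def)
          then show ?thesis by (rule tendsto_eventually)
        qed (simp add: I_def)
      qed
    qed auto
    then show ?thesis by (simp add: \<epsilon>_def[abs_def] J_def)
  qed
  have b_lim: "(\<lambda>m. \<integral>\<^sup>+\<omega>. ennreal (1 - exp_neg (b m \<omega>)) \<partial>M) \<longlonglongrightarrow> (\<integral>\<^sup>+\<omega>. ennreal (1 - exp_neg (a \<omega>)) \<partial>M)"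
  proof (rule nn_integral_dominated_convergence[where w = "\<lambda>_. 1"])
    show "AE \<omega> in M. ennreal (1 - exp_neg (b m \<omega>)) \<le> 1" for m
      using exp_neg_bounds by (auto simp: ennreal_le_1)
    have "AE \<omega> in M. \<omega> \<in> space M" by simp
    with a_fin AE_path_pos show "AE \<omega> in M. (\<lambda>m. ennreal (1 - exp_neg (b m \<omega>))) \<longlonglongrightarrow> ennreal (1 - exp_neg (a \<omega>))"
    proof eventually_elim
      case (elim \<omega>)
      note [measurable] = elim(3)
      have lim: "(\<lambda>m. b m \<omega>) \<longlonglongrightarrow> a \<omega>"
        unfolding b_def a_def
      proof (rule nn_integral_dominated_convergence[where w = "\<lambda>s. ennreal (V (R (max 0 s) \<omega>)) * indicator {0<..} s"])
        show "(\<integral>\<^sup>+s\<in>{0<..}. ennreal (V (R (max 0 s) \<omega>)) \<partial>lborel) < \<infinity>"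
          using elim(1) by (simp add: a_def less_top)
        show "AE s in lborel. ennreal (W m (R (max 0 s) \<omega>)) * indicator {0<..} s \<le> ennreal (V (R (max 0 s) \<omega>)) * indicator {0<..} s" for m
          using elim(2) by eventually_elim (auto simp: indicator_def intro!: ennreal_leI WV)
        show "AE s in lborel. (\<lambda>m. ennreal (W m (R (max 0 s) \<omega>)) * indicator {0<..} s) \<longlonglongrightarrow> ennreal (V (R (max 0 s) \<omega>)) * indicator {0<..} s"
          using elim(2)
        proof eventually_elim
          case (elim s)
          then show ?case by (cases "0 < s") (auto intro!: tendsto_ennrealI Wlim)
        qed
      qed measurable
      have "b m \<omega> \<le> a \<omega>" for m
        unfolding a_def b_def
        by (rule nn_integral_mono_AE, use elim(2) in eventually_elim)
          (auto simp: indicator_def intro!: ennreal_leI WV)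
      then have bf: "b m \<omega> \<noteq> \<infinity>" for m using elim(1) by (metis infinity_ennreal_def top_unique)
      have "(\<lambda>m. enn2real (b m \<omega>)) \<longlonglongrightarrow> enn2real (a \<omega>)"
        using lim elim(1) bf by (intro tendsto_enn2real) (auto simp: less_top)
      then have "(\<lambda>m. ennreal (1 - exp (- enn2real (b m \<omega>)))) \<longlonglongrightarrow> ennreal (1 - exp (- enn2real (a \<omega>)))"
        by (intro tendsto_ennrealI tendsto_diff tendsto_const tendsto_exp tendsto_minus)
      then show ?case using bf elim(1) by (simp add: exp_neg_def)
    qed
  qed (auto simp: emeasure_space_1)
  have "(\<integral>\<^sup>+\<omega>. ennreal (1 - exp_neg (a \<omega>)) \<partial>M) = ennreal (1 - u x)"
  proof (rule LIMSEQ_unique)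
    show "(\<lambda>m. (\<integral>\<^sup>+\<omega>. ennreal (1 - exp_neg (b m \<omega>)) \<partial>M) + \<epsilon> m) \<longlonglongrightarrow> (\<integral>\<^sup>+\<omega>. ennreal (1 - exp_neg (a \<omega>)) \<partial>M)"
      using tendsto_add[OF b_lim \<epsilon>_lim] by simp
    show "(\<lambda>m. (\<integral>\<^sup>+\<omega>. ennreal (1 - exp_neg (b m \<omega>)) \<partial>M) + \<epsilon> m) \<longlonglongrightarrow> ennreal (1 - u x)"
      unfolding main by simp
  qed
  then have "has_bochner_integral M (\<lambda>\<omega>. 1 - exp_neg (a \<omega>)) (1 - u x)"
    using u01[OF x_pos] exp_neg_bounds by (intro has_bochner_integral_nn_integral) auto
  moreover have "integrable M (\<lambda>\<omega>. exp_neg (a \<omega>))"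
    using exp_neg_bounds by (intro integrable_const_bound[where B = 1]) auto
  ultimately have "1 - (\<integral>\<omega>. exp_neg (a \<omega>) \<partial>M) = 1 - u x"
    by (simp add: has_bochner_integral_iff prob_space)
  then show ?thesis by (simp add: a_def)
qed

end

section \<open>The expectation as a hypergeometric function\<close>

text \<open>At position 0 the two integrands can differ: the \<open>ennreal\<close> quotient may be
  \<infinity>, while real division by 0 gives 0. This concerns only a null set of times on almost
  every path, as does the endpoint s = 0.\<close>

lemma I_hat_eq_potential:
  assumes R: "bessel3_process M R x" and x: "x > 0" and \<theta>: "\<theta> > 0" and p: "p \<ge> 0" and q: "q \<ge> 0"
  shows "AE \<omega> in M. I_hat \<theta> R p q \<omega> =
    (\<integral>\<^sup>+s\<in>{0<..}. ennreal (bessel_potential \<theta> p q (R (max 0 s) \<omega>)) \<partial>lborel)"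
proof -
  interpret bessel3 M R x using R x by unfold_locales
  show ?thesis
    using AE_path_pos
  proof eventually_elim
    case (elim \<omega>)
    show ?case
      unfolding I_hat_def
    proof (rule nn_integral_cong_AE, use elim AE_lborel_singleton[of 0] in eventually_elim)
      case (elim s)
      show ?case
      proof (cases "s > 0")
        case True
        define e where "e = exp (\<theta> * R s \<omega>) - 1"
        have e: "e > 0" using elim True \<theta> by (simp add: e_def max_absorb2)
        have "ennreal p / ennreal e + ennreal q / ennreal (e\<^sup>2) = ennreal (p / e + q / e\<^sup>2)"
          using e p q by (simp add: divide_ennreal ennreal_plus)
        then show ?thesis using True by (simp add: e_def bessel_potential_def max_absorb2)
      qed (use elim in simp)
    qed
  qed
qed

theorem theorem6p1:
  fixes M :: "'w measure" and R :: "real \<Rightarrow> 'w \<Rightarrow> real"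
    and x \<theta> p q \<gamma> :: real and \<alpha> \<beta> :: complex
  assumes x_pos: "x > 0"
    and bessel: "bessel3_process M R x"
    and theta_pos: "\<theta> > 0"
    and p_nonneg: "p \<ge> 0"
    and q_nonneg: "q \<ge> 0"
    and alpha: "\<alpha> = complex_of_real (1/2 + 1/2 * sqrt (1 + 8 * q / \<theta>\<^sup>2))
                    + complex_of_real (1 / \<theta>) * csqrt (complex_of_real (2 * (q - p)))"
    and beta: "\<beta> = complex_of_real (1/2 + 1/2 * sqrt (1 + 8 * q / \<theta>\<^sup>2))
                    - complex_of_real (1 / \<theta>) * csqrt (complex_of_real (2 * (q - p)))"
    and gamma: "\<gamma> = 1 + sqrt (1 + 8 * q / \<theta>\<^sup>2)"
  shows "complex_of_real \<gamma> = \<alpha> + \<beta> \<and>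
         complex_of_real (\<integral>\<omega>. exp_neg (I_hat \<theta> R p q \<omega>) \<partial>M) =
           complex_of_real ((1 - exp (- \<theta> * x)) powr (\<gamma> / 2)) * Gamma \<alpha> * Gamma \<beta>
             / complex_of_real (x * \<theta> * Gamma \<gamma>)
           * gauss_F \<alpha> \<beta> \<gamma> (1 - exp (- \<theta> * x)) \<and>
         complex_of_real ((1 - exp (- \<theta> * x)) powr (\<gamma> / 2)) * Gamma \<alpha> * Gamma \<beta>
             / complex_of_real (x * \<theta> * Gamma \<gamma>)
           * gauss_F \<alpha> \<beta> \<gamma> (1 - exp (- \<theta> * x)) =
         complex_of_real ((1 - exp (- \<theta> * x)) powr (\<gamma> / 2) / (x * \<theta>)) *
           (LBINT t:{0..1}. complex_of_real t powr (\<alpha> - 1)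
              * complex_of_real (1 - t) powr (\<beta> - 1)
              * complex_of_real (1 - t * (1 - exp (- \<theta> * x))) powr (\<alpha> - complex_of_real \<gamma>))"
proof -
  interpret bessel3 M R x using bessel x_pos by unfold_locales
  \<comment> \<open>Real or purely imaginary according to the sign of q - p. Its square is real in
    either case, which is all that the sum and the product of \<alpha> and \<beta> require.\<close>
  define w where "w = complex_of_real (1 / \<theta>) * csqrt (complex_of_real (2 * (q - p)))"
  define P where "P = \<gamma> / 2 + 2 * p / \<theta>\<^sup>2"
  have \<alpha>w: "\<alpha> = of_real (\<gamma> / 2) + w" and \<beta>w: "\<beta> = of_real (\<gamma> / 2) - w"
    by (simp_all add: alpha beta gamma w_def add_divide_distrib)
  have sum: "\<alpha> + \<beta> = of_real \<gamma>" by (simp add: \<alpha>w \<beta>w)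
  have rootsq: "(sqrt (1 + 8 * q / \<theta>\<^sup>2))\<^sup>2 = 1 + 8 * q / \<theta>\<^sup>2" using q_nonneg by simp
  have w2: "w\<^sup>2 = of_real (2 * (q - p) / \<theta>\<^sup>2)"
    by (simp add: w_def power_mult_distrib power_divide)
  have prod: "\<alpha> * \<beta> = of_real P"
  proof -
    have "\<alpha> * \<beta> = of_real ((\<gamma> / 2)\<^sup>2) - w\<^sup>2"
      by (simp add: \<alpha>w \<beta>w algebra_simps power2_eq_square)
    also have "\<dots> = of_real ((\<gamma> / 2)\<^sup>2 - 2 * (q - p) / \<theta>\<^sup>2)" by (simp only: w2 of_real_diff)
    \<comment> \<open>By the choice of \<gamma>, \<open>(\<gamma> / 2)\<^sup>2\<close> equals
      \<gamma>/2 plus \<open>2 * q / \<theta>\<^sup>2\<close>, so q cancels.\<close>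
    also have "(\<gamma> / 2)\<^sup>2 - 2 * (q - p) / \<theta>\<^sup>2 = P"
      using rootsq by (simp add: P_def gamma power2_eq_square algebra_simps add_divide_distrib diff_divide_distrib)
    finally show ?thesis .
  qed
  have \<gamma>2: "\<gamma> \<ge> 2" using q_nonneg by (simp add: gamma)
  have Ppos: "P > 0" using \<gamma>2 p_nonneg by (simp add: P_def add_pos_nonneg)
  \<comment> \<open>For real w this is the positivity of \<open>P\<close>, the difference of the
    squares of \<gamma>/2 and w; otherwise the real part is 0.\<close>
  have Rew: "\<bar>Re w\<bar> < \<gamma> / 2"
  proof (cases "q \<ge> p")
    case True
    have wr: "w = of_real (sqrt (2 * (q - p)) / \<theta>)" using True by (simp add: w_def csqrt_of_real_nonneg)
    have "(sqrt (2 * (q - p)) / \<theta>)\<^sup>2 = (\<gamma> / 2)\<^sup>2 - P"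
    proof -
      have "complex_of_real ((\<gamma> / 2)\<^sup>2 - P) = w\<^sup>2"
        by (simp add: prod[symmetric] \<alpha>w \<beta>w algebra_simps power2_eq_square)
      also have "\<dots> = of_real ((sqrt (2 * (q - p)) / \<theta>)\<^sup>2)" by (simp add: wr)
      finally show ?thesis by (simp only: of_real_eq_iff)
    qed
    then have "(sqrt (2 * (q - p)) / \<theta>)\<^sup>2 < (\<gamma> / 2)\<^sup>2" using Ppos by simp
    then have "sqrt (2 * (q - p)) / \<theta> < \<gamma> / 2" by (rule power2_less_imp_less) (use \<gamma>2 in simp)
    then show ?thesis using True theta_pos by (simp add: wr)
  next
    case False
    then have "w = of_real (1 / \<theta>) * (\<i> * of_real (sqrt \<bar>2 * (q - p)\<bar>))"
      unfolding w_def by (subst csqrt_of_real_nonpos) auto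
    then have "Re w = 0" by simp
    then show ?thesis using \<gamma>2 by simp
  qed
  have Re: "Re \<alpha> > 0" "Re \<beta> > 0" using Rew by (auto simp: \<alpha>w \<beta>w)
  obtain A where A: "\<And>n. Gamma (\<alpha> + of_nat n) * Gamma (\<beta> + of_nat n) / (of_real (Gamma (\<gamma> + real n)) * fact n) = of_real (A n)"
    and Apos: "\<And>n. A n > 0"
    and rec: "\<And>n. A (Suc n) * (real n + 1) * (\<gamma> + real n) = A n * ((real n)\<^sup>2 + \<gamma> * real n + P)"
    and lim: "(\<lambda>n. real n * A n) \<longlonglongrightarrow> 1"
    by (rule euler_coefficients_real[OF Re sum prod Ppos]) (rule that; assumption)
  define z where "z = 1 - exp (- \<theta> * x)"
  have z: "0 < z" "z < 1" using x_pos theta_pos by (auto simp: z_def)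
  define u where "u x = (1 - exp (- \<theta> * x)) powr (\<gamma> / 2) * (\<Sum>n. A n * (1 - exp (- \<theta> * x)) ^ n) / (x * \<theta>)" for x
  note green = hypergeometric_green_equation[OF theta_pos p_nonneg q_nonneg gamma P_def Apos rec lim, folded u_def]
  have um: "u \<in> borel_measurable borel" unfolding u_def[abs_def] by measurable
  have "(\<integral>\<omega>. exp_neg (I_hat \<theta> R p q \<omega>) \<partial>M)
    = (\<integral>\<omega>. exp_neg (\<integral>\<^sup>+s\<in>{0<..}. ennreal (bessel_potential \<theta> p q (R (max 0 s) \<omega>)) \<partial>lborel) \<partial>M)"
  proof (rule integral_cong_AE)
    \<comment> \<open>The values of \<open>R\<close> at negative times are unconstrained, so
      measurability is established for the version with \<open>max 0 s\<close>, which has the same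
      integral.\<close>
    have "I_hat \<theta> R p q = (\<lambda>\<omega>. \<integral>\<^sup>+s\<in>{0..}. (ennreal p / ennreal (exp (\<theta> * R (max 0 s) \<omega>) - 1) +
        ennreal q / ennreal ((exp (\<theta> * R (max 0 s) \<omega>) - 1)\<^sup>2)) \<partial>lborel)"
      unfolding I_hat_def by (intro ext nn_integral_cong) (auto simp: indicator_def max_absorb2)
    then have [measurable]: "I_hat \<theta> R p q \<in> borel_measurable M" by simp
    show "(\<lambda>\<omega>. exp_neg (I_hat \<theta> R p q \<omega>)) \<in> borel_measurable M" by measurable
    show "(\<lambda>\<omega>. exp_neg (\<integral>\<^sup>+s\<in>{0<..}. ennreal (bessel_potential \<theta> p q (R (max 0 s) \<omega>)) \<partial>lborel)) \<in> borel_measurable M"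
      by measurable
    show "AE \<omega> in M. exp_neg (I_hat \<theta> R p q \<omega>) =
        exp_neg (\<integral>\<^sup>+s\<in>{0<..}. ennreal (bessel_potential \<theta> p q (R (max 0 s) \<omega>)) \<partial>lborel)"
      using I_hat_eq_potential[OF bessel x_pos theta_pos p_nonneg q_nonneg] by eventually_elim simp
  qed
  also have "\<dots> = u x"
    by (rule feynman_kac_total[OF bessel_potential_measurable um bessel_potential_isCont[OF theta_pos]
          bessel_potential_nonneg[OF theta_pos p_nonneg q_nonneg]
          bessel_potential_antimono[OF theta_pos p_nonneg q_nonneg] green(2,3,1)
          bessel_green_potential_finite[OF theta_pos p_nonneg q_nonneg x_pos]])
  finally have expectation: "(\<integral>\<omega>. exp_neg (I_hat \<theta> R p q \<omega>) \<partial>M) = u x" .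
  define S where "S = (\<Sum>n. A n * z ^ n)"
  have S: "(\<Sum>n. complex_of_real (A n) * of_real z ^ n) = of_real S"
    using summable_power_series_harmonic[OF lim, of z] z
    unfolding S_def by (subst suminf_of_real) simp_all
  have ux: "complex_of_real (u x) = of_real (z powr (\<gamma> / 2)) / of_real (x * \<theta>) * of_real S"
    by (simp add: u_def S_def z_def)
  have nz: "Gamma \<alpha> \<noteq> 0" "Gamma \<beta> \<noteq> 0" "Gamma \<gamma> \<noteq> 0"
    using not_nonpos_Ints_Re_pos[OF Re(1)] not_nonpos_Ints_Re_pos[OF Re(2)] Gamma_real_pos[of \<gamma>] \<gamma>2
    by (auto simp: Gamma_eq_zero_iff)
  \<comment> \<open>The Gamma quotient of the prefactor is the inverse of the one inside
    \<open>gauss_F\<close>, so both closed forms reduce to the bare series with coefficients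
    \<open>A\<close>.\<close>
  have F: "Gamma \<alpha> * Gamma \<beta> / of_real (Gamma \<gamma>) * gauss_F \<alpha> \<beta> \<gamma> z = of_real S"
  proof -
    have "gauss_F \<alpha> \<beta> \<gamma> z = of_real (Gamma \<gamma>) / (Gamma \<beta> * Gamma \<alpha>) *
       (\<Sum>n. complex_of_real (A n) * of_real z ^ n)"
      unfolding gauss_F_def A[symmetric] by simp
    then show ?thesis using nz by (simp add: S)
  qed
  have series: "complex_of_real (z powr (\<gamma> / 2)) * Gamma \<alpha> * Gamma \<beta> / complex_of_real (x * \<theta> * Gamma \<gamma>)
      * gauss_F \<alpha> \<beta> \<gamma> z = of_real (u x)"
  proof -
    have "complex_of_real (z powr (\<gamma> / 2)) * Gamma \<alpha> * Gamma \<beta> / complex_of_real (x * \<theta> * Gamma \<gamma>) * gauss_F \<alpha> \<beta> \<gamma> z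
      = of_real (z powr (\<gamma> / 2)) / of_real (x * \<theta>) * (Gamma \<alpha> * Gamma \<beta> / of_real (Gamma \<gamma>) * gauss_F \<alpha> \<beta> \<gamma> z)"
      by simp
    then show ?thesis by (simp only: F ux)
  qed
  have integral: "(LBINT t:{0..1}. complex_of_real t powr (\<alpha> - 1) * complex_of_real (1 - t) powr (\<beta> - 1)
              * complex_of_real (1 - t * z) powr (\<alpha> - complex_of_real \<gamma>)) = of_real S"
  proof -
    have "Gamma (complex_of_real \<gamma> + of_nat n) = of_real (Gamma (\<gamma> + real n))" for n
      by (metis Gamma_complex_of_real of_real_add of_real_of_nat_eq)
    then show ?thesis
      unfolding euler_integral_hypergeometric[OF Re sum z] by (simp add: A S)
  qed
  have "complex_of_real (z powr (\<gamma> / 2) / (x * \<theta>)) * of_real S = of_real (u x)"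
    by (simp add: ux)
  with series integral expectation sum show ?thesis
    unfolding z_def by simp
qed

end
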